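(* Let $U$ be an open subset of a complex Banach space $E$, let $F$ be a complex Banach space and let $f\in\mathcal{H}^\infty(U,F)$. The following are equivalent: (1) $f\colon U\to F$ has relatively weakly compact range. (2) $T_f\colon\mathcal{G}^\infty(U)\to F$ is weakly compact. (3) There exist a reflexive complex Banach space $G$, a continuous linear operator $T\colon G\to F$ and a mapping $g\in\mathcal{H}^\infty(U,G)$ such that $f=T\circ g$. (4) $f^t\colon F^*\to\mathcal{H}^\infty(U)$ is weakly compact. (5) $f^t\colon F^*\to\mathcal{H}^\infty(U)$ is weak*-to-weak continuous.
   Context: $\mathcal{H}^\infty(U,F)$ is the Banach space of all bounded holomorphic mappings $f\colon U\to F$ with the supremum norm $\|f\|_\infty=\sup_{x\in U}\|f(x)\|$, and $\mathcal{H}^\infty(U)=\mathcal{H}^\infty(U,\mathbb{C})$. For $x\in U$, $\delta(x)\in\mathcal{H}^\infty(U)^*$ is the evaluation functional $\delta(x)(g)=g(x)$. $\mathcal{G}^\infty(U)$ is the norm-closed linear span of $\{\delta(x)\colon x\in U\}$ in $\mathcal{H}^\infty(U)^*$, and $\delta_U\colon U\to\mathcal{G}^\infty(U)$ is $\delta_U(x)=\delta(x)$. By Mujica's linearization theorem, $\delta_U$ is holomorphic and for each $f\in\mathcal{H}^\infty(U,F)$ there is a unique continuous linear operator $T_f\colon\mathcal{G}^\infty(U)\to F$ with $T_f\circ\delta_U=f$. The transpose of $f$ is the linear mapping $f^t\colon F^*\to\mathcal{H}^\infty(U)$, $f^t(\varphi)=\varphi\circ f$. A bounded linear operator between Banach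 spaces is weakly compact if the image of the closed unit ball is relatively weakly compact (its weak closure is weakly compact). In (5), $F^*$ carries the weak* topology and $\mathcal{H}^\infty(U)$ its weak topology as a Banach space. *)

theory Defs
  imports "HOL-Analysis.Analysis" "HOL-Library.Function_Algebras"
begin

section \<open>Complex vector spaces\<close>

class complex_vector = ab_group_add +
  fixes scaleC :: "complex \<Rightarrow> 'a \<Rightarrow> 'a" (infixr "*\<^sub>C" 75)
  assumes scaleC_add_right: "a *\<^sub>C (x + y) = a *\<^sub>C x + a *\<^sub>C y"
    and scaleC_add_left: "(a + b) *\<^sub>C x = a *\<^sub>C x + b *\<^sub>C x"
    and scaleC_scaleC: "a *\<^sub>C b *\<^sub>C x = (a * b) *\<^sub>C x"
    and scaleC_one: "1 *\<^sub>C x = x"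

global_interpretation complex_vector:
    vector_space "scaleC :: complex \<Rightarrow> 'a \<Rightarrow> 'a::complex_vector"
  defines complex_subspace = complex_vector.subspace
    and complex_span = complex_vector.span
  by standard (simp_all add: scaleC_add_right scaleC_add_left scaleC_scaleC scaleC_one)

instantiation complex :: complex_vector
begin
definition "scaleC (a::complex) (x::complex) = a * x"
instance by standard (simp_all add: scaleC_complex_def algebra_simps)
end

instantiation "fun" :: (type, complex_vector) complex_vector
begin
definition "scaleC a f = (\<lambda>x. a *\<^sub>C f x)"
instance
  by standard
    (simp_all add: scaleC_fun_def fun_eq_iff scaleC_add_right scaleC_add_left
      scaleC_scaleC scaleC_one)
end


section \<open>Complex normed and Banach spaces\<close>

text \<open>
  A normed space is a linear subspace of an ambient complex vector space together with a
  norm, whose values off the subspace are irrelevant.  Spaces such as the dual of a given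
  space or the bounded holomorphic mappings on a given open set depend on
  parameters and therefore cannot be types.
\<close>

record 'a cnspace =
  vecs :: "'a set"
  nrm :: "'a \<Rightarrow> real"

text \<open>The case distinction is there because \<^locale>\<open>Metric_space\<close> asks for
  nonnegativity and symmetry on the whole type.\<close>

definition ndist :: "'a::complex_vector cnspace \<Rightarrow> 'a \<Rightarrow> 'a \<Rightarrow> real" where
  "ndist X x y = (if x \<in> vecs X \<and> y \<in> vecs X then nrm X (x - y) else 0)"

locale complex_normed_space =
  fixes X :: "'a::complex_vector cnspace"
  assumes subspace: "complex_subspace (vecs X)"
    and nrm_ge_0: "x \<in> vecs X \<Longrightarrow> 0 \<le> nrm X x"
    and nrm_eq_0_iff: "x \<in> vecs X \<Longrightarrow> nrm X x = 0 \<longleftrightarrow> x = 0"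
    and nrm_scaleC: "x \<in> vecs X \<Longrightarrow> nrm X (a *\<^sub>C x) = cmod a * nrm X x"
    and nrm_triangle: "x \<in> vecs X \<Longrightarrow> y \<in> vecs X \<Longrightarrow> nrm X (x + y) \<le> nrm X x + nrm X y"

sublocale complex_normed_space \<subseteq> Metric_space "vecs X" "ndist X"
proof
  have diff: "x - y \<in> vecs X" if "x \<in> vecs X" "y \<in> vecs X" for x y
    using complex_vector.subspace_diff[OF subspace that] .
  show "0 \<le> ndist X x y" for x y
    unfolding ndist_def using nrm_ge_0[OF diff] by auto
  show "ndist X x y = ndist X y x" for x y
  proof (cases "x \<in> vecs X \<and> y \<in> vecs X")
    case True
    have "(- 1) *\<^sub>C (x - y) = - (1 *\<^sub>C (x - y))"
      by (rule complex_vector.scale_minus_left)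
    then have "(- 1) *\<^sub>C (x - y) = y - x"
      by (simp only: scaleC_one minus_diff_eq)
    with True nrm_scaleC[OF diff, of x y "- 1"] show ?thesis
      by (simp add: ndist_def)
  qed (auto simp: ndist_def)
  show "ndist X x y = 0 \<longleftrightarrow> x = y" if "x \<in> vecs X" "y \<in> vecs X" for x y
    unfolding ndist_def using that nrm_eq_0_iff[OF diff[OF that]] by simp
  show "ndist X x z \<le> ndist X x y + ndist X y z"
    if "x \<in> vecs X" "y \<in> vecs X" "z \<in> vecs X" for x y z
  proof -
    have "nrm X ((x - y) + (y - z)) \<le> nrm X (x - y) + nrm X (y - z)"
      using nrm_triangle[OF diff[OF that(1,2)] diff[OF that(2,3)]] .
    then show ?thesis
      unfolding ndist_def using that by simp
  qed
qed

locale complex_banach_space = complex_normed_space +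
  assumes complete: "mcomplete"

definition norm_topology :: "'a::complex_vector cnspace \<Rightarrow> 'a topology" where
  "norm_topology X = Metric_space.mtopology (vecs X) (ndist X)"

definition unit_ball :: "'a cnspace \<Rightarrow> 'a set" where
  "unit_ball X = {x \<in> vecs X. nrm X x \<le> 1}"

definition complex_field :: "complex cnspace" where
  "complex_field = \<lparr>vecs = UNIV, nrm = cmod\<rparr>"


section \<open>Bounded operators, duals and reflexivity\<close>

text \<open>Maps defined on a subset of a type are extended by zero, so that a map is
  determined by its values on the subset and the pointwise operations of function types
  are those of the mapping spaces.\<close>

definition bounded_ops ::
    "'a::complex_vector cnspace \<Rightarrow> 'b::complex_vector cnspace \<Rightarrow> ('a \<Rightarrow> 'b) set" where
  "bounded_ops X Y = {T.
      (\<forall>x\<in>vecs X. T x \<in> vecs Y) \<and>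
      (\<forall>x\<in>vecs X. \<forall>y\<in>vecs X. T (x + y) = T x + T y) \<and>
      (\<forall>a. \<forall>x\<in>vecs X. T (a *\<^sub>C x) = a *\<^sub>C T x) \<and>
      (\<exists>K. \<forall>x\<in>vecs X. nrm Y (T x) \<le> K * nrm X x) \<and>
      (\<forall>x. x \<notin> vecs X \<longrightarrow> T x = 0)}"

definition dual :: "'a::complex_vector cnspace \<Rightarrow> ('a \<Rightarrow> complex) cnspace" where
  "dual X = \<lparr>vecs = bounded_ops X complex_field,
             nrm = (\<lambda>\<phi>. SUP x\<in>unit_ball X. cmod (\<phi> x))\<rparr>"

definition eval_at :: "('a \<Rightarrow> complex) cnspace \<Rightarrow> 'a \<Rightarrow> ('a \<Rightarrow> complex) \<Rightarrow> complex" where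
  "eval_at S x = (\<lambda>g. if g \<in> vecs S then g x else 0)"

text \<open>Reflexivity: the canonical embedding into the bidual is onto.\<close>

definition reflexive :: "'a::complex_vector cnspace \<Rightarrow> bool" where
  "reflexive X \<longleftrightarrow> eval_at (dual X) ` vecs X = vecs (dual (dual X))"


section \<open>Weak topologies and weak compactness\<close>

definition weak_topology :: "'a::complex_vector cnspace \<Rightarrow> 'a topology" where
  "weak_topology X = topology_generated_by
     {{x \<in> vecs X. \<phi> x \<in> W} | \<phi> W. \<phi> \<in> vecs (dual X) \<and> open W}"

definition weak_star_topology :: "'a::complex_vector cnspace \<Rightarrow> ('a \<Rightarrow> complex) topology" where
  "weak_star_topology X = topology_generated_by
     {{\<phi> \<in> vecs (dual X). \<phi> x \<in> W} | x W. x \<in> vecs X \<and> open W}"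

definition relatively_weakly_compact :: "'a::complex_vector cnspace \<Rightarrow> 'a set \<Rightarrow> bool" where
  "relatively_weakly_compact X S \<longleftrightarrow>
     S \<subseteq> vecs X \<and> compactin (weak_topology X) (weak_topology X closure_of S)"

definition weakly_compact_op ::
    "'a::complex_vector cnspace \<Rightarrow> 'b::complex_vector cnspace \<Rightarrow> ('a \<Rightarrow> 'b) \<Rightarrow> bool" where
  "weakly_compact_op X Y T \<longleftrightarrow>
     T \<in> bounded_ops X Y \<and> relatively_weakly_compact Y (T ` unit_ball X)"


section \<open>Bounded holomorphic mappings\<close>

text \<open>Holomorphy on an open set \<open>U\<close>: at every point there is a complex
  Frechet derivative.\<close>

definition holomorphic_map ::
    "'a::complex_vector cnspace \<Rightarrow> 'a set \<Rightarrow> 'b::complex_vector cnspace \<Rightarrow> ('a \<Rightarrow> 'b) \<Rightarrow> bool" where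
  "holomorphic_map E U F f \<longleftrightarrow>
     (\<forall>x\<in>U. f x \<in> vecs F) \<and>
     (\<forall>x\<in>U. \<exists>A\<in>bounded_ops E F. \<forall>\<epsilon>>0. \<exists>\<delta>>0. \<forall>y\<in>U.
        nrm E (y - x) < \<delta> \<longrightarrow> nrm F (f y - f x - A (y - x)) \<le> \<epsilon> * nrm E (y - x))"

text \<open>The inserted 0 only matters for empty \<open>U\<close>.\<close>

definition Hinf ::
    "'a::complex_vector cnspace \<Rightarrow> 'a set \<Rightarrow> 'b::complex_vector cnspace \<Rightarrow> ('a \<Rightarrow> 'b) cnspace" where
  "Hinf E U F = \<lparr>vecs = {f. holomorphic_map E U F f \<and>
                           (\<exists>K. \<forall>x\<in>U. nrm F (f x) \<le> K) \<and>
                           (\<forall>x. x \<notin> U \<longrightarrow> f x = 0)},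
                 nrm = (\<lambda>f. Sup (insert 0 ((\<lambda>x. nrm F (f x)) ` U)))\<rparr>"

abbreviation Hinf_scalar ::
    "'a::complex_vector cnspace \<Rightarrow> 'a set \<Rightarrow> ('a \<Rightarrow> complex) cnspace" where
  "Hinf_scalar E U \<equiv> Hinf E U complex_field"

definition delta ::
    "'a::complex_vector cnspace \<Rightarrow> 'a set \<Rightarrow> 'a \<Rightarrow> ('a \<Rightarrow> complex) \<Rightarrow> complex" where
  "delta E U x = eval_at (Hinf_scalar E U) x"

definition Ginf ::
    "'a::complex_vector cnspace \<Rightarrow> 'a set \<Rightarrow> (('a \<Rightarrow> complex) \<Rightarrow> complex) cnspace" where
  "Ginf E U = \<lparr>vecs = norm_topology (dual (Hinf_scalar E U)) closure_of
                        complex_span (delta E U ` U),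
               nrm = nrm (dual (Hinf_scalar E U))\<rparr>"

text \<open>The operator given by Mujica's linearization theorem.\<close>

definition linearization ::
    "'a::complex_vector cnspace \<Rightarrow> 'a set \<Rightarrow> 'b::complex_vector cnspace \<Rightarrow> ('a \<Rightarrow> 'b)
      \<Rightarrow> (('a \<Rightarrow> complex) \<Rightarrow> complex) \<Rightarrow> 'b" where
  "linearization E U F f =
     (THE T. T \<in> bounded_ops (Ginf E U) F \<and> (\<forall>x\<in>U. T (delta E U x) = f x))"

text \<open>Since functionals vanish at 0, \<open>\<phi> \<circ> f\<close> is again zero off \<open>U\<close>
  when \<open>f\<close> is.\<close>

definition transpose_map ::
    "'b::complex_vector cnspace \<Rightarrow> ('a \<Rightarrow> 'b) \<Rightarrow> ('b \<Rightarrow> complex) \<Rightarrow> 'a \<Rightarrow> complex" where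
  "transpose_map F f = (\<lambda>\<phi>. if \<phi> \<in> vecs (dual F) then \<phi> \<circ> f else 0)"

text \<open>An existential quantifier over \<open>G\<close> ranges over the spaces inside one
  fixed ambient type.  The ambient type of \<open>F\<close> is always large enough, because the
  reflexive space of the Davis--Figiel--Johnson--Pelczynski construction is a renormed
  subspace of \<open>F\<close>; for the converse direction \<open>G\<close> should range over an
  arbitrary type.\<close>

definition factors_through ::
    "'a::complex_vector cnspace \<Rightarrow> 'a set \<Rightarrow> 'b::complex_vector cnspace \<Rightarrow> ('a \<Rightarrow> 'b)
      \<Rightarrow> 'g::complex_vector cnspace \<Rightarrow> bool" where
  "factors_through E U F f G \<longleftrightarrow>
     (\<exists>T\<in>bounded_ops G F. \<exists>g\<in>vecs (Hinf E U G). f = T \<circ> g)"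

end

theory Submission
  imports Defs "HOL-Complex_Analysis.Cauchy_Integral_Formula"
begin

text \<open>Let \<open>H\<close> be the space of bounded holomorphic functions on \<open>U\<close>.  The adjoint of the transpose of
  \<open>f\<close> maps the dual of \<open>H\<close> to the bidual of \<open>F\<close>.  Each of the five conditions is equivalent to the
  condition \<open>representable\<close>: every value of this adjoint is the evaluation at a point of \<open>F\<close>.

  If the range of \<open>f\<close> is relatively weakly compact, this is Krein's theorem in the form
  \<open>krein_evaluation\<close>: a functional on the dual of \<open>F\<close> which is dominated by the supremum over a
  relatively weakly compact set is an evaluation.  A functional that is not an evaluation takes a
  fixed value \<open>\<theta> > 0\<close> at suitable functionals in the unit ball that vanish at prescribed finitely
  many points (\<open>not_evaluation_functionals\<close>, from Hahn-Banach and completeness); an inductive choice of such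
  functionals, together with finite nets, gives a pointwise null sequence on a compact set, and
  \<open>convex_combination_uniformly_small\<close> produces a uniformly small convex combination, at which the
  value \<open>\<theta>\<close> is impossible.

  Conversely, if the condition holds, then the adjoint, regarded as a map to \<open>F\<close>, is continuous
  from the weak* to the weak topology, so by the Banach-Alaoglu theorem it maps the unit ball to a
  weakly compact set; it extends the linearization, whose image of the unit ball contains the range
  of \<open>f\<close>.  The condition is also a reformulation of the weak*-to-weak continuity of the transpose,
  which implies weak compactness of the transpose by Banach-Alaoglu.  If the transpose is weakly
  compact, a cluster point argument with \<open>not_evaluation_functionals\<close> leads back, since functions
  in \<open>H\<close> are determined by their values on \<open>U\<close>.  If \<open>f\<close> factors through a reflexive space, the
  adjoint takes its values in \<open>F\<close> because it passes through that space.

  The factorization of a map with relatively weakly compact range uses the construction of Davis,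
  Figiel, Johnson and Pelczynski.  Its norms are defined by duality from \<open>2\<^sup>n\<close> times the supremum
  of \<open>\<phi> \<circ> f\<close> plus \<open>2\<^sup>-\<^sup>n\<close> times the norm of \<open>\<phi>\<close>.  Krein's theorem shows that every functional on the
  dual of the new space \<open>G\<close>, restricted to functionals that extend to \<open>F\<close>, is the evaluation at a
  point of \<open>G\<close>; square summability shows that the functionals that extend to \<open>F\<close> are dense in the
  dual of \<open>G\<close>.  So \<open>G\<close> is reflexive.  Finally \<open>f\<close> is holomorphic as a map to \<open>G\<close>, because Cauchy
  estimates control the remainders of \<open>\<phi> \<circ> f\<close> by the supremum of \<open>\<phi> \<circ> f\<close>, and this is what bounds
  the norm of \<open>G\<close>.\<close>

section \<open>The Hahn-Banach theorem\<close>

definition sublinear_on :: "'a::complex_vector set \<Rightarrow> ('a \<Rightarrow> real) \<Rightarrow> bool" where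
  "sublinear_on V q \<longleftrightarrow>
     (\<forall>x\<in>V. \<forall>y\<in>V. q (x + y) \<le> q x + q y) \<and>
     (\<forall>t>0. \<forall>x\<in>V. q (of_real t *\<^sub>C x) \<le> t * q x)"

lemma scaleC_inverse_cancel:
  fixes x :: "'a::complex_vector"
  assumes "0 < t" shows "of_real (inverse t) *\<^sub>C (of_real t *\<^sub>C x) = x"
proof -
  have "of_real (inverse t) *\<^sub>C (of_real t *\<^sub>C x) = (of_real (inverse t) * of_real t) *\<^sub>C x"
    by (rule scaleC_scaleC)
  also have "of_real (inverse t) * of_real t = (1::complex)"
    using assms by (simp flip: of_real_mult)
  finally show ?thesis by (simp only: scaleC_one)
qed

lemma sublinear_on_scale:
  assumes "sublinear_on V q" "complex_subspace V" "x \<in> V" "0 < t"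
  shows "q (of_real t *\<^sub>C x) = t * q x"
proof (rule antisym)
  show "q (of_real t *\<^sub>C x) \<le> t * q x"
    using assms by (auto simp: sublinear_on_def)
  have tx: "of_real t *\<^sub>C x \<in> V"
    using assms complex_vector.subspace_scale by blast
  have "q (of_real s *\<^sub>C y) \<le> s * q y" if "0 < s" "y \<in> V" for s y
    using assms(1) that unfolding sublinear_on_def by blast
  from this[OF _ tx, of "inverse t"]
  have "q x \<le> inverse t * q (of_real t *\<^sub>C x)"
    using \<open>0 < t\<close> by (simp only: scaleC_inverse_cancel positive_imp_inverse_positive)
  then show "t * q x \<le> q (of_real t *\<^sub>C x)"
    using \<open>0 < t\<close> by (simp add: field_simps)
qed

lemma sublinear_on_zero:
  assumes "sublinear_on V q" "complex_subspace V"
  shows "q 0 = 0"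
proof -
  have "0 \<in> V" using assms complex_vector.subspace_0 by blast
  from sublinear_on_scale[OF assms this, of 2] show ?thesis
    by (simp only: complex_vector.scale_zero_right) simp
qed

text \<open>Hahn-Banach is reduced to infima of families of functions: of a chain of sublinear
  functionals, of the family that tests minimality, and of the family that builds in the functional
  to be extended.  Joint sublinearity of the family suffices for all three.\<close>

lemma sublinear_on_INF:
  assumes "I \<noteq> {}"
    and add: "\<And>i j x y. i \<in> I \<Longrightarrow> j \<in> I \<Longrightarrow> x \<in> V \<Longrightarrow> y \<in> V \<Longrightarrow> \<exists>k\<in>I. Q k (x + y) \<le> Q i x + Q j y"
    and scale: "\<And>i x t. i \<in> I \<Longrightarrow> x \<in> V \<Longrightarrow> 0 < t \<Longrightarrow> \<exists>k\<in>I. Q k (of_real t *\<^sub>C x) \<le> t * Q i x"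
    and bdd: "\<And>x. x \<in> V \<Longrightarrow> bdd_below ((\<lambda>i. Q i x) ` I)"
    and V: "complex_subspace V"
  shows "sublinear_on V (\<lambda>x. if x \<in> V then INF i\<in>I. Q i x else 0)"
  unfolding sublinear_on_def
proof (intro conjI ballI allI impI)
  define q where "q x = (INF i\<in>I. Q i x)" for x
  have low: "q x \<le> Q i x" if "x \<in> V" "i \<in> I" for x i
    unfolding q_def using bdd[OF that(1)] that(2) by (rule cINF_lower)
  fix x y assume x: "x \<in> V"
  show "(if of_real t *\<^sub>C x \<in> V then INF i\<in>I. Q i (of_real t *\<^sub>C x) else 0)
      \<le> t * (if x \<in> V then INF i\<in>I. Q i x else 0)" if t: "0 < t" for t
  proof -
    have tx: "of_real t *\<^sub>C x \<in> V" using V x complex_vector.subspace_scale by blast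
    have "q (of_real t *\<^sub>C x) / t \<le> q x"
      unfolding q_def[of x]
    proof (rule cINF_greatest[OF \<open>I \<noteq> {}\<close>])
      fix i assume "i \<in> I"
      then obtain k where "k \<in> I" "Q k (of_real t *\<^sub>C x) \<le> t * Q i x" using scale x t by blast
      then show "q (of_real t *\<^sub>C x) / t \<le> Q i x"
        using low[OF tx \<open>k \<in> I\<close>] t by (simp add: field_simps)
    qed
    then show ?thesis using x tx t by (simp add: q_def field_simps)
  qed
  assume y: "y \<in> V"
  have xy: "x + y \<in> V" using V x y complex_vector.subspace_add by blast
  have "q (x + y) - Q i x \<le> q y" if i: "i \<in> I" for i
    unfolding q_def[of y]
  proof (rule cINF_greatest[OF \<open>I \<noteq> {}\<close>])
    fix j assume "j \<in> I"
    then obtain k where "k \<in> I" "Q k (x + y) \<le> Q i x + Q j y" using add i x y by blast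
    then show "q (x + y) - Q i x \<le> Q j y" using low[OF xy \<open>k \<in> I\<close>] by simp
  qed
  then have "q (x + y) - q y \<le> q x"
    unfolding q_def[of x] using \<open>I \<noteq> {}\<close> by (intro cINF_greatest) (auto simp: algebra_simps)
  then show "(if x + y \<in> V then INF i\<in>I. Q i (x + y) else 0)
      \<le> (if x \<in> V then INF i\<in>I. Q i x else 0) + (if y \<in> V then INF i\<in>I. Q i y else 0)"
    using x y xy by (simp add: q_def)
qed

text \<open>A sublinear functional below \<open>p\<close> is at least \<open>- p (- x)\<close>, so chains have pointwise infima and
  Zorn's lemma applies.  The functions are made zero off \<open>V\<close> so that the pointwise order is
  antisymmetric.\<close>

lemma minimal_sublinear_below:
  assumes p: "sublinear_on V p" and V: "complex_subspace V"
  shows "\<exists>q. sublinear_on V q \<and> (\<forall>x\<in>V. q x \<le> p x) \<and>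
    (\<forall>r. sublinear_on V r \<longrightarrow> (\<forall>x\<in>V. r x \<le> q x) \<longrightarrow> (\<forall>x\<in>V. r x = q x))"
proof -
  define A where "A = {q. sublinear_on V q \<and> (\<forall>x\<in>V. q x \<le> p x) \<and> (\<forall>x. x \<notin> V \<longrightarrow> q x = 0)}"
  define P where "P = (\<lambda>q r::'a \<Rightarrow> real. \<forall>x. r x \<le> q x)"
  have lower: "- p (- x) \<le> q x" if "q \<in> A" "x \<in> V" for q x
  proof -
    have mx: "- x \<in> V" using V that(2) complex_vector.subspace_neg by blast
    have "q (x + (- x)) \<le> q x + q (- x)"
      using that mx unfolding A_def sublinear_on_def by blast
    moreover have "q 0 = 0" using that V sublinear_on_zero unfolding A_def by blast
    moreover have "q (- x) \<le> p (- x)" using that mx unfolding A_def by blast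
    ultimately show ?thesis by simp
  qed
  have "\<exists>m\<in>A. \<forall>a\<in>A. P m a \<longrightarrow> a = m"
  proof (rule predicate_Zorn)
    show "partial_order_on A (relation_of P A)"
      unfolding partial_order_on_def preorder_on_def refl_on_def trans_def antisym_def relation_of_def P_def
      by (auto intro: order_trans simp: fun_eq_iff) (meson order_trans order_antisym)+
  next
    fix C assume C: "C \<in> Chains (relation_of P A)"
    then have CA: "C \<subseteq> A" unfolding Chains_def relation_of_def by auto
    show "\<exists>u\<in>A. \<forall>a\<in>C. P a u"
    proof (cases "C = {}")
      case True
      have "(\<lambda>x. if x \<in> V then p x else 0) \<in> A"
        using p complex_vector.subspace_add[OF V] complex_vector.subspace_scale[OF V]
        unfolding A_def sublinear_on_def by auto
      then show ?thesis using True by auto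
    next
      case False
      have bdd: "bdd_below ((\<lambda>q. q x) ` C)" if "x \<in> V" for x
        using lower[OF _ that] CA by (intro bdd_belowI2[where m="- p (- x)"]) auto
      define u where "u = (\<lambda>x. if x \<in> V then INF q\<in>C. q x else 0)"
      have u: "sublinear_on V u"
        unfolding u_def
      proof (rule sublinear_on_INF[OF False _ _ bdd V])
        fix q r x y assume qr: "q \<in> C" "r \<in> C" "x \<in> V" "y \<in> V"
        then have "P q r \<or> P r q" using C unfolding Chains_def relation_of_def by auto
        then show "\<exists>k\<in>C. k (x + y) \<le> q x + r y"
        proof
          assume "P q r"
          moreover have "r (x + y) \<le> r x + r y"
            using qr CA unfolding A_def sublinear_on_def by blast
          ultimately show ?thesis using qr unfolding P_def
            by (meson add_right_mono order_trans)
        next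
          assume "P r q"
          moreover have "q (x + y) \<le> q x + q y"
            using qr CA unfolding A_def sublinear_on_def by blast
          ultimately show ?thesis using qr unfolding P_def
            by (meson add_left_mono order_trans)
        qed
      next
        fix q x and t :: real assume "q \<in> C" "x \<in> V" "0 < t"
        then show "\<exists>k\<in>C. k (of_real t *\<^sub>C x) \<le> t * q x"
          using CA unfolding A_def sublinear_on_def by blast
      qed auto
      have le: "u x \<le> q x" if "q \<in> C" for q x
      proof (cases "x \<in> V")
        case True
        then show ?thesis unfolding u_def using cINF_lower[OF bdd[OF True] that] True by simp
      next
        case False
        then show ?thesis using that CA unfolding u_def A_def by auto
      qed
      obtain q0 where "q0 \<in> C" using False by blast
      have "u x \<le> p x" if "x \<in> V" for x
        using le[OF \<open>q0 \<in> C\<close>, of x] CA \<open>q0 \<in> C\<close> that unfolding A_def by fastforce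
      then have "u \<in> A"
        using u unfolding A_def by (simp add: u_def)
      then show ?thesis using le unfolding P_def by blast
    qed
  qed
  then obtain q where q: "q \<in> A" and min: "\<And>r. r \<in> A \<Longrightarrow> P q r \<Longrightarrow> r = q" by blast
  show ?thesis
  proof
    show "sublinear_on V q \<and> (\<forall>x\<in>V. q x \<le> p x) \<and>
      (\<forall>r. sublinear_on V r \<longrightarrow> (\<forall>x\<in>V. r x \<le> q x) \<longrightarrow> (\<forall>x\<in>V. r x = q x))"
    proof (intro conjI allI impI ballI)
      show "sublinear_on V q" and "\<And>x. x \<in> V \<Longrightarrow> q x \<le> p x" using q unfolding A_def by auto
      fix r x assume r: "sublinear_on V r" "\<forall>x\<in>V. r x \<le> q x" and x: "x \<in> V"
      define r' where "r' = (\<lambda>x. if x \<in> V then r x else 0)"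
      have "r' \<in> A"
        using r q complex_vector.subspace_add[OF V] complex_vector.subspace_scale[OF V]
        unfolding A_def r'_def sublinear_on_def by (auto intro: order_trans)
      moreover have "P q r'" using r q unfolding P_def r'_def A_def by auto
      ultimately have "r' = q" using min by blast
      then show "r x = q x" using x unfolding r'_def by (auto dest: fun_cong[of _ _ x])
    qed
  qed
qed

text \<open>The infimum over \<open>t \<ge> 0\<close> of \<open>q (y + t x) - t q x\<close> is sublinear in \<open>y\<close> and below \<open>q\<close>; by
  minimality it equals \<open>q\<close>, and \<open>t = 1\<close> gives the inequality that subadditivity lacks.\<close>

lemma minimal_sublinear_additive:
  assumes q: "sublinear_on V q" and V: "complex_subspace V"
    and min: "\<forall>r. sublinear_on V r \<longrightarrow> (\<forall>x\<in>V. r x \<le> q x) \<longrightarrow> (\<forall>x\<in>V. r x = q x)"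
    and x: "x \<in> V" and y: "y \<in> V"
  shows "q (x + y) = q x + q y"
proof (rule antisym)
  show "q (x + y) \<le> q x + q y" using q x y unfolding sublinear_on_def by blast
  define Q where "Q = (\<lambda>t::real. \<lambda>y. q (y + of_real t *\<^sub>C x) - t * q x)"
  have tx: "of_real t *\<^sub>C x \<in> V" for t :: real using V x complex_vector.subspace_scale by blast
  have qtx: "q (of_real t *\<^sub>C x) = t * q x" if "0 \<le> t" for t
    using sublinear_on_scale[OF q V x] sublinear_on_zero[OF q V] that
    by (cases "t = 0") (simp_all add: complex_vector.scale_zero_left)
  have bdd: "bdd_below ((\<lambda>t. Q t y) ` {0..})" if "y \<in> V" for y
  proof (rule bdd_belowI2[where m = "- q (- y)"])
    fix t :: real assume "t \<in> {0..}"
    have "q ((y + of_real t *\<^sub>C x) + - y) \<le> q (y + of_real t *\<^sub>C x) + q (- y)"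
      using q that tx V complex_vector.subspace_add complex_vector.subspace_neg
      unfolding sublinear_on_def by blast
    then show "- q (- y) \<le> Q t y" using qtx \<open>t \<in> {0..}\<close> unfolding Q_def by simp
  qed
  define r where "r = (\<lambda>y. if y \<in> V then INF t\<in>{0..}. Q t y else 0)"
  have "sublinear_on V r"
    unfolding r_def
  proof (rule sublinear_on_INF[OF _ _ _ bdd V])
    fix s t :: real and u v assume st: "s \<in> {0..}" "t \<in> {0..}" and uv: "u \<in> V" "v \<in> V"
    have "q ((u + of_real s *\<^sub>C x) + (v + of_real t *\<^sub>C x))
        \<le> q (u + of_real s *\<^sub>C x) + q (v + of_real t *\<^sub>C x)"
      using q uv tx V complex_vector.subspace_add unfolding sublinear_on_def by blast
    then have "Q (s + t) (u + v) \<le> Q s u + Q t v"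
      unfolding Q_def by (simp add: scaleC_add_left algebra_simps)
    then show "\<exists>k\<in>{0..}. Q k (u + v) \<le> Q s u + Q t v" using st by force
  next
    fix s t :: real and u assume s: "s \<in> {0..}" and u: "u \<in> V" and t: "0 < t"
    have "of_real t *\<^sub>C (u + of_real s *\<^sub>C x) = of_real t *\<^sub>C u + of_real (t * s) *\<^sub>C x"
      by (simp add: scaleC_add_right scaleC_scaleC)
    moreover have "q (of_real t *\<^sub>C (u + of_real s *\<^sub>C x)) = t * q (u + of_real s *\<^sub>C x)"
      using sublinear_on_scale[OF q V _ t] u tx V complex_vector.subspace_add by blast
    ultimately have "Q (t * s) (of_real t *\<^sub>C u) = t * Q s u"
      unfolding Q_def by (simp add: algebra_simps)
    then show "\<exists>k\<in>{0..}. Q k (of_real t *\<^sub>C u) \<le> t * Q s u"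
      using s t by (intro bexI[of _ "t * s"]) auto
  qed auto
  moreover have low: "r u \<le> Q t u" if "u \<in> V" "0 \<le> t" for u t
    unfolding r_def using that bdd[OF that(1)] by (auto intro: cINF_lower)
  moreover have "r u \<le> q u" if "u \<in> V" for u
    using low[OF that, of 0] by (simp add: Q_def complex_vector.scale_zero_left)
  ultimately have "r y = q y" using min y by blast
  moreover have "r y \<le> q (y + x) - q x"
    using low[OF y, of 1] by (simp add: Q_def scaleC_one)
  ultimately show "q x + q y \<le> q (x + y)" by (simp add: add.commute)
qed

text \<open>A real-linear functional below the infimal convolution of \<open>p\<close> and \<open>f\<close> extends \<open>f\<close>, and a
  minimal sublinear functional below it is linear on all of \<open>V\<close>.\<close>

lemma hahn_banach_real:
  assumes V: "complex_subspace V" and M: "complex_subspace M" and MV: "M \<subseteq> V"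
    and p: "sublinear_on V p"
    and fadd: "\<And>x y. x \<in> M \<Longrightarrow> y \<in> M \<Longrightarrow> f (x + y) = f x + f y"
    and fscale: "\<And>t x. x \<in> M \<Longrightarrow> f (of_real t *\<^sub>C x) = t * f x"
    and fp: "\<And>x. x \<in> M \<Longrightarrow> f x \<le> p x"
  obtains g where "\<And>x y. x \<in> V \<Longrightarrow> y \<in> V \<Longrightarrow> g (x + y) = g x + g y"
    "\<And>t x. x \<in> V \<Longrightarrow> g (of_real t *\<^sub>C x) = t * g x"
    "\<And>x. x \<in> M \<Longrightarrow> g x = f x" "\<And>x. x \<in> V \<Longrightarrow> g x \<le> p x"
proof -
  have f0: "f 0 = 0"
    using fscale[of 0 0] complex_vector.subspace_0[OF M] by (simp add: complex_vector.scale_zero_left)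
  have fneg: "f (- m) = - f m" if "m \<in> M" for m
    using fadd[of m "- m"] that M complex_vector.subspace_neg f0 by fastforce
  define Q where "Q = (\<lambda>m x. p (x - m) + f m)"
  have bdd: "bdd_below ((\<lambda>m. Q m x) ` M)" if "x \<in> V" for x
  proof (rule bdd_belowI2[where m = "- p (- x)"])
    fix m assume m: "m \<in> M"
    have "p ((x - m) + (- x)) \<le> p (x - m) + p (- x)"
      using p m MV that V complex_vector.subspace_diff complex_vector.subspace_neg
      unfolding sublinear_on_def by blast
    moreover have "f (- m) \<le> p (- m)" using m fp M complex_vector.subspace_neg by blast
    ultimately show "- p (- x) \<le> Q m x" using fneg[OF m] unfolding Q_def by simp
  qed
  define p0 where "p0 = (\<lambda>x. if x \<in> V then INF m\<in>M. Q m x else 0)"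
  have "sublinear_on V p0"
    unfolding p0_def
  proof (rule sublinear_on_INF[OF _ _ _ bdd V])
    show "M \<noteq> {}" using M complex_vector.subspace_0 by blast
    fix m n x y assume m: "m \<in> M" "n \<in> M" and x: "x \<in> V" "y \<in> V"
    have "p ((x - m) + (y - n)) \<le> p (x - m) + p (y - n)"
      using p m MV x V complex_vector.subspace_diff unfolding sublinear_on_def by blast
    then have "Q (m + n) (x + y) \<le> Q m x + Q n y"
      unfolding Q_def using fadd m by (simp add: algebra_simps)
    then show "\<exists>k\<in>M. Q k (x + y) \<le> Q m x + Q n y"
      using m M complex_vector.subspace_add by blast
  next
    fix m x and t :: real assume m: "m \<in> M" and x: "x \<in> V" and t: "0 < t"
    have "p (of_real t *\<^sub>C (x - m)) \<le> t * p (x - m)"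
      using p t m x MV V complex_vector.subspace_diff unfolding sublinear_on_def by blast
    then have "Q (of_real t *\<^sub>C m) (of_real t *\<^sub>C x) \<le> t * Q m x"
      unfolding Q_def using fscale m by (simp add: complex_vector.scale_right_diff_distrib algebra_simps)
    then show "\<exists>k\<in>M. Q k (of_real t *\<^sub>C x) \<le> t * Q m x"
      using m M complex_vector.subspace_scale by blast
  qed
  from minimal_sublinear_below[OF this V]
  obtain q where q: "sublinear_on V q" and qp: "\<And>x. x \<in> V \<Longrightarrow> q x \<le> p0 x"
    and min: "\<forall>r. sublinear_on V r \<longrightarrow> (\<forall>x\<in>V. r x \<le> q x) \<longrightarrow> (\<forall>x\<in>V. r x = q x)"
    by blast
  note add = minimal_sublinear_additive[OF q V min]
  have q0: "q 0 = 0" using sublinear_on_zero[OF q V] .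
  have neg: "q (- x) = - q x" if "x \<in> V" for x
    using add[OF that, of "- x"] that V complex_vector.subspace_neg q0 by fastforce
  have low: "p0 x \<le> p (x - m) + f m" if "x \<in> V" "m \<in> M" for x m
    using cINF_lower[OF bdd[OF that(1)] that(2)] that(1) by (simp add: Q_def p0_def)
  have p0: "p 0 = 0" using sublinear_on_zero[OF p V] .
  show ?thesis
  proof
    fix x assume x: "x \<in> V"
    show "q (x + y) = q x + q y" if "y \<in> V" for y using add x that .
    have pos: "q (of_real t *\<^sub>C x) = t * q x" if "0 < t" for t
      using sublinear_on_scale[OF q V x that] .
    show "q (of_real t *\<^sub>C x) = t * q x" for t
    proof (cases "0 < t" "t = 0" rule: case_split[case_product case_split])
      case False_False
      have "q (of_real (- t) *\<^sub>C x) = - t * q x" using pos[of "- t"] False_False by simp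
      moreover have "of_real (- t) *\<^sub>C x = - (of_real t *\<^sub>C x)"
        by (simp add: complex_vector.scale_minus_left)
      moreover have "of_real t *\<^sub>C x \<in> V" using V x complex_vector.subspace_scale by blast
      ultimately show ?thesis using neg by simp
    qed (use pos q0 in \<open>auto simp: complex_vector.scale_zero_left\<close>)
    show "q x \<le> p x"
      using qp[OF x] low[OF x, of 0] M complex_vector.subspace_0 f0 by fastforce
  next
    have le: "q m \<le> f m" if "m \<in> M" for m
      using qp[of m] low[of m m] that MV p0 by force
    fix m assume m: "m \<in> M"
    then have "- m \<in> M" using M complex_vector.subspace_neg by blast
    then show "q m = f m"
      using le[of m] le[of "- m"] neg fneg m MV by fastforce
  qed
qed

text \<open>The real part of a complex-linear functional determines it, and rotating the argument bounds
  the modulus by the real part.\<close>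

lemma hahn_banach_complex:
  assumes V: "complex_subspace V" and M: "complex_subspace M" and MV: "M \<subseteq> V"
    and padd: "\<And>x y. x \<in> V \<Longrightarrow> y \<in> V \<Longrightarrow> p (x + y) \<le> p x + p y"
    and pscale: "\<And>a x. x \<in> V \<Longrightarrow> p (a *\<^sub>C x) = cmod a * p x"
    and fadd: "\<And>x y. x \<in> M \<Longrightarrow> y \<in> M \<Longrightarrow> f (x + y) = f x + f y"
    and fscale: "\<And>a x. x \<in> M \<Longrightarrow> f (a *\<^sub>C x) = a * f x"
    and fp: "\<And>x. x \<in> M \<Longrightarrow> cmod (f x) \<le> p x"
  obtains g where "\<And>x y. x \<in> V \<Longrightarrow> y \<in> V \<Longrightarrow> g (x + y) = g x + g y"
    "\<And>a x. x \<in> V \<Longrightarrow> g (a *\<^sub>C x) = a * g x"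
    "\<And>x. x \<in> M \<Longrightarrow> g x = f x" "\<And>x. x \<in> V \<Longrightarrow> cmod (g x) \<le> p x"
proof -
  have p: "sublinear_on V p" unfolding sublinear_on_def using padd pscale by simp
  obtain h where hadd: "\<And>x y. x \<in> V \<Longrightarrow> y \<in> V \<Longrightarrow> h (x + y) = h x + h y"
    and hscale: "\<And>t x. x \<in> V \<Longrightarrow> h (of_real t *\<^sub>C x) = t * h x"
    and hf: "\<And>x. x \<in> M \<Longrightarrow> h x = Re (f x)" and hp: "\<And>x. x \<in> V \<Longrightarrow> h x \<le> p x"
  proof (rule hahn_banach_real[OF V M MV p, of "\<lambda>x. Re (f x)"])
    show "Re (f x) \<le> p x" if "x \<in> M" for x using fp[OF that] complex_Re_le_cmod order_trans by blast
  qed (use fadd fscale in auto)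
  define g where "g = (\<lambda>x. Complex (h x) (- h (\<i> *\<^sub>C x)))"
  have sV: "a *\<^sub>C x \<in> V" if "x \<in> V" for a x using V that complex_vector.subspace_scale by blast
  have dec: "a *\<^sub>C x = of_real (Re a) *\<^sub>C x + of_real (Im a) *\<^sub>C (\<i> *\<^sub>C x)" for a and x :: 'a
  proof -
    have "a = of_real (Re a) + of_real (Im a) * \<i>" by (simp add: complex_eq_iff)
    then show ?thesis by (metis scaleC_add_left scaleC_scaleC)
  qed
  have ii: "\<i> *\<^sub>C \<i> *\<^sub>C x = - x" for x :: 'a
    by (metis complex_vector.scale_minus_left i_squared power2_eq_square scaleC_one scaleC_scaleC)
  have hneg: "h (- x) = - h x" if "x \<in> V" for x
    using hscale[OF that, of "-1"] by (simp add: complex_vector.scale_minus_left scaleC_one)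
  have gadd: "g (x + y) = g x + g y" if "x \<in> V" "y \<in> V" for x y
    unfolding g_def using hadd that sV by (simp add: scaleC_add_right complex_eq_iff)
  have hs: "h (a *\<^sub>C x) = Re a * h x + Im a * h (\<i> *\<^sub>C x)" if "x \<in> V" for a x
    by (subst dec) (simp only: hadd hscale sV that)
  have gscale: "g (a *\<^sub>C x) = a * g x" if x: "x \<in> V" for a x
  proof -
    have "\<i> *\<^sub>C (a *\<^sub>C x) = a *\<^sub>C (\<i> *\<^sub>C x)" by (simp add: scaleC_scaleC mult.commute)
    then have "h (\<i> *\<^sub>C (a *\<^sub>C x)) = Re a * h (\<i> *\<^sub>C x) - Im a * h x"
      using hs[OF sV[OF x], of a \<i>] hneg[OF x] by (simp add: ii mult.commute[of \<i> a])
    then show ?thesis unfolding g_def using hs[OF x, of a] by (simp add: complex_eq_iff mult.commute[of \<i> a])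
  qed
  show ?thesis
  proof
    show "g (x + y) = g x + g y" if "x \<in> V" "y \<in> V" for x y using gadd that .
    show "g (a *\<^sub>C x) = a * g x" if "x \<in> V" for a x using gscale that .
    show "g m = f m" if m: "m \<in> M" for m
    proof -
      have "\<i> *\<^sub>C m \<in> M" using M m complex_vector.subspace_scale by blast
      then show ?thesis unfolding g_def using hf m fscale[OF m, of \<i>] by (simp add: complex_eq_iff)
    qed
    show "cmod (g x) \<le> p x" if x: "x \<in> V" for x
    proof (cases "g x = 0")
      case True
      have "p (0 *\<^sub>C x) = 0" "p (of_real (-1) *\<^sub>C x) = p x"
        using pscale[OF x, of 0] pscale[OF x, of "-1"] by simp_all
      moreover have "p (x + of_real (-1) *\<^sub>C x) \<le> p x + p (of_real (-1) *\<^sub>C x)" using padd x sV by blast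
      ultimately have "0 \<le> p x" by (simp add: complex_vector.scale_minus_left complex_vector.scale_zero_left scaleC_one)
      then show ?thesis using True by simp
    next
      case False
      \<comment> \<open>rotate \<open>x\<close> so that the value becomes real\<close>
      define c where "c = of_real (cmod (g x)) / g x"
      have c: "cmod c = 1" "c * g x = of_real (cmod (g x))"
        using False unfolding c_def by (simp_all add: norm_divide)
      have "cmod (g x) = Re (g (c *\<^sub>C x))" using gscale[OF x] c by simp
      also have "\<dots> = h (c *\<^sub>C x)" by (simp add: g_def)
      also have "\<dots> \<le> p x" using hp[OF sV[OF x], of c] pscale[OF x, of c] c by simp
      finally show ?thesis .
    qed
  qed
qed

section \<open>Normed spaces and their duals\<close>

lemma scaleC_functional: "(a *\<^sub>C (h :: 'x \<Rightarrow> complex)) x = a * h x"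
  by (simp add: scaleC_fun_def scaleC_complex_def)

lemma mem_dual_iff:
  "\<phi> \<in> vecs (dual X) \<longleftrightarrow>
     (\<forall>x\<in>vecs X. \<forall>y\<in>vecs X. \<phi> (x + y) = \<phi> x + \<phi> y) \<and>
     (\<forall>a. \<forall>x\<in>vecs X. \<phi> (a *\<^sub>C x) = a * \<phi> x) \<and>
     (\<exists>K. \<forall>x\<in>vecs X. cmod (\<phi> x) \<le> K * nrm X x) \<and>
     (\<forall>x. x \<notin> vecs X \<longrightarrow> \<phi> x = 0)"
  by (simp add: dual_def bounded_ops_def complex_field_def scaleC_complex_def)

context complex_normed_space
begin

lemma vadd [simp, intro]: "x \<in> vecs X \<Longrightarrow> y \<in> vecs X \<Longrightarrow> x + y \<in> vecs X"
  using subspace complex_vector.subspace_add by blast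

lemma vdiff [simp, intro]: "x \<in> vecs X \<Longrightarrow> y \<in> vecs X \<Longrightarrow> x - y \<in> vecs X"
  using subspace complex_vector.subspace_diff by blast

lemma vscale [simp, intro]: "x \<in> vecs X \<Longrightarrow> a *\<^sub>C x \<in> vecs X"
  using subspace complex_vector.subspace_scale by blast

lemma vneg [simp, intro]: "x \<in> vecs X \<Longrightarrow> - x \<in> vecs X"
  using subspace complex_vector.subspace_neg by blast

lemma vzero [simp, intro]: "0 \<in> vecs X"
  using subspace complex_vector.subspace_0 by blast

lemma nrm_zero [simp]: "nrm X 0 = 0"
  using nrm_eq_0_iff by blast

lemma nrm_uminus: "x \<in> vecs X \<Longrightarrow> nrm X (- x) = nrm X x"
  using nrm_scaleC[of x "- 1"] by (simp add: complex_vector.scale_minus_left)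

lemma normalized_in_unit_ball:
  assumes "x \<in> vecs X" "x \<noteq> 0"
  shows "of_real (inverse (nrm X x)) *\<^sub>C x \<in> unit_ball X"
  using assms nrm_ge_0[of x] nrm_eq_0_iff[of x]
  by (auto simp: unit_ball_def nrm_scaleC norm_inverse)

lemma zero_in_unit_ball: "0 \<in> unit_ball X"
  by (simp add: unit_ball_def)

lemma dual_add: "\<phi> \<in> vecs (dual X) \<Longrightarrow> x \<in> vecs X \<Longrightarrow> y \<in> vecs X \<Longrightarrow> \<phi> (x + y) = \<phi> x + \<phi> y"
  and dual_scale: "\<phi> \<in> vecs (dual X) \<Longrightarrow> x \<in> vecs X \<Longrightarrow> \<phi> (a *\<^sub>C x) = a * \<phi> x"
  and dual_off: "\<phi> \<in> vecs (dual X) \<Longrightarrow> x \<notin> vecs X \<Longrightarrow> \<phi> x = 0"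
  by (simp_all add: mem_dual_iff)

lemma dual_zero: "\<phi> \<in> vecs (dual X) \<Longrightarrow> \<phi> 0 = 0"
  using dual_scale[of \<phi> 0 0] by simp

lemma dual_diff: "\<phi> \<in> vecs (dual X) \<Longrightarrow> x \<in> vecs X \<Longrightarrow> y \<in> vecs X \<Longrightarrow> \<phi> (x - y) = \<phi> x - \<phi> y"
  using dual_add[of \<phi> "x - y" y] by simp

lemma dual_sum:
  assumes "\<phi> \<in> vecs (dual X)" "\<And>i. i \<in> I \<Longrightarrow> h i \<in> vecs X"
  shows "\<phi> (\<Sum>i\<in>I. h i) = (\<Sum>i\<in>I. \<phi> (h i))"
  using assms(2)
proof (induction I rule: infinite_finite_induct)
  case (insert i I)
  have "sum h I \<in> vecs X" using insert.prems by (intro complex_vector.subspace_sum[OF subspace]) auto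
  then show ?case using dual_add[OF assms(1)] insert by simp
qed (use dual_zero assms in auto)

lemma dual_bdd_above:
  assumes "\<phi> \<in> vecs (dual X)"
  shows "bdd_above ((\<lambda>x. cmod (\<phi> x)) ` unit_ball X)"
proof -
  obtain K where K: "\<forall>x\<in>vecs X. cmod (\<phi> x) \<le> K * nrm X x" using assms mem_dual_iff by blast
  have "cmod (\<phi> x) \<le> \<bar>K\<bar>" if "x \<in> unit_ball X" for x
  proof -
    have x: "x \<in> vecs X" "nrm X x \<le> 1" using that by (auto simp: unit_ball_def)
    have "cmod (\<phi> x) \<le> K * nrm X x" using K x by blast
    also have "\<dots> \<le> \<bar>K\<bar> * nrm X x" using nrm_ge_0[OF x(1)] by (intro mult_right_mono) auto
    also have "\<dots> \<le> \<bar>K\<bar>" using x by (simp add: mult_left_le)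
    finally show ?thesis .
  qed
  then show ?thesis by (rule bdd_aboveI2)
qed

lemma dual_nrm_eq: "nrm (dual X) \<phi> = (SUP x\<in>unit_ball X. cmod (\<phi> x))"
  by (simp add: dual_def)

lemma dual_unit_ball_le:
  assumes "\<phi> \<in> vecs (dual X)" "x \<in> unit_ball X"
  shows "cmod (\<phi> x) \<le> nrm (dual X) \<phi>"
  unfolding dual_nrm_eq using assms dual_bdd_above by (intro cSUP_upper)

lemma dual_nrm_ge_0:
  assumes "\<phi> \<in> vecs (dual X)"
  shows "0 \<le> nrm (dual X) \<phi>"
  using dual_unit_ball_le[OF assms zero_in_unit_ball] norm_ge_zero order_trans by blast

lemma dual_le:
  assumes \<phi>: "\<phi> \<in> vecs (dual X)" and x: "x \<in> vecs X"
  shows "cmod (\<phi> x) \<le> nrm (dual X) \<phi> * nrm X x"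
proof (cases "x = 0")
  case True
  then show ?thesis using dual_zero[OF \<phi>] by simp
next
  case False
  then have pos: "0 < nrm X x" using nrm_ge_0[OF x] nrm_eq_0_iff[OF x] by simp
  have "cmod (\<phi> (of_real (inverse (nrm X x)) *\<^sub>C x)) \<le> nrm (dual X) \<phi>"
    using dual_unit_ball_le[OF \<phi> normalized_in_unit_ball[OF x False]] .
  then show ?thesis using pos dual_scale[OF \<phi> x] by (simp add: norm_divide divide_simps mult.commute)
qed

lemma dual_nrm_le:
  assumes "0 \<le> K" "\<And>x. x \<in> vecs X \<Longrightarrow> cmod (\<phi> x) \<le> K * nrm X x"
  shows "nrm (dual X) \<phi> \<le> K"
  unfolding dual_nrm_eq
proof (rule cSUP_least)
  show "unit_ball X \<noteq> {}" using zero_in_unit_ball by blast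
  fix x assume "x \<in> unit_ball X"
  then have "x \<in> vecs X" "nrm X x \<le> 1" by (auto simp: unit_ball_def)
  then show "cmod (\<phi> x) \<le> K" using assms(2)[of x] mult_left_le[OF _ assms(1)] by fastforce
qed

lemma dual_normed: "complex_normed_space (dual X)"
proof
  show "complex_subspace (vecs (dual X))"
    unfolding complex_vector.subspace_def
  proof (intro conjI ballI allI)
    show "0 \<in> vecs (dual X)" by (auto simp: mem_dual_iff intro: exI[of _ 0])
  next
    fix \<phi> \<psi> assume *: "\<phi> \<in> vecs (dual X)" "\<psi> \<in> vecs (dual X)"
    have "cmod ((\<phi> + \<psi>) x) \<le> (nrm (dual X) \<phi> + nrm (dual X) \<psi>) * nrm X x" if "x \<in> vecs X" for x
      using norm_triangle_ineq[of "\<phi> x" "\<psi> x"] dual_le[OF *(1) that] dual_le[OF *(2) that]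
      by (simp add: algebra_simps)
    then have "\<exists>K. \<forall>x\<in>vecs X. cmod ((\<phi> + \<psi>) x) \<le> K * nrm X x" by blast
    then show "\<phi> + \<psi> \<in> vecs (dual X)"
      using * unfolding mem_dual_iff by (simp add: algebra_simps)
  next
    fix a \<phi> assume *: "\<phi> \<in> vecs (dual X)"
    have "cmod ((a *\<^sub>C \<phi>) x) \<le> (cmod a * nrm (dual X) \<phi>) * nrm X x" if "x \<in> vecs X" for x
      using dual_le[OF *(1) that]
      by (simp add: scaleC_functional norm_mult mult_left_mono mult.assoc)
    then have "\<exists>K. \<forall>x\<in>vecs X. cmod ((a *\<^sub>C \<phi>) x) \<le> K * nrm X x" by blast
    then show "a *\<^sub>C \<phi> \<in> vecs (dual X)"
      using * unfolding mem_dual_iff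
      by (simp add: scaleC_functional algebra_simps)
  qed
next
  fix \<phi> assume *: "\<phi> \<in> vecs (dual X)"
  show "0 \<le> nrm (dual X) \<phi>" using dual_nrm_ge_0[OF *] .
  show "nrm (dual X) \<phi> = 0 \<longleftrightarrow> \<phi> = 0"
  proof
    assume 0: "nrm (dual X) \<phi> = 0"
    show "\<phi> = 0"
    proof
      fix x show "\<phi> x = 0 x"
        using dual_le[OF *, of x] dual_off[OF *, of x] 0 by (cases "x \<in> vecs X") auto
    qed
  next
    assume "\<phi> = 0"
    then have "nrm (dual X) \<phi> \<le> 0" by (intro dual_nrm_le) auto
    then show "nrm (dual X) \<phi> = 0" using dual_nrm_ge_0[OF *] by simp
  qed
  fix a
  have le: "nrm (dual X) (a *\<^sub>C \<phi>) \<le> cmod a * nrm (dual X) \<phi>" if "\<phi> \<in> vecs (dual X)" for a \<phi>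
  proof (rule dual_nrm_le)
    show "0 \<le> cmod a * nrm (dual X) \<phi>" using dual_nrm_ge_0[OF that] by simp
    show "cmod ((a *\<^sub>C \<phi>) x) \<le> (cmod a * nrm (dual X) \<phi>) * nrm X x" if "x \<in> vecs X" for x
      using dual_le[OF \<open>\<phi> \<in> _\<close> that]
      by (simp add: scaleC_functional norm_mult mult_left_mono mult.assoc)
  qed
  show "nrm (dual X) (a *\<^sub>C \<phi>) = cmod a * nrm (dual X) \<phi>"
  proof (rule antisym[OF le[OF *]])
    show "cmod a * nrm (dual X) \<phi> \<le> nrm (dual X) (a *\<^sub>C \<phi>)"
    proof (cases "a = 0")
      case False
      have "nrm (dual X) \<phi> \<le> nrm (dual X) (a *\<^sub>C \<phi>) / cmod a"
        unfolding dual_nrm_eq[of \<phi>]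
      proof (rule cSUP_least)
        show "unit_ball X \<noteq> {}" using zero_in_unit_ball by blast
        fix x assume x: "x \<in> unit_ball X"
        have "bdd_above ((\<lambda>x. cmod ((a *\<^sub>C \<phi>) x)) ` unit_ball X)"
          using dual_unit_ball_le[OF *]
          by (intro bdd_aboveI2[where M = "cmod a * nrm (dual X) \<phi>"])
            (simp add: scaleC_functional norm_mult mult_left_mono)
        then have "cmod ((a *\<^sub>C \<phi>) x) \<le> nrm (dual X) (a *\<^sub>C \<phi>)"
          unfolding dual_nrm_eq using x by (intro cSUP_upper)
        then show "cmod (\<phi> x) \<le> nrm (dual X) (a *\<^sub>C \<phi>) / cmod a"
          using False by (simp add: scaleC_functional norm_mult field_simps)
      qed
      then show ?thesis using False by (simp add: field_simps)
    next
      case True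
      have "0 \<le> nrm (dual X) (0::'a \<Rightarrow> complex)"
        by (rule dual_nrm_ge_0) (auto simp: mem_dual_iff intro: exI[of _ 0])
      then show ?thesis using True by simp
    qed
  qed
  fix \<psi> assume \<psi>: "\<psi> \<in> vecs (dual X)"
  show "nrm (dual X) (\<phi> + \<psi>) \<le> nrm (dual X) \<phi> + nrm (dual X) \<psi>"
  proof (rule dual_nrm_le)
    show "0 \<le> nrm (dual X) \<phi> + nrm (dual X) \<psi>" using dual_nrm_ge_0 * \<psi> by simp
    show "cmod ((\<phi> + \<psi>) x) \<le> (nrm (dual X) \<phi> + nrm (dual X) \<psi>) * nrm X x" if "x \<in> vecs X" for x
      using norm_triangle_ineq[of "\<phi> x" "\<psi> x"] dual_le[OF * that] dual_le[OF \<psi> that]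
      by (simp add: algebra_simps)
  qed
qed

lemma restrict_in_dual:
  assumes "\<And>x y. x \<in> vecs X \<Longrightarrow> y \<in> vecs X \<Longrightarrow> h (x + y) = h x + h y"
    and "\<And>a x. x \<in> vecs X \<Longrightarrow> h (a *\<^sub>C x) = a * h x"
    and "\<And>x. x \<in> vecs X \<Longrightarrow> cmod (h x) \<le> K * nrm X x"
  shows "(\<lambda>x. if x \<in> vecs X then h x else 0) \<in> vecs (dual X)"
proof -
  have "\<exists>K. \<forall>x\<in>vecs X. cmod (h x) \<le> K * nrm X x" using assms(3) by blast
  then show ?thesis unfolding mem_dual_iff using assms(1,2) by auto
qed

lemma hahn_banach_normed:
  assumes M: "complex_subspace M" "M \<subseteq> vecs X" and K: "0 \<le> K"
    and fadd: "\<And>x y. x \<in> M \<Longrightarrow> y \<in> M \<Longrightarrow> f (x + y) = f x + f y"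
    and fscale: "\<And>a x. x \<in> M \<Longrightarrow> f (a *\<^sub>C x) = a * f x"
    and fp: "\<And>x. x \<in> M \<Longrightarrow> cmod (f x) \<le> K * nrm X x"
  shows "\<exists>\<phi>\<in>vecs (dual X). nrm (dual X) \<phi> \<le> K \<and> (\<forall>x\<in>M. \<phi> x = f x)"
proof -
  obtain g where g: "\<And>x y. x \<in> vecs X \<Longrightarrow> y \<in> vecs X \<Longrightarrow> g (x + y) = g x + g y"
    "\<And>a x. x \<in> vecs X \<Longrightarrow> g (a *\<^sub>C x) = a * g x"
    "\<And>x. x \<in> M \<Longrightarrow> g x = f x" "\<And>x. x \<in> vecs X \<Longrightarrow> cmod (g x) \<le> K * nrm X x"
  proof (rule hahn_banach_complex[OF subspace M, of "\<lambda>x. K * nrm X x" f])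
    show "K * nrm X (x + y) \<le> K * nrm X x + K * nrm X y" if "x \<in> vecs X" "y \<in> vecs X" for x y
      using mult_left_mono[OF nrm_triangle[OF that] K] by (simp add: algebra_simps)
    show "K * nrm X (a *\<^sub>C x) = cmod a * (K * nrm X x)" if "x \<in> vecs X" for a x
      using nrm_scaleC[OF that] by simp
  qed (use fadd fscale fp in auto)
  define \<phi> where "\<phi> = (\<lambda>x. if x \<in> vecs X then g x else 0)"
  have "\<phi> \<in> vecs (dual X)" unfolding \<phi>_def using g by (intro restrict_in_dual) auto
  moreover have "nrm (dual X) \<phi> \<le> K" using K g(4) by (intro dual_nrm_le) (auto simp: \<phi>_def)
  moreover have "\<forall>x\<in>M. \<phi> x = f x" using g(3) M by (auto simp: \<phi>_def)
  ultimately show ?thesis by blast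
qed

text \<open>Extend \<open>a x \<mapsto> a \<parallel>x\<parallel>\<close> from the line through \<open>x\<close>.\<close>

lemma norming_functional:
  assumes x: "x \<in> vecs X"
  shows "\<exists>\<phi>\<in>unit_ball (dual X). \<phi> x = of_real (nrm X x)"
proof (cases "x = 0")
  case True
  have "0 \<in> unit_ball (dual X)"
    using complex_normed_space.zero_in_unit_ball[OF dual_normed] .
  then show ?thesis using True by (intro bexI[of _ 0]) auto
next
  case False
  define M where "M = range (\<lambda>a. a *\<^sub>C x)"
  define f where "f y = (THE a. y = a *\<^sub>C x) * of_real (nrm X x)" for y
  have f: "f (a *\<^sub>C x) = a * of_real (nrm X x)" for a
  proof -
    have "(THE b. a *\<^sub>C x = b *\<^sub>C x) = a" using False by (intro the_equality) auto
    then show ?thesis by (simp add: f_def)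
  qed
  have "\<exists>\<phi>\<in>vecs (dual X). nrm (dual X) \<phi> \<le> 1 \<and> (\<forall>x\<in>M. \<phi> x = f x)"
  proof (rule hahn_banach_normed)
    show "complex_subspace M"
      unfolding complex_vector.subspace_def
    proof (intro conjI ballI allI)
      show "0 \<in> M" unfolding M_def by (rule range_eqI[of _ _ 0]) simp
      show "y + z \<in> M" if yz: "y \<in> M" "z \<in> M" for y z
      proof -
        obtain a b where "y = a *\<^sub>C x" "z = b *\<^sub>C x" using yz by (auto simp: M_def)
        then have "y + z = (a + b) *\<^sub>C x" by (simp only: scaleC_add_left)
        then show ?thesis unfolding M_def by (rule range_eqI)
      qed
      show "b *\<^sub>C y \<in> M" if yz: "y \<in> M" for b y
      proof -
        obtain a where "y = a *\<^sub>C x" using yz by (auto simp: M_def)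
        then have "b *\<^sub>C y = (b * a) *\<^sub>C x" by (simp only: scaleC_scaleC)
        then show ?thesis unfolding M_def by (rule range_eqI)
      qed
    qed
    show "M \<subseteq> vecs X" using x by (auto simp: M_def)
    show "f (y + z) = f y + f z" if yz: "y \<in> M" "z \<in> M" for y z
    proof -
      obtain a b where "y = a *\<^sub>C x" "z = b *\<^sub>C x" using yz by (auto simp: M_def)
      then show ?thesis using f[of "a + b"] f[of a] f[of b] by (simp add: scaleC_add_left algebra_simps)
    qed
    show "f (b *\<^sub>C y) = b * f y" if yz: "y \<in> M" for b y
    proof -
      obtain a where "y = a *\<^sub>C x" using yz by (auto simp: M_def)
      then show ?thesis using f[of "b * a"] f[of a] by simp
    qed
    show "cmod (f y) \<le> 1 * nrm X y" if yz: "y \<in> M" for y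
    proof -
      obtain a where "y = a *\<^sub>C x" using yz by (auto simp: M_def)
      then show ?thesis using f[of a] nrm_scaleC[OF x] nrm_ge_0[OF x] by (simp add: norm_mult)
    qed
  qed simp
  moreover have "x \<in> M" unfolding M_def by (rule range_eqI[of _ _ 1]) simp
  ultimately show ?thesis using f[of 1] by (auto simp: unit_ball_def)
qed

lemma eq_zero_if_functionals_vanish:
  assumes "x \<in> vecs X" "\<And>\<phi>. \<phi> \<in> vecs (dual X) \<Longrightarrow> \<phi> x = 0"
  shows "x = 0"
proof -
  obtain \<phi> where "\<phi> \<in> vecs (dual X)" "\<phi> x = of_real (nrm X x)"
    using norming_functional[OF assms(1)] by (auto simp: unit_ball_def)
  then have "nrm X x = 0" using assms(2) by (metis of_real_eq_0_iff)
  then show ?thesis using nrm_eq_0_iff[OF assms(1)] by simp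
qed

lemma eq_if_functionals_agree:
  assumes "x \<in> vecs X" "y \<in> vecs X" "\<And>\<phi>. \<phi> \<in> vecs (dual X) \<Longrightarrow> \<phi> x = \<phi> y"
  shows "x = y"
proof -
  have "x - y = 0"
  proof (rule eq_zero_if_functionals_vanish)
    fix \<phi> assume \<phi>: "\<phi> \<in> vecs (dual X)"
    show "\<phi> (x - y) = 0" using assms(3)[OF \<phi>] dual_diff[OF \<phi> assms(1,2)] by simp
  qed (use assms in auto)
  then show ?thesis by simp
qed

lemma nrm_le_if_functionals_le:
  assumes "x \<in> vecs X" "\<And>\<phi>. \<phi> \<in> vecs (dual X) \<Longrightarrow> cmod (\<phi> x) \<le> K * nrm (dual X) \<phi>" "0 \<le> K"
  shows "nrm X x \<le> K"
proof -
  obtain \<phi> where \<phi>: "\<phi> \<in> vecs (dual X)" "nrm (dual X) \<phi> \<le> 1" "\<phi> x = of_real (nrm X x)"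
    using norming_functional[OF assms(1)] by (auto simp: unit_ball_def)
  have "nrm X x \<le> K * nrm (dual X) \<phi>" using assms(2)[OF \<phi>(1)] \<phi>(3) nrm_ge_0[OF assms(1)] by simp
  also have "\<dots> \<le> K" using \<phi>(2) \<open>0 \<le> K\<close> by (simp add: mult_left_le)
  finally show ?thesis .
qed

lemma MCauchy_iff_nrm:
  fixes s :: "nat \<Rightarrow> 'a"
  assumes "\<And>n. s n \<in> vecs X"
  shows "MCauchy s \<longleftrightarrow> (\<forall>e>0. \<exists>N. \<forall>m n. N \<le> m \<longrightarrow> N \<le> n \<longrightarrow> nrm X (s m - s n) < e)"
  unfolding MCauchy_def using assms by (auto simp: ndist_def)

lemma limitin_iff_nrm:
  fixes s :: "nat \<Rightarrow> 'a"
  assumes "\<And>n. s n \<in> vecs X"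
  shows "limitin mtopology s l sequentially \<longleftrightarrow>
    l \<in> vecs X \<and> (\<forall>e>0. \<exists>N. \<forall>n\<ge>N. nrm X (s n - l) < e)"
  unfolding limit_metric_sequentially by (simp add: ndist_def assms cong: conj_cong)

end

lemma (in complex_banach_space) cauchy_converges:
  fixes s :: "nat \<Rightarrow> 'a"
  assumes "\<And>n. s n \<in> vecs X"
    and "\<And>e. 0 < e \<Longrightarrow> \<exists>N. \<forall>m n. N \<le> m \<longrightarrow> N \<le> n \<longrightarrow> nrm X (s m - s n) < e"
  obtains l where "l \<in> vecs X" "\<And>e. 0 < e \<Longrightarrow> \<exists>N. \<forall>n\<ge>N. nrm X (s n - l) < e"
proof -
  have "MCauchy s" using MCauchy_iff_nrm[of s] assms by simp
  then obtain l where "limitin mtopology s l sequentially"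
    using complete unfolding mcomplete_def by blast
  then have "l \<in> vecs X" "\<forall>e>0. \<exists>N. \<forall>n\<ge>N. nrm X (s n - l) < e"
    using limitin_iff_nrm[of s l] assms(1) by simp_all
  then show ?thesis by (intro that) auto
qed

section \<open>Functionals on the dual that are evaluations\<close>

text \<open>Membership in the image of \<open>X\<close> under the canonical embedding in the bidual.\<close>

definition is_evaluation :: "'a::complex_vector cnspace \<Rightarrow> (('a \<Rightarrow> complex) \<Rightarrow> complex) \<Rightarrow> bool" where
  "is_evaluation X z \<longleftrightarrow> (\<exists>x\<in>vecs X. \<forall>\<phi>\<in>vecs (dual X). z \<phi> = \<phi> x)"

text \<open>Induction on \<open>D\<close>: on the kernel of one functional the others account for \<open>g\<close>, and what remains
  vanishes on that kernel, hence is a multiple of the one functional.\<close>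

lemma functional_vanishing_on_common_kernel:
  fixes h :: "'d \<Rightarrow> 'v::complex_vector \<Rightarrow> complex"
  assumes "finite D" "complex_subspace V"
    and "\<And>d u v. d \<in> D \<Longrightarrow> u \<in> V \<Longrightarrow> v \<in> V \<Longrightarrow> h d (u + v) = h d u + h d v"
    and "\<And>d a v. d \<in> D \<Longrightarrow> v \<in> V \<Longrightarrow> h d (a *\<^sub>C v) = a * h d v"
    and "\<And>u v. u \<in> V \<Longrightarrow> v \<in> V \<Longrightarrow> g (u + v) = g u + g v"
    and "\<And>a v. v \<in> V \<Longrightarrow> g (a *\<^sub>C v) = a * g v"
    and "\<And>v. v \<in> V \<Longrightarrow> (\<And>d. d \<in> D \<Longrightarrow> h d v = 0) \<Longrightarrow> g v = 0"
  shows "\<exists>c. \<forall>v\<in>V. g v = (\<Sum>d\<in>D. c d * h d v)"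
  using assms
proof (induction D arbitrary: V rule: finite_induct)
  case empty
  then show ?case by auto
next
  case (insert d D)
  note V = insert.prems(1)
  define W where "W = {v\<in>V. h d v = 0}"
  have h0: "h d 0 = 0" using insert.prems(3)[of d 0 0] complex_vector.subspace_0[OF V] by simp
  have W: "complex_subspace W"
    unfolding W_def complex_vector.subspace_def
    using insert.prems(2,3)[of d] complex_vector.subspace_0[OF V] h0
      complex_vector.subspace_add[OF V] complex_vector.subspace_scale[OF V]
    by auto
  have "\<exists>c. \<forall>v\<in>W. g v = (\<Sum>d\<in>D. c d * h d v)"
  proof (rule insert.IH[OF W])
    fix v assume "v \<in> W" "\<And>d. d \<in> D \<Longrightarrow> h d v = 0"
    then show "g v = 0" using insert.prems(6)[of v] by (auto simp: W_def)
  qed (use insert.prems in \<open>auto simp: W_def\<close>)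
  then obtain c where c: "\<And>v. v \<in> W \<Longrightarrow> g v = (\<Sum>d\<in>D. c d * h d v)" by blast
  show ?case
  proof (cases "\<exists>w\<in>V. h d w \<noteq> 0")
    case False
    then have "W = V" by (auto simp: W_def)
    then have "\<forall>v\<in>V. g v = (\<Sum>e\<in>insert d D. c e * h e v)"
      using c False insert.hyps by (auto simp: sum.insert)
    then show ?thesis by blast
  next
    case True
    then obtain w where w: "w \<in> V" "h d w \<noteq> 0" by blast
    define r where "r v = g v - (\<Sum>e\<in>D. c e * h e v)" for v
    define k where "k = r w / h d w"
    have "g v = k * h d v + (\<Sum>e\<in>D. c e * h e v)" if v: "v \<in> V" for v
    proof -
      \<comment> \<open>subtracting a multiple of \<open>w\<close> moves \<open>v\<close> into the kernel of \<open>h d\<close>\<close>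
      define b where "b = - (h d v / h d w)"
      have bw: "b *\<^sub>C w \<in> V" using complex_vector.subspace_scale[OF V] w by blast
      define u where "u = v + b *\<^sub>C w"
      have uV: "u \<in> V" unfolding u_def using complex_vector.subspace_add[OF V] v bw by blast
      have "h d u = 0"
      proof -
        have "h d u = h d v + b * h d w" unfolding u_def using insert.prems(2,3)[of d] v w bw by simp
        then show ?thesis using w by (simp add: b_def)
      qed
      then have "u \<in> W" using uV by (simp add: W_def)
      have hu: "h e u = h e v + b * h e w" if "e \<in> D" for e
        using insert.prems(2,3)[of e] that v w bw by (simp add: u_def)
      have "g u = g v + b * g w" using insert.prems(4,5) v w bw by (simp add: u_def)
      moreover have "g u = (\<Sum>e\<in>D. c e * h e v) + b * (\<Sum>e\<in>D. c e * h e w)"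
        unfolding c[OF \<open>u \<in> W\<close>]
        by (simp add: hu algebra_simps sum.distrib sum_distrib_left cong: sum.cong)
      ultimately have "r v = - b * r w" by (simp add: r_def algebra_simps)
      moreover have "k * h d v = - b * r w" by (simp add: k_def b_def)
      ultimately show ?thesis using r_def[of v] by (simp add: algebra_simps)
    qed
    then have "\<forall>v\<in>V. g v = (\<Sum>e\<in>insert d D. (c(d := k)) e * h e v)"
      using insert.hyps by (auto simp: sum.insert intro!: sum.cong)
    then show ?thesis by blast
  qed
qed

text \<open>The canonical embedding is isometric, so its image is complete and therefore norm-closed in the
  bidual.\<close>

lemma (in complex_banach_space) evaluation_if_approximable:
  assumes z: "z \<in> vecs (dual (dual X))"
    and approx: "\<And>e. 0 < e \<Longrightarrow> \<exists>x\<in>vecs X. \<forall>\<phi>\<in>vecs (dual X). cmod (z \<phi> - \<phi> x) \<le> e * nrm (dual X) \<phi>"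
  shows "is_evaluation X z"
proof -
  have "\<exists>x. x \<in> vecs X \<and> (\<forall>\<phi>\<in>vecs (dual X). cmod (z \<phi> - \<phi> x) \<le> inverse (Suc n) * nrm (dual X) \<phi>)" for n
    using approx[of "inverse (Suc n)"] by auto
  then obtain s where s: "\<And>n. s n \<in> vecs X"
    and sz: "\<And>n \<phi>. \<phi> \<in> vecs (dual X) \<Longrightarrow> cmod (z \<phi> - \<phi> (s n)) \<le> inverse (Suc n) * nrm (dual X) \<phi>"
    by metis
  have diff: "nrm X (s m - s n) \<le> inverse (Suc m) + inverse (Suc n)" for m n
  proof (rule nrm_le_if_functionals_le)
    fix \<phi> assume \<phi>: "\<phi> \<in> vecs (dual X)"
    have "cmod (\<phi> (s m - s n)) = cmod ((z \<phi> - \<phi> (s n)) - (z \<phi> - \<phi> (s m)))"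
      using dual_diff[OF \<phi> s s] by simp
    also have "\<dots> \<le> cmod (z \<phi> - \<phi> (s n)) + cmod (z \<phi> - \<phi> (s m))" by (rule norm_triangle_ineq4)
    finally show "cmod (\<phi> (s m - s n)) \<le> (inverse (Suc m) + inverse (Suc n)) * nrm (dual X) \<phi>"
      using sz[OF \<phi>, of m] sz[OF \<phi>, of n] by (simp add: algebra_simps)
  qed (use s in auto)
  obtain l where l: "l \<in> vecs X" "\<And>e. 0 < e \<Longrightarrow> \<exists>N. \<forall>n\<ge>N. nrm X (s n - l) < e"
  proof (rule cauchy_converges[of s])
    fix e :: real assume "0 < e"
    then obtain N where N: "inverse (Suc N) < e / 2" using reals_Archimedean[of "e/2"] by auto
    have "nrm X (s m - s n) < e" if "N \<le> m" "N \<le> n" for m n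
    proof -
      have "inverse (Suc m) \<le> inverse (Suc N)" "inverse (Suc n) \<le> inverse (Suc N)"
        using that by (simp_all add: le_imp_inverse_le)
      then show ?thesis using diff[of m n] N by linarith
    qed
    then show "\<exists>N. \<forall>m n. N \<le> m \<longrightarrow> N \<le> n \<longrightarrow> nrm X (s m - s n) < e" by blast
  qed (use s in auto)
  have "z \<phi> = \<phi> l" if \<phi>: "\<phi> \<in> vecs (dual X)" for \<phi>
  proof -
    have "cmod (z \<phi> - \<phi> l) \<le> 0 + e" if e: "0 < e" for e
    proof -
      define e' where "e' = e / (2 * (nrm (dual X) \<phi> + 1))"
      have p: "0 \<le> nrm (dual X) \<phi>" using dual_nrm_ge_0[OF \<phi>] .
      then have e': "0 < e'" using e by (simp add: e'_def)
      obtain N1 where N1: "\<And>n. n \<ge> N1 \<Longrightarrow> nrm X (s n - l) < e'" using l(2)[OF e'] by blast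
      obtain N2 where N2: "inverse (Suc N2) < e'" using reals_Archimedean[OF e'] by auto
      define n where "n = max N1 N2"
      have "inverse (Suc n) \<le> inverse (Suc N2)" by (simp add: n_def le_imp_inverse_le)
      then have n: "inverse (Suc n) \<le> e'" using N2 by linarith
      have "cmod (z \<phi> - \<phi> l) = cmod ((z \<phi> - \<phi> (s n)) + \<phi> (s n - l))"
        using dual_diff[OF \<phi> s l(1)] by simp
      also have "\<dots> \<le> cmod (z \<phi> - \<phi> (s n)) + cmod (\<phi> (s n - l))" by (rule norm_triangle_ineq)
      also have "\<dots> \<le> inverse (Suc n) * nrm (dual X) \<phi> + nrm (dual X) \<phi> * nrm X (s n - l)"
        using sz[OF \<phi>] dual_le[OF \<phi>, of "s n - l"] s l by (intro add_mono) auto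
      also have "\<dots> \<le> e' * nrm (dual X) \<phi> + nrm (dual X) \<phi> * e'"
        using n N1[of n] p by (intro add_mono mult_right_mono mult_left_mono) (auto simp: n_def)
      also have "\<dots> \<le> e' * (2 * (nrm (dual X) \<phi> + 1))" using e' by (simp add: algebra_simps)
      also have "\<dots> = e" using p by (simp add: e'_def)
      finally show ?thesis by simp
    qed
    then have "cmod (z \<phi> - \<phi> l) \<le> 0" by (rule field_le_epsilon)
    then show ?thesis by simp
  qed
  then show ?thesis using l(1) unfolding is_evaluation_def by blast
qed

text \<open>If for some finite \<open>D\<close> the functional \<open>z\<close> is bounded by \<open>e\<close> on the annihilator of \<open>D\<close>, then it
  agrees there with some \<open>z'\<close> of norm at most \<open>e\<close>, and \<open>z - z'\<close> is evaluation at a combination of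
  \<open>D\<close>.  If this happened for all \<open>e\<close>, then \<open>z\<close> would be a norm limit of evaluations.\<close>

lemma (in complex_banach_space) not_evaluation_functionals:
  assumes z: "z \<in> vecs (dual (dual X))" and nev: "\<not> is_evaluation X z"
  shows "\<exists>\<theta>>0. \<forall>D. finite D \<longrightarrow> D \<subseteq> vecs X \<longrightarrow>
    (\<exists>\<phi>\<in>unit_ball (dual X). (\<forall>d\<in>D. \<phi> d = 0) \<and> z \<phi> = of_real \<theta>)"
proof -
  interpret D: complex_normed_space "dual X" by (rule dual_normed)
  interpret DD: complex_normed_space "dual (dual X)" by (rule D.dual_normed)
  define P where "P D \<theta> \<longleftrightarrow> (\<exists>\<phi>\<in>unit_ball (dual X). (\<forall>d\<in>D. \<phi> d = 0) \<and> z \<phi> = of_real \<theta>)"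
    for D and \<theta> :: real
  have "\<exists>\<theta>>0. \<forall>D. finite D \<longrightarrow> D \<subseteq> vecs X \<longrightarrow> P D \<theta>"
  proof (rule ccontr)
    assume neg: "\<not> ?thesis"
    have "is_evaluation X z"
    proof (rule evaluation_if_approximable[OF z])
      fix e :: real assume e: "0 < e"
      with neg obtain D where D: "finite D" "D \<subseteq> vecs X" and "\<not> P D e"
        by blast
      then have none: "\<And>\<phi>. \<phi> \<in> unit_ball (dual X) \<Longrightarrow> (\<And>d. d \<in> D \<Longrightarrow> \<phi> d = 0) \<Longrightarrow> z \<phi> \<noteq> of_real e"
        unfolding P_def by blast
      define N where "N = {\<phi>\<in>vecs (dual X). \<forall>d\<in>D. \<phi> d = 0}"
      have N: "complex_subspace N"
        unfolding N_def complex_vector.subspace_def by (auto simp: scaleC_functional)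
      have zN: "cmod (z \<phi>) \<le> e * nrm (dual X) \<phi>" if \<phi>: "\<phi> \<in> N" for \<phi>
      proof (rule ccontr)
        \<comment> \<open>otherwise a multiple of \<open>\<phi>\<close> would lie in the unit ball and be mapped to \<open>e\<close>\<close>
        assume less: "\<not> ?thesis"
        have \<phi>D: "\<phi> \<in> vecs (dual X)" using \<phi> by (simp add: N_def)
        have pos: "0 < cmod (z \<phi>)" using less e D.nrm_ge_0[OF \<phi>D]
          by (meson mult_nonneg_nonneg less_imp_le not_le order_le_less_trans)
        define a where "a = of_real e / z \<phi>"
        have "cmod a * nrm (dual X) \<phi> \<le> 1"
          using less pos e by (simp add: a_def norm_divide field_simps)
        then have "a *\<^sub>C \<phi> \<in> unit_ball (dual X)"
          using \<phi>D D.nrm_scaleC[OF \<phi>D] by (simp add: unit_ball_def)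
        moreover have "(a *\<^sub>C \<phi>) d = 0" if "d \<in> D" for d
          using \<phi> that by (simp add: N_def scaleC_functional)
        moreover have "z (a *\<^sub>C \<phi>) = of_real e"
          using D.dual_scale[OF z \<phi>D] pos by (simp add: a_def)
        ultimately show False using none by blast
      qed
      have "\<exists>z'\<in>vecs (dual (dual X)). nrm (dual (dual X)) z' \<le> e \<and> (\<forall>\<phi>\<in>N. z' \<phi> = z \<phi>)"
        by (rule D.hahn_banach_normed[OF N])
          (use zN e D.dual_add[OF z] D.dual_scale[OF z] in \<open>auto simp: N_def\<close>)
      then obtain z' where z': "z' \<in> vecs (dual (dual X))" "nrm (dual (dual X)) z' \<le> e"
        and zz: "\<And>\<phi>. \<phi> \<in> N \<Longrightarrow> z' \<phi> = z \<phi>" by blast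
      have "\<exists>c. \<forall>\<phi>\<in>vecs (dual X). z \<phi> - z' \<phi> = (\<Sum>d\<in>D. c d * \<phi> d)"
        by (rule functional_vanishing_on_common_kernel[OF D(1) D.subspace])
          (use zz D.dual_add[OF z] D.dual_scale[OF z] D.dual_add[OF z'(1)] D.dual_scale[OF z'(1)]
            in \<open>auto simp: N_def scaleC_functional algebra_simps\<close>)
      then obtain c where c: "\<And>\<phi>. \<phi> \<in> vecs (dual X) \<Longrightarrow> z \<phi> - z' \<phi> = (\<Sum>d\<in>D. c d * \<phi> d)" by blast
      define x where "x = (\<Sum>d\<in>D. c d *\<^sub>C d)"
      have "x \<in> vecs X" unfolding x_def using D by (intro complex_vector.subspace_sum[OF subspace]) auto
      moreover have "cmod (z \<phi> - \<phi> x) \<le> e * nrm (dual X) \<phi>" if \<phi>: "\<phi> \<in> vecs (dual X)" for \<phi>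
      proof -
        have "\<phi> x = (\<Sum>d\<in>D. \<phi> (c d *\<^sub>C d))" unfolding x_def using D by (intro dual_sum[OF \<phi>]) auto
        also have "\<dots> = (\<Sum>d\<in>D. c d * \<phi> d)" using D by (intro sum.cong) (auto simp: dual_scale[OF \<phi>])
        finally have "z \<phi> - \<phi> x = z' \<phi>" using c[OF \<phi>] by (simp add: algebra_simps)
        then show ?thesis
          using D.dual_le[OF z'(1) \<phi>] mult_right_mono[OF z'(2) D.nrm_ge_0[OF \<phi>]] by simp
      qed
      ultimately show "\<exists>x\<in>vecs X. \<forall>\<phi>\<in>vecs (dual X). cmod (z \<phi> - \<phi> x) \<le> e * nrm (dual X) \<phi>" by blast
    qed
    then show False using nev by blast
  qed
  then show ?thesis unfolding P_def .
qed

section \<open>Weak topologies\<close>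

lemma Hausdorff_space_if_separated:
  fixes T :: "'x topology"
  assumes "\<And>x y. x \<in> topspace T \<Longrightarrow> y \<in> topspace T \<Longrightarrow> x \<noteq> y \<Longrightarrow>
    \<exists>h :: 'x \<Rightarrow> complex. continuous_map T euclidean h \<and> h x \<noteq> h y"
  shows "Hausdorff_space T"
  unfolding Hausdorff_space_def
proof (intro allI impI, elim conjE)
  fix x y assume xy: "x \<in> topspace T" "y \<in> topspace T" "x \<noteq> y"
  then obtain h :: "'x \<Rightarrow> complex" where h: "continuous_map T euclidean h" "h x \<noteq> h y"
    using assms by blast
  then obtain A B where AB: "open A" "open B" "h x \<in> A" "h y \<in> B" "A \<inter> B = {}"
    using hausdorff[OF h(2)] by blast
  show "\<exists>U V. openin T U \<and> openin T V \<and> x \<in> U \<and> y \<in> V \<and> disjnt U V"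
  proof (intro exI conjI)
    show "openin T {x \<in> topspace T. h x \<in> A}" "openin T {x \<in> topspace T. h x \<in> B}"
      using openin_continuous_map_preimage[OF h(1)] AB by simp_all
  qed (use xy AB in \<open>auto simp: disjnt_def\<close>)
qed

lemma compactin_nested:
  fixes C :: "nat \<Rightarrow> 'x set"
  assumes K: "compactin T K" and C: "\<And>n. closedin T (C n)" "decseq C" "\<And>n. K \<inter> C n \<noteq> {}"
  shows "\<exists>x\<in>K. \<forall>n. x \<in> C n"
proof -
  have "(\<Inter>n. K \<inter> C n) \<noteq> {}"
  proof (rule compact_space_imp_nest)
    show "compact_space (subtopology T K)" using K compact_space_subtopology by blast
    show "closedin (subtopology T K) (K \<inter> C n)" for n
      using C(1) closedin_subtopology by blast
    show "decseq (\<lambda>n. K \<inter> C n)" using C(2) by (auto simp: decseq_def)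
  qed (use C in auto)
  then show ?thesis by blast
qed

context complex_normed_space
begin

lemma topspace_weak_topology [simp]: "topspace (weak_topology X) = vecs X"
proof -
  have "0 \<in> vecs (dual X)" using complex_normed_space.vzero[OF dual_normed] .
  then have "vecs X \<subseteq> topspace (weak_topology X)"
    unfolding weak_topology_def topology_generated_by_topspace
    by (intro Union_upper CollectI exI[of _ 0] exI[of _ UNIV]) auto
  moreover have "topspace (weak_topology X) \<subseteq> vecs X"
    unfolding weak_topology_def topology_generated_by_topspace by auto
  ultimately show ?thesis by blast
qed

lemma topspace_weak_star_topology [simp]: "topspace (weak_star_topology X) = vecs (dual X)"
proof -
  have "vecs (dual X) \<subseteq> topspace (weak_star_topology X)"
    unfolding weak_star_topology_def topology_generated_by_topspace
    by (intro Union_upper CollectI exI[of _ 0] exI[of _ UNIV]) auto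
  moreover have "topspace (weak_star_topology X) \<subseteq> vecs (dual X)"
    unfolding weak_star_topology_def topology_generated_by_topspace by auto
  ultimately show ?thesis by blast
qed

lemma continuous_map_functional:
  assumes "\<phi> \<in> vecs (dual X)"
  shows "continuous_map (weak_topology X) euclidean \<phi>"
  unfolding continuous_map_def
proof (intro conjI allI impI)
  fix W :: "complex set" assume "openin euclidean W"
  then have "{x \<in> vecs X. \<phi> x \<in> W} \<in> {{x \<in> vecs X. \<phi> x \<in> W} | \<phi> W. \<phi> \<in> vecs (dual X) \<and> open W}"
    using assms open_openin by blast
  then have "openin (weak_topology X) {x \<in> vecs X. \<phi> x \<in> W}"
    unfolding weak_topology_def by (rule topology_generated_by_Basis)
  then show "openin (weak_topology X) {x \<in> topspace (weak_topology X). \<phi> x \<in> W}" by simp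
qed auto

lemma continuous_map_evaluation:
  assumes "x \<in> vecs X"
  shows "continuous_map (weak_star_topology X) euclidean (\<lambda>\<phi>. \<phi> x)"
  unfolding continuous_map_def
proof (intro conjI allI impI)
  fix W :: "complex set" assume "openin euclidean W"
  then have "{\<phi> \<in> vecs (dual X). \<phi> x \<in> W} \<in> {{\<phi> \<in> vecs (dual X). \<phi> x \<in> W} | x W. x \<in> vecs X \<and> open W}"
    using assms open_openin by blast
  then have "openin (weak_star_topology X) {\<phi> \<in> vecs (dual X). \<phi> x \<in> W}"
    unfolding weak_star_topology_def by (rule topology_generated_by_Basis)
  then show "openin (weak_star_topology X) {\<phi> \<in> topspace (weak_star_topology X). \<phi> x \<in> W}" by simp
qed auto

lemma continuous_map_into_weak_topology:
  assumes "\<And>t. t \<in> topspace T \<Longrightarrow> h t \<in> vecs X"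
    and "\<And>\<phi>. \<phi> \<in> vecs (dual X) \<Longrightarrow> continuous_map T euclidean (\<lambda>t. \<phi> (h t))"
  shows "continuous_map T (weak_topology X) h"
  unfolding weak_topology_def
proof (rule continuous_on_generated_topo)
  fix A assume "A \<in> {{x \<in> vecs X. \<phi> x \<in> W} | \<phi> W. \<phi> \<in> vecs (dual X) \<and> open W}"
  then obtain \<phi> W where A: "A = {x \<in> vecs X. \<phi> x \<in> W}" "\<phi> \<in> vecs (dual X)" "open W" by blast
  have "h -` A \<inter> topspace T = {t \<in> topspace T. \<phi> (h t) \<in> W}" using A assms(1) by auto
  then show "openin T (h -` A \<inter> topspace T)"
    using openin_continuous_map_preimage[OF assms(2)[OF A(2)]] A(3) by simp
next
  show "h ` topspace T \<subseteq> \<Union> {{x \<in> vecs X. \<phi> x \<in> W} | \<phi> W. \<phi> \<in> vecs (dual X) \<and> open W}"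
    using assms(1) topspace_weak_topology
    unfolding weak_topology_def topology_generated_by_topspace by auto
qed

lemma continuous_map_into_weak_star_topology:
  assumes "\<And>t. t \<in> topspace T \<Longrightarrow> h t \<in> vecs (dual X)"
    and "\<And>x. x \<in> vecs X \<Longrightarrow> continuous_map T euclidean (\<lambda>t. h t x)"
  shows "continuous_map T (weak_star_topology X) h"
  unfolding weak_star_topology_def
proof (rule continuous_on_generated_topo)
  fix A assume "A \<in> {{\<phi> \<in> vecs (dual X). \<phi> x \<in> W} | x W. x \<in> vecs X \<and> open W}"
  then obtain x W where A: "A = {\<phi> \<in> vecs (dual X). \<phi> x \<in> W}" "x \<in> vecs X" "open W" by blast
  have "h -` A \<inter> topspace T = {t \<in> topspace T. h t x \<in> W}" using A assms(1) by auto
  then show "openin T (h -` A \<inter> topspace T)"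
    using openin_continuous_map_preimage[OF assms(2)[OF A(2)]] A(3) by simp
next
  show "h ` topspace T \<subseteq> \<Union> {{\<phi> \<in> vecs (dual X). \<phi> x \<in> W} | x W. x \<in> vecs X \<and> open W}"
    using assms(1) topspace_weak_star_topology
    unfolding weak_star_topology_def topology_generated_by_topspace by auto
qed

lemma Hausdorff_weak_topology: "Hausdorff_space (weak_topology X)"
proof (rule Hausdorff_space_if_separated)
  fix x y assume "x \<in> topspace (weak_topology X)" "y \<in> topspace (weak_topology X)" "x \<noteq> y"
  then obtain \<phi> where "\<phi> \<in> vecs (dual X)" "\<phi> x \<noteq> \<phi> y" using eq_if_functionals_agree by auto
  then show "\<exists>h. continuous_map (weak_topology X) euclidean h \<and> (h x :: complex) \<noteq> h y"
    using continuous_map_functional by blast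
qed

lemma relatively_weakly_compact_subset:
  assumes "relatively_weakly_compact X S" "R \<subseteq> S"
  shows "relatively_weakly_compact X R"
  using assms closed_compactin[OF _ closure_of_mono[OF assms(2)] closedin_closure_of]
  unfolding relatively_weakly_compact_def by blast

lemma relatively_weakly_compact_if_subset_compact:
  assumes K: "compactin (weak_topology X) K" and "S \<subseteq> K"
  shows "relatively_weakly_compact X S"
proof -
  have "closedin (weak_topology X) K"
    using compactin_imp_closedin[OF Hausdorff_weak_topology K] .
  then have "weak_topology X closure_of S \<subseteq> K" using \<open>S \<subseteq> K\<close> by (rule closure_of_minimal[rotated])
  then have "compactin (weak_topology X) (weak_topology X closure_of S)"
    using closed_compactin[OF K _ closedin_closure_of] by blast
  moreover have "S \<subseteq> vecs X" using compactin_subset_topspace[OF K] \<open>S \<subseteq> K\<close> by auto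
  ultimately show ?thesis by (simp add: relatively_weakly_compact_def)
qed

text \<open>The dual unit ball is a closed subset of a product of discs.\<close>

theorem banach_alaoglu: "compactin (weak_star_topology X) (unit_ball (dual X))"
proof -
  define r where "r x = (if x \<in> vecs X then nrm X x else 0)" for x
  define L where "L = {\<phi> :: 'a \<Rightarrow> complex.
    (\<forall>x y. x \<in> vecs X \<longrightarrow> y \<in> vecs X \<longrightarrow> \<phi> (x + y) = \<phi> x + \<phi> y) \<and>
    (\<forall>a x. x \<in> vecs X \<longrightarrow> \<phi> (a *\<^sub>C x) = a * \<phi> x)}"
  define C where "C = (PiE UNIV (\<lambda>x. cball 0 (r x)) :: ('a \<Rightarrow> complex) set)"
  have "compactin (product_topology (\<lambda>i. euclidean) UNIV) C"
    unfolding C_def compactin_PiE by auto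
  then have "compact C" by (simp add: euclidean_product_topology)
  moreover have "closed L"
    unfolding L_def
    by (intro closed_Collect_conj closed_Collect_all closed_Collect_imp closed_Collect_eq
        continuous_intros continuous_on_product_coordinates) auto
  ultimately have "compact (C \<inter> L)" by (rule compact_Int_closed)
  moreover have "C \<inter> L = unit_ball (dual X)"
  proof (intro equalityI subsetI)
    fix \<phi> assume "\<phi> \<in> C \<inter> L"
    then have le: "cmod (\<phi> x) \<le> r x" and "\<phi> \<in> L" for x by (auto simp: C_def PiE_iff)
    have "\<phi> x = 0" if "x \<notin> vecs X" for x using le[of x] that by (simp add: r_def)
    moreover have le1: "cmod (\<phi> x) \<le> 1 * nrm X x" if "x \<in> vecs X" for x using le[of x] that by (simp add: r_def)
    moreover have "\<exists>K. \<forall>x\<in>vecs X. cmod (\<phi> x) \<le> K * nrm X x" using le1 by blast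
    ultimately have "\<phi> \<in> vecs (dual X)" using \<open>\<phi> \<in> L\<close> unfolding mem_dual_iff L_def by simp
    moreover have "nrm (dual X) \<phi> \<le> 1" using le1 by (intro dual_nrm_le) auto
    ultimately show "\<phi> \<in> unit_ball (dual X)" by (simp add: unit_ball_def)
  next
    fix \<phi> assume "\<phi> \<in> unit_ball (dual X)"
    then have \<phi>: "\<phi> \<in> vecs (dual X)" "nrm (dual X) \<phi> \<le> 1" by (auto simp: unit_ball_def)
    have "cmod (\<phi> x) \<le> r x" for x
    proof (cases "x \<in> vecs X")
      case True
      have "cmod (\<phi> x) \<le> nrm (dual X) \<phi> * nrm X x" using dual_le[OF \<phi>(1) True] .
      also have "\<dots> \<le> nrm X x" using mult_right_mono[OF \<phi>(2) nrm_ge_0[OF True]] by simp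
      finally show ?thesis using True by (simp add: r_def)
    qed (use dual_off[OF \<phi>(1)] in \<open>simp add: r_def\<close>)
    then have "\<phi> \<in> C" by (simp add: C_def PiE_iff)
    moreover have "\<phi> \<in> L" using dual_add[OF \<phi>(1)] dual_scale[OF \<phi>(1)] by (simp add: L_def)
    ultimately show "\<phi> \<in> C \<inter> L" by blast
  qed
  ultimately have B: "compact (unit_ball (dual X))" by simp
  have "continuous_map (top_of_set (unit_ball (dual X))) (weak_star_topology X) (\<lambda>\<phi>. \<phi>)"
  proof (rule continuous_map_into_weak_star_topology)
    fix x
    have "continuous_on (unit_ball (dual X)) (\<lambda>\<phi>. \<phi> x)"
      by (rule continuous_on_subset[OF continuous_on_product_coordinates]) auto
    then show "continuous_map (top_of_set (unit_ball (dual X))) euclidean (\<lambda>\<phi>. \<phi> x)" by simp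
  qed (auto simp: unit_ball_def)
  moreover have "compactin (top_of_set (unit_ball (dual X))) (unit_ball (dual X))" using B by simp
  ultimately have "compactin (weak_star_topology X) ((\<lambda>\<phi>. \<phi>) ` unit_ball (dual X))"
    by (rule image_compactin[rotated])
  then show ?thesis by simp
qed

end

section \<open>Convex combinations of pointwise null sequences\<close>

text \<open>The convex hull of the terms from index \<open>n\<close> on.  Closure under mixtures of two points makes
  rule induction available.\<close>

inductive_set tail_hull :: "(nat \<Rightarrow> 'v::complex_vector) \<Rightarrow> nat \<Rightarrow> 'v set" for \<phi> n where
  base: "n \<le> k \<Longrightarrow> \<phi> k \<in> tail_hull \<phi> n"
| mix: "u \<in> tail_hull \<phi> n \<Longrightarrow> v \<in> tail_hull \<phi> n \<Longrightarrow> 0 \<le> s \<Longrightarrow> s \<le> 1 \<Longrightarrow>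
    of_real s *\<^sub>C u + of_real (1 - s) *\<^sub>C v \<in> tail_hull \<phi> n"

lemma tail_hull_mono:
  assumes "m \<le> n" "u \<in> tail_hull \<phi> n"
  shows "u \<in> tail_hull \<phi> m"
  using assms(2)
proof induction
  case (base k)
  then show ?case using assms(1) by (intro tail_hull.base) simp
next
  case (mix u v s)
  then show ?case by (intro tail_hull.mix)
qed

lemma norm_mix_le:
  fixes u v :: "'x \<Rightarrow> complex"
  assumes "0 \<le> s" "s \<le> 1"
  shows "cmod ((of_real s *\<^sub>C u + of_real (1 - s) *\<^sub>C v) x) \<le> s * cmod (u x) + (1 - s) * cmod (v x)"
proof -
  have "cmod ((of_real s *\<^sub>C u + of_real (1 - s) *\<^sub>C v) x) \<le> cmod (of_real s * u x) + cmod (of_real (1 - s) * v x)"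
    unfolding plus_fun_apply scaleC_functional by (rule norm_triangle_ineq)
  also have "\<dots> = s * cmod (u x) + (1 - s) * cmod (v x)"
    unfolding norm_mult norm_of_real using assms by simp
  finally show ?thesis .
qed

lemma tail_hull_norm_le:
  fixes \<phi> :: "nat \<Rightarrow> 'x \<Rightarrow> complex"
  assumes "h \<in> tail_hull \<phi> n" "\<And>k. n \<le> k \<Longrightarrow> cmod (\<phi> k x) \<le> b"
  shows "cmod (h x) \<le> b"
  using assms(1)
proof induction
  case (base k)
  then show ?case using assms(2) by blast
next
  case (mix u v s)
  have "s * cmod (u x) + (1 - s) * cmod (v x) \<le> s * b + (1 - s) * b"
    using mix by (intro add_mono mult_left_mono) auto
  then show ?case using norm_mix_le[OF mix.hyps(3,4), of u v x] by (simp add: algebra_simps)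
qed

lemma tail_hull_continuous:
  fixes \<phi> :: "nat \<Rightarrow> 'x \<Rightarrow> complex"
  assumes "h \<in> tail_hull \<phi> n" "\<And>k. continuous_map T euclidean (\<phi> k)"
  shows "continuous_map T euclidean h"
  using assms(1)
proof induction
  case (base k)
  then show ?case using assms(2) by blast
next
  case (mix u v s)
  have scale: "continuous_map T euclidean (\<lambda>x. c * h x)" if "continuous_map T euclidean h" for c and h :: "'x \<Rightarrow> complex"
  proof -
    have "continuous_map T euclidean ((\<lambda>w. c * w) \<circ> h)"
      by (rule continuous_map_compose[OF that])
        (intro continuous_map_iff_continuous2[THEN iffD2] continuous_intros)
    then show ?thesis by (simp add: o_def)
  qed
  have "(of_real s *\<^sub>C u + of_real (1 - s) *\<^sub>C v) = (\<lambda>x. of_real s * u x + of_real (1 - s) * v x)"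
    unfolding plus_fun_def scaleC_functional ..
  then show ?case using continuous_map_add[OF scale[OF mix.IH(1)] scale[OF mix.IH(2)]] by metis
qed

text \<open>If no convex combination is uniformly small, then one finds combinations from later and
  later tails and shrinking nonempty compact sets on which they stay large.  Passing to a
  combination \<open>h\<^sub>1\<close> whose supremum is almost minimal makes the loss in each step arbitrarily
  small: a mixture of \<open>h\<^sub>1\<close> with a little of \<open>h\<close> can only be large at points where both are.\<close>

lemma convex_null_step:
  fixes \<phi> :: "nat \<Rightarrow> 'x \<Rightarrow> complex" and A :: "'x set"
  defines "Q \<equiv> \<lambda>A b. \<exists>m. \<forall>h\<in>tail_hull \<phi> m. \<exists>x\<in>A. b \<le> cmod (h x)"
  assumes bound: "\<And>n x. x \<in> A \<Longrightarrow> cmod (\<phi> n x) \<le> B" and Q: "Q A \<beta>" and less: "\<beta>' < \<beta>"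
  shows "\<exists>h\<in>tail_hull \<phi> n. Q {x \<in> A. \<beta>' \<le> cmod (h x)} \<beta>'"
proof -
  have hB: "cmod (h x) \<le> B" if "h \<in> tail_hull \<phi> m" "x \<in> A" for h m x
    using tail_hull_norm_le[OF that(1)] bound that(2) by blast
  obtain m0 where "\<forall>h\<in>tail_hull \<phi> m0. \<exists>x\<in>A. \<beta> \<le> cmod (h x)" using Q unfolding Q_def by blast
  moreover have "\<phi> m0 \<in> tail_hull \<phi> m0" by (rule tail_hull.base) simp
  ultimately obtain x0 where "x0 \<in> A" by blast
  then have B0: "0 \<le> B" using bound norm_ge_zero order_trans by blast
  define \<alpha> where "\<alpha> = Sup {b. Q A b}"
  have bdd: "bdd_above {b. Q A b}"
  proof (rule bdd_aboveI)
    fix b assume "b \<in> {b. Q A b}"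
    then obtain m where "\<forall>h\<in>tail_hull \<phi> m. \<exists>x\<in>A. b \<le> cmod (h x)" unfolding Q_def by blast
    moreover have m: "\<phi> m \<in> tail_hull \<phi> m" by (rule tail_hull.base) simp
    ultimately obtain x where "x \<in> A" "b \<le> cmod (\<phi> m x)" by blast
    then show "b \<le> B" using hB[OF m] by fastforce
  qed
  have "\<beta> \<le> \<alpha>" unfolding \<alpha>_def using Q bdd by (intro cSup_upper) auto
  define \<delta> where "\<delta> = \<beta> - \<beta>'"
  have "0 < \<delta>" using less by (simp add: \<delta>_def)
  \<comment> \<open>\<open>s\<close> is the weight of \<open>h\<close> in the mixture; it must be small against \<open>\<delta> / B\<close> to make \<open>h\<^sub>1\<close> large,
    and the defect \<open>\<eta>\<close> of minimality must be small against \<open>s\<close> to make \<open>h\<close> large\<close>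
  define s where "s = min (1/2) (\<delta> / (2 * (B + 1)))"
  have s: "0 < s" "s \<le> 1/2" unfolding s_def using \<open>0 < \<delta>\<close> B0 by (simp, intro min.cobounded1)
  have "s * (B + 1) \<le> \<delta> / 2"
  proof -
    have "s \<le> \<delta> / (2 * (B + 1))" by (simp add: s_def)
    then show ?thesis using B0 by (simp add: field_simps)
  qed
  then have sB: "s * B \<le> \<delta> / 2" using s by (simp add: algebra_simps)
  define \<eta> where "\<eta> = s * \<delta> / 2"
  have \<eta>: "0 < \<eta>" "\<eta> \<le> \<delta> / 4"
    using s \<open>0 < \<delta>\<close> mult_right_mono[OF s(2), of \<delta>] by (simp_all add: \<eta>_def)
  obtain a where "Q A a" "\<alpha> - \<eta> < a"
    using less_cSupD[of "{b. Q A b}" "\<alpha> - \<eta>"] Q \<eta> unfolding \<alpha>_def by auto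
  then obtain m where m: "\<And>h. h \<in> tail_hull \<phi> m \<Longrightarrow> \<exists>x\<in>A. \<alpha> - \<eta> \<le> cmod (h x)"
    unfolding Q_def by (meson less_imp_le order_trans)
  have "\<not> Q A (\<alpha> + \<eta>)"
  proof
    assume "Q A (\<alpha> + \<eta>)"
    then have "\<alpha> + \<eta> \<le> \<alpha>" unfolding \<alpha>_def using bdd by (intro cSup_upper) auto
    then show False using \<eta> by simp
  qed
  then obtain h\<^sub>1 where h1: "h\<^sub>1 \<in> tail_hull \<phi> (max n m)" and h1_less: "\<And>x. x \<in> A \<Longrightarrow> cmod (h\<^sub>1 x) < \<alpha> + \<eta>"
    unfolding Q_def by (meson not_le)
  have "\<exists>x\<in>{x \<in> A. \<beta>' \<le> cmod (h\<^sub>1 x)}. \<beta>' \<le> cmod (h x)" if h: "h \<in> tail_hull \<phi> (max n m)" for h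
  proof -
    have "of_real s *\<^sub>C h + of_real (1 - s) *\<^sub>C h\<^sub>1 \<in> tail_hull \<phi> (max n m)"
      using h h1 s by (intro tail_hull.mix) auto
    then have "of_real s *\<^sub>C h + of_real (1 - s) *\<^sub>C h\<^sub>1 \<in> tail_hull \<phi> m"
      by (rule tail_hull_mono[rotated]) simp
    then obtain x where x: "x \<in> A" "\<alpha> - \<eta> \<le> cmod ((of_real s *\<^sub>C h + of_real (1 - s) *\<^sub>C h\<^sub>1) x)"
      using m by blast
    then have key: "\<alpha> - \<eta> \<le> s * cmod (h x) + (1 - s) * cmod (h\<^sub>1 x)"
      using norm_mix_le[of s h h\<^sub>1 x] s by linarith
    have "s * cmod (h x) \<le> s * B" using hB[OF h x(1)] s by (intro mult_left_mono) auto
    moreover have "(1 - s) * cmod (h\<^sub>1 x) \<le> cmod (h\<^sub>1 x)" using s by (simp add: mult_left_le_one_le)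
    ultimately have "s * cmod (h x) + (1 - s) * cmod (h\<^sub>1 x) \<le> \<delta> / 2 + cmod (h\<^sub>1 x)"
      using sB by (intro add_mono) auto
    then have "\<alpha> - \<eta> \<le> \<delta> / 2 + cmod (h\<^sub>1 x)" using key by (rule order_trans[rotated])
    then have one: "\<beta>' \<le> cmod (h\<^sub>1 x)"
      using \<eta>(2) \<open>\<beta> \<le> \<alpha>\<close> \<open>0 < \<delta>\<close> unfolding \<delta>_def by argo
    have "(1 - s) * cmod (h\<^sub>1 x) \<le> (1 - s) * (\<alpha> + \<eta>)"
      using h1_less[OF x(1)] s by (intro mult_left_mono) auto
    then have "\<alpha> - \<eta> \<le> s * cmod (h x) + (1 - s) * (\<alpha> + \<eta>)" using key by linarith
    then have "s * \<alpha> - 2 * \<eta> + s * \<eta> \<le> s * cmod (h x)" by (simp add: algebra_simps)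
    moreover have "2 * \<eta> = s * \<delta>" by (simp add: \<eta>_def)
    moreover have "0 \<le> s * \<eta>" using s \<eta> by simp
    ultimately have "s * (\<alpha> - \<delta>) \<le> s * cmod (h x)" by (simp add: right_diff_distrib)
    then have "\<alpha> - \<delta> \<le> cmod (h x)" using s by simp
    then have "\<beta>' \<le> cmod (h x)" using \<open>\<beta> \<le> \<alpha>\<close> by (simp add: \<delta>_def)
    then show ?thesis using x(1) one by blast
  qed
  then have "Q {x \<in> A. \<beta>' \<le> cmod (h\<^sub>1 x)} \<beta>'" unfolding Q_def by blast
  moreover have "h\<^sub>1 \<in> tail_hull \<phi> n" using h1 by (rule tail_hull_mono[rotated]) simp
  ultimately show ?thesis by blast
qed

text \<open>If the conclusion failed, the preceding step could be iterated with bounds that stay above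
  \<open>\<epsilon> / 2\<close>.  By compactness the resulting sets have a common point \<open>x\<close>, at which some combination
  of every tail is at least \<open>\<epsilon> / 2\<close> in modulus, although \<open>\<phi> n x\<close> tends to zero.\<close>

theorem convex_combination_uniformly_small:
  fixes \<phi> :: "nat \<Rightarrow> 'x \<Rightarrow> complex"
  assumes K: "compactin T K" and cont: "\<And>n. continuous_map T euclidean (\<phi> n)"
    and bound: "\<And>n x. x \<in> K \<Longrightarrow> cmod (\<phi> n x) \<le> B"
    and null: "\<And>x. x \<in> K \<Longrightarrow> (\<lambda>n. \<phi> n x) \<longlonglongrightarrow> 0" and \<epsilon>: "0 < \<epsilon>"
  shows "\<exists>h\<in>tail_hull \<phi> 0. \<forall>x\<in>K. cmod (h x) < \<epsilon>"
proof (rule ccontr)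
  assume neg: "\<not> ?thesis"
  define Q where "Q A b \<longleftrightarrow> (\<exists>m. \<forall>h\<in>tail_hull \<phi> m. \<exists>x\<in>A. b \<le> cmod (h x))" for A b
  define \<beta> where "\<beta> n = \<epsilon> / 2 + \<epsilon> / 2 * (1/2) ^ n" for n :: nat
  have \<beta>: "\<beta> (Suc n) < \<beta> n" "\<epsilon> / 2 \<le> \<beta> n" for n using \<epsilon> by (simp_all add: \<beta>_def)
  have "Q K (\<beta> 0)" using neg unfolding Q_def \<beta>_def by (auto simp: not_less intro!: exI[of _ 0])
  have "\<exists>A. \<forall>n. (A n \<subseteq> K \<and> closedin (subtopology T K) (A n) \<and> Q (A n) (\<beta> n)) \<and>
      (A (Suc n) \<subseteq> A n \<and> (\<exists>h\<in>tail_hull \<phi> n. \<forall>x\<in>A (Suc n). \<beta> (Suc n) \<le> cmod (h x)))"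
  proof (rule dependent_nat_choice)
    have "closedin (subtopology T K) K"
      using compactin_subset_topspace[OF K] by (simp add: closedin_subtopology_refl)
    then show "\<exists>A. A \<subseteq> K \<and> closedin (subtopology T K) A \<and> Q A (\<beta> 0)" using \<open>Q K (\<beta> 0)\<close> by blast
  next
    fix A n assume A: "A \<subseteq> K \<and> closedin (subtopology T K) A \<and> Q A (\<beta> n)"
    have "\<exists>h\<in>tail_hull \<phi> n. Q {x \<in> A. \<beta> (Suc n) \<le> cmod (h x)} (\<beta> (Suc n))"
      unfolding Q_def
    proof (rule convex_null_step)
      show "cmod (\<phi> k x) \<le> B" if "x \<in> A" for k x using bound A that by blast
      show "\<exists>m. \<forall>h\<in>tail_hull \<phi> m. \<exists>x\<in>A. \<beta> n \<le> cmod (h x)" using A by (simp add: Q_def)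
    qed (rule \<beta>)
    then obtain h where h: "h \<in> tail_hull \<phi> n" "Q {x \<in> A. \<beta> (Suc n) \<le> cmod (h x)} (\<beta> (Suc n))" by blast
    have "continuous_map (subtopology T K) euclidean h"
      using tail_hull_continuous[OF h(1) cont] by (rule continuous_map_from_subtopology)
    moreover have "closed {w. \<beta> (Suc n) \<le> cmod w}" by (intro closed_Collect_le continuous_intros)
    ultimately have "closedin (subtopology T K) {x \<in> A. h x \<in> {w. \<beta> (Suc n) \<le> cmod w}}"
      using A by (intro closedin_continuous_map_preimage_gen) auto
    then show "\<exists>A'. (A' \<subseteq> K \<and> closedin (subtopology T K) A' \<and> Q A' (\<beta> (Suc n))) \<and>
      A' \<subseteq> A \<and> (\<exists>h\<in>tail_hull \<phi> n. \<forall>x\<in>A'. \<beta> (Suc n) \<le> cmod (h x))"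
      using A h by (intro exI[of _ "{x \<in> A. \<beta> (Suc n) \<le> cmod (h x)}"]) auto
  qed
  then obtain A where A: "\<And>n. A n \<subseteq> K" "\<And>n. closedin (subtopology T K) (A n)" "\<And>n. Q (A n) (\<beta> n)"
    and dec: "\<And>n. A (Suc n) \<subseteq> A n" and big: "\<And>n. \<exists>h\<in>tail_hull \<phi> n. \<forall>x\<in>A (Suc n). \<beta> (Suc n) \<le> cmod (h x)"
    by metis
  have ne: "A n \<noteq> {}" for n
  proof -
    obtain m where "\<forall>h\<in>tail_hull \<phi> m. \<exists>x\<in>A n. \<beta> n \<le> cmod (h x)" using A(3) unfolding Q_def by blast
    moreover have "\<phi> m \<in> tail_hull \<phi> m" by (rule tail_hull.base) simp
    ultimately show ?thesis by blast
  qed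
  have "(\<Inter>n. A n) \<noteq> {}"
  proof (rule compact_space_imp_nest)
    show "compact_space (subtopology T K)" using K compact_space_subtopology by blast
    show "decseq A" using dec by (rule decseq_SucI)
  qed (use A ne in auto)
  then obtain x where x: "\<And>n. x \<in> A n" by blast
  then have "x \<in> K" using A by blast
  then obtain N where N: "\<And>n. N \<le> n \<Longrightarrow> cmod (\<phi> n x) < \<epsilon> / 4"
    using LIMSEQ_D[OF null, of x "\<epsilon> / 4"] \<epsilon> by auto
  obtain h where h: "h \<in> tail_hull \<phi> N" "\<beta> (Suc N) \<le> cmod (h x)" using big[of N] x by blast
  have "cmod (h x) \<le> \<epsilon> / 4" using N by (intro tail_hull_norm_le[OF h(1)]) (simp only: less_imp_le)
  then show False using h(2) \<beta>(2)[of "Suc N"] \<epsilon> by linarith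
qed

section \<open>Krein's theorem\<close>

context complex_normed_space
begin

lemma closedin_functional_le:
  assumes "\<phi> \<in> vecs (dual X)"
  shows "closedin (weak_topology X) {x \<in> vecs X. cmod (\<phi> x) \<le> b}"
proof -
  have "closed {w. cmod w \<le> b}" by (intro closed_Collect_le continuous_intros)
  then have "closedin (weak_topology X) {x \<in> topspace (weak_topology X). \<phi> x \<in> {w. cmod w \<le> b}}"
    by (intro closedin_continuous_map_preimage[OF continuous_map_functional[OF assms]]) simp
  then show ?thesis by simp
qed

lemma functional_le_on_weak_closure:
  assumes "\<phi> \<in> vecs (dual X)" "S \<subseteq> vecs X" "\<And>x. x \<in> S \<Longrightarrow> cmod (\<phi> x) \<le> b"
    and "x \<in> weak_topology X closure_of S"
  shows "cmod (\<phi> x) \<le> b"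
proof -
  have "weak_topology X closure_of S \<subseteq> {x \<in> vecs X. cmod (\<phi> x) \<le> b}"
    using assms closedin_functional_le by (intro closure_of_minimal) auto
  then show ?thesis using assms(4) by blast
qed

lemma finite_net_for_functionals:
  assumes K: "compactin (weak_topology X) K" and \<Phi>: "finite \<Phi>" "\<Phi> \<subseteq> vecs (dual X)" and r: "0 < r"
  shows "\<exists>D. finite D \<and> D \<subseteq> K \<and> (\<forall>x\<in>K. \<exists>d\<in>D. \<forall>\<phi>\<in>\<Phi>. cmod (\<phi> x - \<phi> d) < r)"
proof -
  have KX: "K \<subseteq> vecs X" using compactin_subset_topspace[OF K] by simp
  define Nb where "Nb d = vecs X \<inter> (\<Inter>\<phi>\<in>\<Phi>. {x \<in> vecs X. \<phi> x \<in> ball (\<phi> d) r})" for d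
  have "openin (weak_topology X) (Nb d)" for d
  proof -
    have "openin (weak_topology X) {x \<in> vecs X. \<phi> x \<in> ball (\<phi> d) r}" if "\<phi> \<in> \<Phi>" for \<phi>
      using openin_continuous_map_preimage[OF continuous_map_functional, of \<phi> "ball (\<phi> d) r"] that \<Phi>(2) by auto
    then have "openin (weak_topology X) ((\<Inter>\<phi>\<in>\<Phi>. {x \<in> vecs X. \<phi> x \<in> ball (\<phi> d) r}) \<inter> topspace (weak_topology X))"
      by (intro openin_INT[OF \<Phi>(1)])
    then show ?thesis by (simp only: Nb_def topspace_weak_topology Int_commute)
  qed
  moreover have "K \<subseteq> \<Union> (Nb ` K)" using KX r by (auto simp: Nb_def)
  ultimately obtain \<F> where \<F>: "finite \<F>" "\<F> \<subseteq> Nb ` K" "K \<subseteq> \<Union> \<F>"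
    using compactinD[OF K, of "Nb ` K"] by auto
  then obtain D where D: "D \<subseteq> K" "finite D" "\<F> = Nb ` D" using finite_subset_image by metis
  have "\<exists>d\<in>D. \<forall>\<phi>\<in>\<Phi>. cmod (\<phi> x - \<phi> d) < r" if "x \<in> K" for x
  proof -
    obtain d where "d \<in> D" "x \<in> Nb d" using \<F>(3) D(3) \<open>x \<in> K\<close> by auto
    then show ?thesis by (auto simp: Nb_def dist_norm norm_minus_commute)
  qed
  then show ?thesis using D by blast
qed

text \<open>By compactness of the dual ball, a point of the closure where \<open>\<phi> n\<close> does not tend to zero would
  be detected by a functional that vanishes on \<open>D\<close>, and hence on its weak closure.\<close>

lemma null_on_weak_closure:
  assumes \<phi>: "\<And>n. \<phi> n \<in> unit_ball (dual X)" and DX: "D \<subseteq> vecs X"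
    and van: "\<And>d. d \<in> D \<Longrightarrow> \<exists>N. \<forall>n\<ge>N. \<phi> n d = 0"
    and x: "x \<in> weak_topology X closure_of D"
  shows "(\<lambda>n. \<phi> n x) \<longlonglongrightarrow> 0"
proof (rule ccontr)
  have xX: "x \<in> vecs X" using x closure_of_subset_topspace[of "weak_topology X" D] by auto
  assume "\<not> ?thesis"
  then obtain r where r: "0 < r" and freq: "\<And>N. \<exists>n\<ge>N. r \<le> cmod (\<phi> n x)"
    unfolding LIMSEQ_iff by (auto simp: not_less)
  define C where "C N = {\<psi> \<in> vecs (dual X). r \<le> cmod (\<psi> x) \<and> (\<forall>d\<in>D. (\<forall>n\<ge>N. \<phi> n d = 0) \<longrightarrow> \<psi> d = 0)}" for N
  have "\<exists>\<psi>\<in>unit_ball (dual X). \<forall>N. \<psi> \<in> C N"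
  proof (rule compactin_nested[OF banach_alaoglu])
    show "closedin (weak_star_topology X) (C N)" for N
    proof -
      have clo: "closedin (weak_star_topology X) {\<psi> \<in> vecs (dual X). \<psi> y \<in> W}" if "y \<in> vecs X" "closed W" for y W
        using closedin_continuous_map_preimage[OF continuous_map_evaluation[OF that(1)], of W] that(2) by simp
      have C: "C N = {\<psi> \<in> vecs (dual X). \<psi> x \<in> {w. r \<le> cmod w}} \<inter>
          (vecs (dual X) \<inter> (\<Inter>d\<in>{d\<in>D. \<forall>n\<ge>N. \<phi> n d = 0}. {\<psi> \<in> vecs (dual X). \<psi> d \<in> {0}}))"
        by (auto simp: C_def)
      have "closed {w. r \<le> cmod w}" by (intro closed_Collect_le continuous_intros)
      from clo[OF xX this] show ?thesis
        unfolding C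
      proof (rule closedin_Int)
        show "closedin (weak_star_topology X)
          (vecs (dual X) \<inter> (\<Inter>d\<in>{d\<in>D. \<forall>n\<ge>N. \<phi> n d = 0}. {\<psi> \<in> vecs (dual X). \<psi> d \<in> {0}}))"
        proof (cases "{d\<in>D. \<forall>n\<ge>N. \<phi> n d = 0} = {}")
          case True
          show ?thesis unfolding True using closedin_topspace[of "weak_star_topology X"] by simp
        next
          case False
          have "closedin (weak_star_topology X) {\<psi> \<in> vecs (dual X). \<psi> d \<in> {0}}" if "d \<in> D" for d
            by (rule clo) (use DX that in auto)
          then show ?thesis
            using closedin_topspace[of "weak_star_topology X"] False
            by (intro closedin_Int closedin_INT) auto
        qed
      qed
    qed
    show "decseq C" unfolding decseq_def C_def by auto
    fix N
    obtain n where "N \<le> n" "r \<le> cmod (\<phi> n x)" using freq by blast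
    then have "\<phi> n \<in> C N" using \<phi>[of n] by (auto simp: C_def unit_ball_def)
    then show "unit_ball (dual X) \<inter> C N \<noteq> {}" using \<phi>[of n] by blast
  qed
  then obtain \<psi> where \<psi>: "\<And>N. \<psi> \<in> C N" by blast
  have van0: "cmod (\<psi> d) \<le> 0" if "d \<in> D" for d
    using van[OF that] \<psi> that by (auto simp: C_def)
  have "cmod (\<psi> x) \<le> 0"
  proof (rule functional_le_on_weak_closure[OF _ DX _ x])
    show "\<psi> \<in> vecs (dual X)" using \<psi>[of 0] by (simp add: C_def)
  qed (rule van0)
  then show False using \<psi>[of 0] r by (simp add: C_def)
qed

end

text \<open>A convex combination involves only finitely many terms, so a net that is fine enough for the
  first \<open>N\<close> of them is fine for the combination.\<close>

lemma tail_hull_common_net: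
  fixes \<phi> :: "nat \<Rightarrow> 'x \<Rightarrow> complex"
  assumes "h \<in> tail_hull \<phi> m"
  shows "\<exists>N. \<forall>x d t. (\<forall>i<N. cmod (\<phi> i x - \<phi> i d) < t) \<longrightarrow> cmod (h x - h d) \<le> t"
  using assms
proof induction
  case (base k)
  show ?case by (intro exI[of _ "Suc k"]) (auto intro: less_imp_le)
next
  case (mix u v s)
  then obtain M N where M: "\<And>x d t. (\<forall>i<M. cmod (\<phi> i x - \<phi> i d) < t) \<Longrightarrow> cmod (u x - u d) \<le> t"
    and N: "\<And>x d t. (\<forall>i<N. cmod (\<phi> i x - \<phi> i d) < t) \<Longrightarrow> cmod (v x - v d) \<le> t" by blast
  show ?case
  proof (intro exI[of _ "max M N"] allI impI)
    fix x d t assume *: "\<forall>i<max M N. cmod (\<phi> i x - \<phi> i d) < t"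
    have "s * cmod (u x - u d) + (1 - s) * cmod (v x - v d) \<le> s * t + (1 - s) * t"
      using M[of x d t] N[of x d t] * mix.hyps by (intro add_mono mult_left_mono) auto
    moreover have "cmod ((of_real s *\<^sub>C u + of_real (1 - s) *\<^sub>C v) x - (of_real s *\<^sub>C u + of_real (1 - s) *\<^sub>C v) d)
        = cmod ((of_real s *\<^sub>C (\<lambda>x. u x - u d) + of_real (1 - s) *\<^sub>C (\<lambda>x. v x - v d)) x)"
      unfolding plus_fun_apply scaleC_functional by (simp add: algebra_simps)
    ultimately show "cmod ((of_real s *\<^sub>C u + of_real (1 - s) *\<^sub>C v) x - (of_real s *\<^sub>C u + of_real (1 - s) *\<^sub>C v) d) \<le> t"
      using norm_mix_le[OF mix.hyps(3,4), of "\<lambda>x. u x - u d" "\<lambda>x. v x - v d" x] by (simp add: algebra_simps)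
  qed
qed

text \<open>The hypothesis on \<open>z\<close> is weaker than being bounded by a multiple of the supremum over \<open>S\<close>, as it
  would be in Krein's theorem: an arbitrarily small multiple of the norm may be added.  The
  Davis-Figiel-Johnson-Pelczynski space needs this form.

  Suppose that \<open>z\<close> is not an evaluation, and let \<open>K\<close> be the weak closure of \<open>S\<close>.  Choose
  alternately finite subsets of \<open>K\<close>, which are finer and finer nets with respect to the functionals
  chosen so far, and functionals \<open>\<phi> n\<close> of norm at most one which vanish on all points chosen so far
  while \<open>z (\<phi> n) = \<theta>\<close>.  Then \<open>\<phi> n\<close> tends to zero pointwise on the weak closure of the chosen
  points, so some convex combination \<open>h\<close> is small at all these points and hence, as they contain
  nets, on \<open>K\<close>.  Then the hypothesis makes \<open>z h\<close> smaller than \<open>\<theta>\<close>, but \<open>z h = \<theta>\<close>.\<close>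

theorem (in complex_banach_space) krein_evaluation:
  assumes S: "relatively_weakly_compact X S" and M: "\<And>x. x \<in> S \<Longrightarrow> nrm X x \<le> M"
    and z: "z \<in> vecs (dual (dual X))"
    and dom: "\<And>e. 0 < e \<Longrightarrow> \<exists>C\<ge>0. \<forall>\<phi>\<in>vecs (dual X). \<forall>b\<ge>0.
      (\<forall>x\<in>S. cmod (\<phi> x) \<le> b) \<longrightarrow> cmod (z \<phi>) \<le> C * b + e * nrm (dual X) \<phi>"
  shows "is_evaluation X z"
proof (rule ccontr)
  interpret D: complex_normed_space "dual X" by (rule dual_normed)
  assume "\<not> is_evaluation X z"
  then obtain \<theta> :: real where \<theta>: "0 < \<theta>"
    and pickable: "\<forall>D. finite D \<longrightarrow> D \<subseteq> vecs X \<longrightarrow>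
      (\<exists>\<phi>\<in>unit_ball (dual X). (\<forall>d\<in>D. \<phi> d = 0) \<and> z \<phi> = of_real \<theta>)"
    using not_evaluation_functionals[OF z] by blast
  define K where "K = weak_topology X closure_of S"
  have K: "compactin (weak_topology X) K" and SX: "S \<subseteq> vecs X"
    using S by (simp_all add: relatively_weakly_compact_def K_def)
  have KX: "K \<subseteq> vecs X" using compactin_subset_topspace[OF K] by simp
  have SK: "S \<subseteq> K" unfolding K_def using closure_of_subset[of S "weak_topology X"] SX by simp
  obtain pick where pick: "\<And>D. finite D \<Longrightarrow> D \<subseteq> vecs X \<Longrightarrow> pick D \<in> unit_ball (dual X)"
    "\<And>D d. finite D \<Longrightarrow> D \<subseteq> vecs X \<Longrightarrow> d \<in> D \<Longrightarrow> pick D d = 0"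
    "\<And>D. finite D \<Longrightarrow> D \<subseteq> vecs X \<Longrightarrow> z (pick D) = of_real \<theta>"
    using pickable by metis
  have "\<exists>D. finite D \<and> D \<subseteq> K \<and> (\<forall>x\<in>K. \<exists>d\<in>D. \<forall>\<phi>\<in>\<Phi>. cmod (\<phi> x - \<phi> d) < inverse (Suc n))"
    if "finite \<Phi>" "\<Phi> \<subseteq> vecs (dual X)" for \<Phi> and n :: nat
    using finite_net_for_functionals[OF K that] by simp
  then obtain net where net: "\<And>\<Phi> n. finite \<Phi> \<Longrightarrow> \<Phi> \<subseteq> vecs (dual X) \<Longrightarrow> finite (net \<Phi> n)"
    "\<And>\<Phi> n. finite \<Phi> \<Longrightarrow> \<Phi> \<subseteq> vecs (dual X) \<Longrightarrow> net \<Phi> n \<subseteq> K"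
    "\<And>\<Phi> n x. finite \<Phi> \<Longrightarrow> \<Phi> \<subseteq> vecs (dual X) \<Longrightarrow> x \<in> K \<Longrightarrow>
       \<exists>d\<in>net \<Phi> n. \<forall>\<phi>\<in>\<Phi>. cmod (\<phi> x - \<phi> d) < inverse (Suc n)"
    by metis
  \<comment> \<open>the state after \<open>n\<close> steps: the functionals chosen so far and the points where all later
    ones vanish\<close>
  define st where "st = rec_nat ({}, {}) (\<lambda>n (\<Phi>, D). (insert (pick (D \<union> net \<Phi> n)) \<Phi>, D \<union> net \<Phi> n))"
  define P where "P n = fst (st n)" for n
  define D where "D n = snd (st n)" for n
  define \<phi> where "\<phi> n = pick (D (Suc n))" for n
  have st0: "P 0 = {}" "D 0 = {}" by (simp_all add: P_def D_def st_def)
  have D_Suc: "D (Suc n) = D n \<union> net (P n) n" for n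
    by (simp add: P_def D_def st_def split_beta)
  have P_Suc: "P (Suc n) = insert (\<phi> n) (P n)" for n
    unfolding \<phi>_def D_Suc by (simp add: P_def D_def st_def split_beta)
  have inv: "finite (P n) \<and> P n \<subseteq> vecs (dual X) \<and> finite (D n) \<and> D n \<subseteq> K" for n
  proof (induction n)
    case (Suc n)
    then have "finite (D (Suc n))" "D (Suc n) \<subseteq> K" unfolding D_Suc using net(1,2)[of "P n" n] by auto
    moreover from this have "\<phi> n \<in> vecs (dual X)"
      unfolding \<phi>_def using pick(1)[of "D (Suc n)"] KX by (auto simp: unit_ball_def)
    ultimately show ?case unfolding P_Suc using Suc by simp
  qed (simp add: st0)
  have fin: "finite (D n)" "D n \<subseteq> vecs X" for n using inv[of n] KX by auto
  have \<phi>: "\<phi> n \<in> unit_ball (dual X)" "z (\<phi> n) = of_real \<theta>" for n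
    unfolding \<phi>_def by (rule pick(1)[OF fin], rule pick(3)[OF fin])
  have \<phi>_van: "\<phi> n d = 0" if "d \<in> D (Suc n)" for n d
    unfolding \<phi>_def using pick(2)[OF fin that] .
  have D_mono: "D m \<subseteq> D n" if "m \<le> n" for m n
    using that by (rule lift_Suc_mono_le[rotated]) (auto simp: D_Suc)
  have \<phi>_P: "\<phi> i \<in> P n" if "i < n" for i n
    using that by (induction n) (auto simp: P_Suc less_Suc_eq)
  define DD where "DD = (\<Union>n. D n)"
  have DDK: "DD \<subseteq> K" using inv by (auto simp: DD_def)
  define A where "A = weak_topology X closure_of DD"
  have "closedin (weak_topology X) K" by (simp add: K_def)
  then have AK: "A \<subseteq> K" unfolding A_def using DDK by (intro closure_of_minimal)
  have DDA: "DD \<subseteq> A" unfolding A_def using closure_of_subset[of DD "weak_topology X"] DDK KX by auto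
  obtain C where C: "0 \<le> C" and zC: "\<And>\<phi> b. \<phi> \<in> vecs (dual X) \<Longrightarrow> 0 \<le> b \<Longrightarrow>
      (\<forall>x\<in>S. cmod (\<phi> x) \<le> b) \<Longrightarrow> cmod (z \<phi>) \<le> C * b + \<theta> / 2 * nrm (dual X) \<phi>"
    using dom[of "\<theta> / 2"] \<theta> by auto
  define r where "r = \<theta> / (4 * (C + 1))"
  have r: "0 < r" using \<theta> C by (simp add: r_def)
  have "\<exists>h\<in>tail_hull \<phi> 0. \<forall>x\<in>A. cmod (h x) < r"
  proof (rule convex_combination_uniformly_small[OF _ _ _ _ r])
    show "compactin (weak_topology X) A"
      using closed_compactin[OF K AK] by (simp add: A_def)
    show "continuous_map (weak_topology X) euclidean (\<phi> n)" for n
      using continuous_map_functional \<phi>(1) by (simp add: unit_ball_def)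
    show "cmod (\<phi> n x) \<le> M" if "x \<in> A" for n x
    proof (rule functional_le_on_weak_closure[OF _ SX])
      show "\<phi> n \<in> vecs (dual X)" using \<phi>(1)[of n] by (simp add: unit_ball_def)
      show "x \<in> weak_topology X closure_of S" using that AK by (auto simp: K_def)
      fix y assume y: "y \<in> S"
      then have yX: "y \<in> vecs X" using SX by blast
      have "cmod (\<phi> n y) \<le> nrm (dual X) (\<phi> n) * nrm X y"
        using dual_le[OF _ yX] \<phi>(1)[of n] by (simp add: unit_ball_def)
      also have "\<dots> \<le> nrm X y"
        using mult_right_mono[of _ 1, OF _ nrm_ge_0[OF yX]] \<phi>(1)[of n] by (simp add: unit_ball_def)
      finally show "cmod (\<phi> n y) \<le> M" using M[OF y] by simp
    qed
    show "(\<lambda>n. \<phi> n x) \<longlonglongrightarrow> 0" if "x \<in> A" for x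
    proof (rule null_on_weak_closure[OF \<phi>(1)])
      show "DD \<subseteq> vecs X" using DDK KX by blast
      show "x \<in> weak_topology X closure_of DD" using that by (simp add: A_def)
      fix d assume "d \<in> DD"
      then obtain N where "d \<in> D N" by (auto simp: DD_def)
      then have "\<phi> n d = 0" if "N \<le> n" for n using \<phi>_van D_mono[of N "Suc n"] that by auto
      then show "\<exists>N. \<forall>n\<ge>N. \<phi> n d = 0" by blast
    qed
  qed
  then obtain h where h: "h \<in> tail_hull \<phi> 0" and hr: "\<And>x. x \<in> A \<Longrightarrow> cmod (h x) < r" by blast
  have hB: "h \<in> unit_ball (dual X) \<and> z h = of_real \<theta>"
    using h
  proof induction
    case (mix u v s)
    then have uv: "u \<in> vecs (dual X)" "v \<in> vecs (dual X)" by (auto simp: unit_ball_def)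
    have "nrm (dual X) (of_real s *\<^sub>C u + of_real (1 - s) *\<^sub>C v)
        \<le> nrm (dual X) (of_real s *\<^sub>C u) + nrm (dual X) (of_real (1 - s) *\<^sub>C v)"
      using uv by (intro D.nrm_triangle D.vscale)
    also have "\<dots> = s * nrm (dual X) u + (1 - s) * nrm (dual X) v"
      unfolding D.nrm_scaleC[OF uv(1)] D.nrm_scaleC[OF uv(2)] norm_of_real using mix.hyps by simp
    also have "\<dots> \<le> s * 1 + (1 - s) * 1"
      using mix by (intro add_mono mult_left_mono) (auto simp: unit_ball_def)
    finally have "of_real s *\<^sub>C u + of_real (1 - s) *\<^sub>C v \<in> unit_ball (dual X)"
      using uv D.vadd D.vscale by (simp add: unit_ball_def)
    moreover have "z (of_real s *\<^sub>C u + of_real (1 - s) *\<^sub>C v) = of_real s * z u + of_real (1 - s) * z v"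
      using D.dual_add[OF z, of "of_real s *\<^sub>C u" "of_real (1 - s) *\<^sub>C v"] D.dual_scale[OF z] uv D.vscale by metis
    moreover have "of_real s * of_real \<theta> + of_real (1 - s) * of_real \<theta> = (of_real \<theta> :: complex)"
      by (simp add: algebra_simps)
    ultimately show ?case using mix.IH by metis
  qed (use \<phi> in auto)
  obtain N where N: "\<And>x d t. (\<forall>i<N. cmod (\<phi> i x - \<phi> i d) < t) \<Longrightarrow> cmod (h x - h d) \<le> t"
    using tail_hull_common_net[OF h] by blast
  \<comment> \<open>the nets are so fine that the supremum of \<open>h\<close> over \<open>K\<close> is approached on \<open>DD\<close>\<close>
  have "cmod (h x) \<le> r" if x: "x \<in> K" for x
  proof (rule field_le_epsilon)
    fix e :: real assume "0 < e"
    then obtain n0 where n0: "inverse (Suc n0) < e" using reals_Archimedean by blast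
    define n where "n = max N n0"
    have "inverse (Suc n) \<le> inverse (Suc n0)" by (simp add: n_def le_imp_inverse_le)
    then have n: "inverse (Suc n) < e" using n0 by linarith
    obtain d where d: "d \<in> net (P n) n" "\<And>\<psi>. \<psi> \<in> P n \<Longrightarrow> cmod (\<psi> x - \<psi> d) < inverse (Suc n)"
      using net(3)[OF _ _ x, of "P n" n] inv[of n] by blast
    have "cmod (h x - h d) \<le> inverse (Suc n)" using d(2) \<phi>_P by (intro N) (auto simp: n_def)
    moreover have "d \<in> DD" using d(1) D_Suc[of n] by (auto simp: DD_def)
    then have "cmod (h d) < r" using hr DDA by blast
    moreover have "cmod (h x) \<le> cmod (h d) + cmod (h x - h d)" by (rule norm_triangle_sub)
    ultimately show "cmod (h x) \<le> r + e" using n by linarith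
  qed
  then have "cmod (z h) \<le> C * r + \<theta> / 2 * nrm (dual X) h"
    using zC[of h r] hB SK r by (auto simp: unit_ball_def)
  moreover have "\<theta> / 2 * nrm (dual X) h \<le> \<theta> / 2 * 1"
    using hB \<theta> by (intro mult_left_mono) (auto simp: unit_ball_def)
  moreover have "C * r \<le> \<theta> / 4" using C \<theta> by (simp add: r_def field_simps)
  ultimately show False using hB \<theta> by simp
qed

section \<open>Bounded operators and bounded holomorphic mappings\<close>

lemma complex_field_simps [simp]: "vecs complex_field = UNIV" "nrm complex_field = cmod"
  by (simp_all add: complex_field_def)

lemma complex_field_normed: "complex_normed_space complex_field"
  by standard (auto simp: complex_vector.subspace_def scaleC_complex_def norm_mult norm_triangle_ineq)

lemma vecs_dual: "vecs (dual X) = bounded_ops X complex_field"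
  by (simp add: dual_def)

lemma mem_bounded_ops_iff:
  "T \<in> bounded_ops X Y \<longleftrightarrow>
      (\<forall>x\<in>vecs X. T x \<in> vecs Y) \<and>
      (\<forall>x\<in>vecs X. \<forall>y\<in>vecs X. T (x + y) = T x + T y) \<and>
      (\<forall>a. \<forall>x\<in>vecs X. T (a *\<^sub>C x) = a *\<^sub>C T x) \<and>
      (\<exists>K. \<forall>x\<in>vecs X. nrm Y (T x) \<le> K * nrm X x) \<and>
      (\<forall>x. x \<notin> vecs X \<longrightarrow> T x = 0)"
  by (simp add: bounded_ops_def)

lemma bounded_ops_bound:
  assumes X: "complex_normed_space X" and T: "T \<in> bounded_ops X Y"
  obtains K where "0 < K" "\<And>x. x \<in> vecs X \<Longrightarrow> nrm Y (T x) \<le> K * nrm X x"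
proof -
  interpret X: complex_normed_space X by (rule X)
  obtain K where K: "\<forall>x\<in>vecs X. nrm Y (T x) \<le> K * nrm X x" using T mem_bounded_ops_iff by blast
  have "nrm Y (T x) \<le> (\<bar>K\<bar> + 1) * nrm X x" if "x \<in> vecs X" for x
  proof -
    have "K * nrm X x \<le> (\<bar>K\<bar> + 1) * nrm X x" using X.nrm_ge_0[OF that] by (intro mult_right_mono) auto
    then show ?thesis using K that by fastforce
  qed
  then show ?thesis by (intro that[of "\<bar>K\<bar> + 1"]) auto
qed

lemma bounded_ops_closed:
  assumes "T \<in> bounded_ops X Y" shows "x \<in> vecs X \<Longrightarrow> T x \<in> vecs Y"
    and "x \<in> vecs X \<Longrightarrow> y \<in> vecs X \<Longrightarrow> T (x + y) = T x + T y"
    and "x \<in> vecs X \<Longrightarrow> T (a *\<^sub>C x) = a *\<^sub>C T x"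
    and "x \<notin> vecs X \<Longrightarrow> T x = 0"
  using assms by (simp_all add: mem_bounded_ops_iff)

lemma bounded_ops_diff:
  assumes X: "complex_normed_space X" and T: "T \<in> bounded_ops X Y" and "x \<in> vecs X" "y \<in> vecs X"
  shows "T (x - y) = T x - T y"
  using bounded_ops_closed(2)[OF T, of "x - y" y] complex_normed_space.vdiff[OF X] assms(3,4) by simp

lemma bounded_ops_zero:
  assumes X: "complex_normed_space X" and T: "T \<in> bounded_ops X Y"
  shows "T 0 = 0"
  using bounded_ops_diff[OF X T, of 0 0] complex_normed_space.vzero[OF X] by simp

lemma bounded_ops_comp:
  assumes X: "complex_normed_space X" and Y: "complex_normed_space Y"
    and S: "S \<in> bounded_ops X Y" and T: "T \<in> bounded_ops Y Z"
  shows "T \<circ> S \<in> bounded_ops X Z"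
proof -
  obtain K where K: "0 < K" "\<And>x. x \<in> vecs X \<Longrightarrow> nrm Y (S x) \<le> K * nrm X x" using bounded_ops_bound[OF X S] by metis
  obtain L where L: "0 < L" "\<And>y. y \<in> vecs Y \<Longrightarrow> nrm Z (T y) \<le> L * nrm Y y" using bounded_ops_bound[OF Y T] by metis
  note S' = bounded_ops_closed[OF S] and T' = bounded_ops_closed[OF T]
  have "nrm Z (T (S x)) \<le> (L * K) * nrm X x" if "x \<in> vecs X" for x
  proof -
    have "nrm Z (T (S x)) \<le> L * nrm Y (S x)" using L(2) S'(1)[OF that] .
    also have "\<dots> \<le> L * (K * nrm X x)" using L(1) K(2)[OF that] by (intro mult_left_mono) auto
    finally show ?thesis by simp
  qed
  then have "\<exists>K. \<forall>x\<in>vecs X. nrm Z ((T \<circ> S) x) \<le> K * nrm X x" by auto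
  then show ?thesis
    unfolding mem_bounded_ops_iff using S' T' bounded_ops_zero[OF Y T] by simp
qed

lemma bounded_ops_add:
  assumes X: "complex_normed_space X" and Y: "complex_normed_space Y"
    and S: "S \<in> bounded_ops X Y" and T: "T \<in> bounded_ops X Y"
  shows "S + T \<in> bounded_ops X Y"
proof -
  interpret Y: complex_normed_space Y by (rule Y)
  obtain K where K: "\<And>x. x \<in> vecs X \<Longrightarrow> nrm Y (S x) \<le> K * nrm X x" using bounded_ops_bound[OF X S] by metis
  obtain L where L: "\<And>x. x \<in> vecs X \<Longrightarrow> nrm Y (T x) \<le> L * nrm X x" using bounded_ops_bound[OF X T] by metis
  note S' = bounded_ops_closed[OF S] and T' = bounded_ops_closed[OF T]
  have "nrm Y ((S + T) x) \<le> (K + L) * nrm X x" if "x \<in> vecs X" for x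
    using Y.nrm_triangle[OF S'(1)[OF that] T'(1)[OF that]] K[OF that] L[OF that]
    by (simp add: algebra_simps)
  then have "\<exists>K. \<forall>x\<in>vecs X. nrm Y ((S + T) x) \<le> K * nrm X x" by blast
  then show ?thesis
    unfolding mem_bounded_ops_iff using S' T' by (simp add: scaleC_add_right)
qed

lemma mem_Hinf_iff:
  "f \<in> vecs (Hinf E U F) \<longleftrightarrow>
     holomorphic_map E U F f \<and> (\<exists>K. \<forall>x\<in>U. nrm F (f x) \<le> K) \<and> (\<forall>x. x \<notin> U \<longrightarrow> f x = 0)"
  by (simp add: Hinf_def)

lemma Hinf_nrm_eq: "nrm (Hinf E U F) f = Sup (insert 0 ((\<lambda>x. nrm F (f x)) ` U))"
  by (simp add: Hinf_def)

lemma Hinf_nrm_le: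
  assumes "0 \<le> K" "\<And>x. x \<in> U \<Longrightarrow> nrm F (f x) \<le> K"
  shows "nrm (Hinf E U F) f \<le> K"
  unfolding Hinf_nrm_eq using assms by (intro cSup_least) auto

lemma Hinf_bdd_above:
  assumes "f \<in> vecs (Hinf E U F)"
  shows "bdd_above (insert 0 ((\<lambda>x. nrm F (f x)) ` U))"
proof -
  obtain K where "\<forall>x\<in>U. nrm F (f x) \<le> K" using assms mem_Hinf_iff by blast
  then show ?thesis by (intro bdd_aboveI[of _ "max 0 K"]) auto
qed

lemma Hinf_le:
  assumes "f \<in> vecs (Hinf E U F)" "x \<in> U"
  shows "nrm F (f x) \<le> nrm (Hinf E U F) f"
  unfolding Hinf_nrm_eq using Hinf_bdd_above[OF assms(1)] assms(2) by (intro cSup_upper) auto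

lemma Hinf_nrm_ge_0:
  assumes "f \<in> vecs (Hinf E U F)"
  shows "0 \<le> nrm (Hinf E U F) f"
  unfolding Hinf_nrm_eq using Hinf_bdd_above[OF assms] by (intro cSup_upper) auto

definition frechet_at ::
    "'a::complex_vector cnspace \<Rightarrow> 'a set \<Rightarrow> 'b::complex_vector cnspace \<Rightarrow> ('a \<Rightarrow> 'b) \<Rightarrow> 'a \<Rightarrow> ('a \<Rightarrow> 'b) \<Rightarrow> bool" where
  "frechet_at E U F f x A \<longleftrightarrow> (\<forall>\<epsilon>>0. \<exists>\<delta>>0. \<forall>y\<in>U. nrm E (y - x) < \<delta> \<longrightarrow>
     nrm F (f y - f x - A (y - x)) \<le> \<epsilon> * nrm E (y - x))"

lemma holomorphic_map_iff:
  "holomorphic_map E U F f \<longleftrightarrow>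
     (\<forall>x\<in>U. f x \<in> vecs F) \<and> (\<forall>x\<in>U. \<exists>A\<in>bounded_ops E F. frechet_at E U F f x A)"
  by (simp add: holomorphic_map_def frechet_at_def)

lemma frechet_at_comp:
  assumes E: "complex_normed_space E" and F: "complex_normed_space F" and UE: "U \<subseteq> vecs E"
    and T: "T \<in> bounded_ops F G" and fF: "\<And>x. x \<in> U \<Longrightarrow> f x \<in> vecs F" and x: "x \<in> U"
    and A: "A \<in> bounded_ops E F" and lim: "frechet_at E U F f x A"
  shows "frechet_at E U G (T \<circ> f) x (T \<circ> A)"
  unfolding frechet_at_def
proof (intro allI impI)
  interpret E: complex_normed_space E by (rule E)
  interpret F: complex_normed_space F by (rule F)
  obtain K where K: "0 < K" "\<And>y. y \<in> vecs F \<Longrightarrow> nrm G (T y) \<le> K * nrm F y" using bounded_ops_bound[OF F T] by metis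
  fix \<epsilon> :: real assume "0 < \<epsilon>"
  then have "0 < \<epsilon> / K" using K(1) by simp
  then obtain \<delta> where \<delta>: "0 < \<delta>" and le: "\<And>y. y \<in> U \<Longrightarrow> nrm E (y - x) < \<delta> \<Longrightarrow>
     nrm F (f y - f x - A (y - x)) \<le> \<epsilon> / K * nrm E (y - x)"
    using lim unfolding frechet_at_def by blast
  show "\<exists>\<delta>>0. \<forall>y\<in>U. nrm E (y - x) < \<delta> \<longrightarrow>
    nrm G ((T \<circ> f) y - (T \<circ> f) x - (T \<circ> A) (y - x)) \<le> \<epsilon> * nrm E (y - x)"
  proof (intro exI[of _ \<delta>] conjI ballI impI \<delta>)
    fix y assume y: "y \<in> U" "nrm E (y - x) < \<delta>"
    have Ayx: "A (y - x) \<in> vecs F" using bounded_ops_closed(1)[OF A] UE x y by blast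
    have "(T \<circ> f) y - (T \<circ> f) x - (T \<circ> A) (y - x) = T (f y - f x - A (y - x))"
      using bounded_ops_diff[OF F T] fF x y Ayx by simp
    then have "nrm G ((T \<circ> f) y - (T \<circ> f) x - (T \<circ> A) (y - x)) \<le> K * nrm F (f y - f x - A (y - x))"
      using K(2) fF x y Ayx by simp
    also have "\<dots> \<le> K * (\<epsilon> / K * nrm E (y - x))" using le[OF y] K(1) by (intro mult_left_mono) auto
    also have "\<dots> = \<epsilon> * nrm E (y - x)" using K(1) by simp
    finally show "nrm G ((T \<circ> f) y - (T \<circ> f) x - (T \<circ> A) (y - x)) \<le> \<epsilon> * nrm E (y - x)" .
  qed
qed

lemma frechet_at_add:
  assumes E: "complex_normed_space E" and F: "complex_normed_space F" and UE: "U \<subseteq> vecs E"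
    and fF: "\<And>x. x \<in> U \<Longrightarrow> f x \<in> vecs F" and gF: "\<And>x. x \<in> U \<Longrightarrow> g x \<in> vecs F" and x: "x \<in> U"
    and A: "A \<in> bounded_ops E F" and limA: "frechet_at E U F f x A"
    and B: "B \<in> bounded_ops E F" and limB: "frechet_at E U F g x B"
  shows "frechet_at E U F (f + g) x (A + B)"
  unfolding frechet_at_def
proof (intro allI impI)
  interpret E: complex_normed_space E by (rule E)
  interpret F: complex_normed_space F by (rule F)
  fix \<epsilon> :: real assume "0 < \<epsilon>"
  then have "0 < \<epsilon> / 2" by simp
  then obtain \<delta> \<delta>' where \<delta>: "0 < \<delta>" "0 < \<delta>'" and leA: "\<And>y. y \<in> U \<Longrightarrow> nrm E (y - x) < \<delta> \<Longrightarrow>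
     nrm F (f y - f x - A (y - x)) \<le> \<epsilon> / 2 * nrm E (y - x)"
    and leB: "\<And>y. y \<in> U \<Longrightarrow> nrm E (y - x) < \<delta>' \<Longrightarrow>
     nrm F (g y - g x - B (y - x)) \<le> \<epsilon> / 2 * nrm E (y - x)"
    using limA limB unfolding frechet_at_def by metis
  show "\<exists>\<delta>>0. \<forall>y\<in>U. nrm E (y - x) < \<delta> \<longrightarrow>
    nrm F ((f + g) y - (f + g) x - (A + B) (y - x)) \<le> \<epsilon> * nrm E (y - x)"
  proof (intro exI[of _ "min \<delta> \<delta>'"] conjI ballI impI)
    fix y assume y: "y \<in> U" "nrm E (y - x) < min \<delta> \<delta>'"
    have AB: "A (y - x) \<in> vecs F" "B (y - x) \<in> vecs F"
      using bounded_ops_closed(1)[OF A] bounded_ops_closed(1)[OF B] UE x y by blast+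
    have eq: "(f + g) y - (f + g) x - (A + B) (y - x) = (f y - f x - A (y - x)) + (g y - g x - B (y - x))"
      by simp
    have "nrm F ((f + g) y - (f + g) x - (A + B) (y - x))
        \<le> nrm F (f y - f x - A (y - x)) + nrm F (g y - g x - B (y - x))"
      unfolding eq using fF gF x y AB by (intro F.nrm_triangle F.vdiff) auto
    also have "\<dots> \<le> \<epsilon> / 2 * nrm E (y - x) + \<epsilon> / 2 * nrm E (y - x)"
      using leA[of y] leB[of y] y by (intro add_mono) auto
    finally show "nrm F ((f + g) y - (f + g) x - (A + B) (y - x)) \<le> \<epsilon> * nrm E (y - x)" by simp
  qed (use \<delta> in auto)
qed

lemma frechet_at_zero:
  assumes E: "complex_normed_space E" and F: "complex_normed_space F" and UE: "U \<subseteq> vecs E" and x: "x \<in> U"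
  shows "frechet_at E U F 0 x 0"
proof -
  interpret E: complex_normed_space E by (rule E)
  interpret F: complex_normed_space F by (rule F)
  have "0 \<le> \<epsilon> * nrm E (y - x)" if "0 < \<epsilon>" "y \<in> U" for \<epsilon> y
    using E.nrm_ge_0[of "y - x"] that UE x by (intro mult_nonneg_nonneg) auto
  then show ?thesis unfolding frechet_at_def by (auto intro: exI[of _ 1])
qed

lemma bounded_ops_zero_mem:
  assumes "complex_normed_space F" shows "0 \<in> bounded_ops E F"
proof -
  interpret F: complex_normed_space F by fact
  show ?thesis unfolding mem_bounded_ops_iff by (auto intro: exI[of _ 0])
qed

lemma Hinf_comp:
  assumes E: "complex_normed_space E" and F: "complex_normed_space F" and UE: "U \<subseteq> vecs E"
    and T: "T \<in> bounded_ops F G" and f: "f \<in> vecs (Hinf E U F)"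
  shows "T \<circ> f \<in> vecs (Hinf E U G)"
proof -
  have f': "holomorphic_map E U F f" "\<And>x. x \<notin> U \<Longrightarrow> f x = 0" using f mem_Hinf_iff by blast+
  obtain K where K: "0 < K" "\<And>y. y \<in> vecs F \<Longrightarrow> nrm G (T y) \<le> K * nrm F y" using bounded_ops_bound[OF F T] by metis
  have "nrm G ((T \<circ> f) x) \<le> K * nrm (Hinf E U F) f" if "x \<in> U" for x
  proof -
    have "f x \<in> vecs F" using f'(1) that by (simp add: holomorphic_map_def)
    then have "nrm G ((T \<circ> f) x) \<le> K * nrm F (f x)" using K(2) by simp
    also have "\<dots> \<le> K * nrm (Hinf E U F) f" using K(1) Hinf_le[OF f that] by simp
    finally show ?thesis .
  qed
  then have "\<exists>K. \<forall>x\<in>U. nrm G ((T \<circ> f) x) \<le> K" by blast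
  moreover have hol: "holomorphic_map E U G (T \<circ> f)"
    using f'(1) unfolding holomorphic_map_iff
    by (metis bounded_ops_closed(1)[OF T] bounded_ops_comp[OF E F _ T] frechet_at_comp[OF E F UE T] comp_apply)
  ultimately show ?thesis
    unfolding mem_Hinf_iff
    using hol f'(2) bounded_ops_zero[OF F T] by simp
qed

lemma Hinf_normed:
  assumes E: "complex_normed_space E" and F: "complex_normed_space F" and UE: "U \<subseteq> vecs E"
  shows "complex_normed_space (Hinf E U F)"
proof
  interpret F: complex_normed_space F by (rule F)
  have val: "f x \<in> vecs F" if "f \<in> vecs (Hinf E U F)" "x \<in> U" for f x
    using that by (simp add: mem_Hinf_iff holomorphic_map_def)
  have add: "f + g \<in> vecs (Hinf E U F)" "nrm (Hinf E U F) (f + g) \<le> nrm (Hinf E U F) f + nrm (Hinf E U F) g"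
    if f: "f \<in> vecs (Hinf E U F)" and g: "g \<in> vecs (Hinf E U F)" for f g
  proof -
    have le: "nrm F ((f + g) x) \<le> nrm (Hinf E U F) f + nrm (Hinf E U F) g" if x: "x \<in> U" for x
      using F.nrm_triangle[OF val[OF f x] val[OF g x]] Hinf_le[OF f x] Hinf_le[OF g x] by simp
    have "\<exists>C\<in>bounded_ops E F. frechet_at E U F (f + g) x C" if x: "x \<in> U" for x
    proof -
      obtain A B where A: "A \<in> bounded_ops E F" "frechet_at E U F f x A"
        and B: "B \<in> bounded_ops E F" "frechet_at E U F g x B"
        using f g x unfolding mem_Hinf_iff holomorphic_map_iff by meson
      have "frechet_at E U F (f + g) x (A + B)"
        by (rule frechet_at_add[OF E F UE _ _ x A B]) (use val f g in auto)
      then show ?thesis using bounded_ops_add[OF E F A(1) B(1)] by blast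
    qed
    then have "holomorphic_map E U F (f + g)"
      unfolding holomorphic_map_iff using val[OF f] val[OF g] by simp
    then show "f + g \<in> vecs (Hinf E U F)"
      using f g le unfolding mem_Hinf_iff by auto
    show "nrm (Hinf E U F) (f + g) \<le> nrm (Hinf E U F) f + nrm (Hinf E U F) g"
      using le Hinf_nrm_ge_0[OF f] Hinf_nrm_ge_0[OF g] by (intro Hinf_nrm_le) auto
  qed
  have scale: "a *\<^sub>C f \<in> vecs (Hinf E U F)" if f: "f \<in> vecs (Hinf E U F)" for a f
  proof -
    have "(\<lambda>y. if y \<in> vecs F then a *\<^sub>C y else 0) \<in> bounded_ops F F"
      unfolding mem_bounded_ops_iff
      by (auto simp: scaleC_add_right mult.commute F.nrm_scaleC intro: exI[of _ "cmod a"])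
    from Hinf_comp[OF E F UE this f]
    have "(\<lambda>y. if y \<in> vecs F then a *\<^sub>C y else 0) \<circ> f \<in> vecs (Hinf E U F)" .
    moreover have "(\<lambda>y. if y \<in> vecs F then a *\<^sub>C y else 0) \<circ> f = a *\<^sub>C f"
    proof
      fix x show "((\<lambda>y. if y \<in> vecs F then a *\<^sub>C y else 0) \<circ> f) x = (a *\<^sub>C f) x"
        using val[OF f, of x] f F.vzero by (cases "x \<in> U") (auto simp: scaleC_fun_def mem_Hinf_iff)
    qed
    ultimately show ?thesis by simp
  qed
  have "holomorphic_map E U F 0"
    unfolding holomorphic_map_iff using frechet_at_zero[OF E F UE] bounded_ops_zero_mem[OF F] by auto
  then have zero: "0 \<in> vecs (Hinf E U F)" by (auto simp: mem_Hinf_iff)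
  show "complex_subspace (vecs (Hinf E U F))"
    unfolding complex_vector.subspace_def
    using add(1) scale zero by blast
  fix f assume f: "f \<in> vecs (Hinf E U F)"
  show "0 \<le> nrm (Hinf E U F) f" using Hinf_nrm_ge_0[OF f] .
  show "nrm (Hinf E U F) f = 0 \<longleftrightarrow> f = 0"
  proof
    assume 0: "nrm (Hinf E U F) f = 0"
    show "f = 0"
    proof
      fix x show "f x = 0 x"
      proof (cases "x \<in> U")
        case True
        then have "nrm F (f x) = 0" using Hinf_le[OF f True] F.nrm_ge_0[OF val[OF f True]] 0 by simp
        then show ?thesis using F.nrm_eq_0_iff[OF val[OF f True]] by simp
      qed (use f in \<open>simp add: mem_Hinf_iff\<close>)
    qed
  next
    assume "f = 0"
    then have "nrm (Hinf E U F) f \<le> 0" by (intro Hinf_nrm_le) auto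
    then show "nrm (Hinf E U F) f = 0" using Hinf_nrm_ge_0[OF f] by simp
  qed
  show "nrm (Hinf E U F) (a *\<^sub>C f) = cmod a * nrm (Hinf E U F) f" for a
  proof (rule antisym)
    have "nrm F ((a *\<^sub>C f) x) = cmod a * nrm F (f x)" if "x \<in> U" for x
      using F.nrm_scaleC[OF val[OF f that]] by (simp add: scaleC_fun_def)
    note s = this
    show "nrm (Hinf E U F) (a *\<^sub>C f) \<le> cmod a * nrm (Hinf E U F) f"
      using s Hinf_le[OF f] Hinf_nrm_ge_0[OF f] by (intro Hinf_nrm_le) (auto intro: mult_left_mono)
    show "cmod a * nrm (Hinf E U F) f \<le> nrm (Hinf E U F) (a *\<^sub>C f)"
    proof (cases "a = 0")
      case True
      then show ?thesis using Hinf_nrm_ge_0[OF scale[OF f, of a]] by simp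
    next
      case False
      have "nrm (Hinf E U F) f \<le> nrm (Hinf E U F) (a *\<^sub>C f) / cmod a"
      proof (rule Hinf_nrm_le)
        show "0 \<le> nrm (Hinf E U F) (a *\<^sub>C f) / cmod a" using Hinf_nrm_ge_0[OF scale[OF f]] by simp
        show "nrm F (f x) \<le> nrm (Hinf E U F) (a *\<^sub>C f) / cmod a" if "x \<in> U" for x
          using s[OF that] Hinf_le[OF scale[OF f, of a] that] False by (simp add: pos_le_divide_eq mult.commute)
      qed
      then show ?thesis using False by (simp add: field_simps)
    qed
  qed
  show "nrm (Hinf E U F) (f + g) \<le> nrm (Hinf E U F) f + nrm (Hinf E U F) g" if "g \<in> vecs (Hinf E U F)" for g
    using add(2)[OF f that] .
qed

section \<open>The adjoint of the transpose\<close>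

locale bounded_holomorphic =
  E: complex_banach_space E + F: complex_banach_space F
  for E :: "'a::complex_vector cnspace" and F :: "'b::complex_vector cnspace" +
  fixes U :: "'a set" and f :: "'a \<Rightarrow> 'b"
  assumes U: "openin (norm_topology E) U" and f: "f \<in> vecs (Hinf E U F)"
begin

abbreviation "H \<equiv> Hinf_scalar E U"

lemma U_subset: "U \<subseteq> vecs E"
  using openin_subset[OF U] by (simp add: norm_topology_def)

sublocale H: complex_normed_space H
  by (rule Hinf_normed[OF E.complex_normed_space_axioms complex_field_normed U_subset])

sublocale FD: complex_normed_space "dual F" by (rule F.dual_normed)
sublocale HD: complex_normed_space "dual H" by (rule H.dual_normed)

lemma f_closed: "x \<in> U \<Longrightarrow> f x \<in> vecs F"
  using f by (simp add: mem_Hinf_iff holomorphic_map_def)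

lemma f_off: "x \<notin> U \<Longrightarrow> f x = 0"
  using f by (simp add: mem_Hinf_iff)

lemma comp_closed: "\<phi> \<in> vecs (dual F) \<Longrightarrow> \<phi> \<circ> f \<in> vecs H"
  unfolding vecs_dual
  by (rule Hinf_comp[OF E.complex_normed_space_axioms F.complex_normed_space_axioms U_subset _ f])

lemma comp_nrm_le_sup:
  assumes "0 \<le> b" "\<And>x. x \<in> U \<Longrightarrow> cmod (\<phi> (f x)) \<le> b"
  shows "nrm H (\<phi> \<circ> f) \<le> b"
  using assms by (intro Hinf_nrm_le) auto

lemma comp_nrm_le:
  assumes \<phi>: "\<phi> \<in> vecs (dual F)"
  shows "nrm H (\<phi> \<circ> f) \<le> nrm (Hinf E U F) f * nrm (dual F) \<phi>"
proof (rule comp_nrm_le_sup)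
  show "0 \<le> nrm (Hinf E U F) f * nrm (dual F) \<phi>"
    using Hinf_nrm_ge_0[OF f] FD.nrm_ge_0[OF \<phi>] by simp
  fix x assume x: "x \<in> U"
  have "cmod (\<phi> (f x)) \<le> nrm (dual F) \<phi> * nrm F (f x)" using F.dual_le[OF \<phi> f_closed[OF x]] .
  also have "\<dots> \<le> nrm (dual F) \<phi> * nrm (Hinf E U F) f"
    using Hinf_le[OF f x] FD.nrm_ge_0[OF \<phi>] by (rule mult_left_mono)
  finally show "cmod (\<phi> (f x)) \<le> nrm (Hinf E U F) f * nrm (dual F) \<phi>" by (simp add: mult.commute)
qed

lemma comp_add: "(\<phi> + \<psi>) \<circ> f = (\<phi> \<circ> f) + (\<psi> \<circ> f)" for \<phi> \<psi> :: "'b \<Rightarrow> complex"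
  by (simp add: fun_eq_iff)

lemma comp_scale: "(a *\<^sub>C \<phi>) \<circ> f = a *\<^sub>C (\<phi> \<circ> f)" for \<phi> :: "'b \<Rightarrow> complex"
  by (simp add: fun_eq_iff scaleC_functional)

text \<open>The adjoint of the transpose of \<open>f\<close>.  It maps the evaluation at \<open>x\<close> on \<open>H\<close> to the evaluation at
  \<open>f x\<close> on the dual of \<open>F\<close>.\<close>

definition adj :: "(('a \<Rightarrow> complex) \<Rightarrow> complex) \<Rightarrow> ('b \<Rightarrow> complex) \<Rightarrow> complex" where
  "adj \<gamma> = (\<lambda>\<phi>. if \<phi> \<in> vecs (dual F) then \<gamma> (\<phi> \<circ> f) else 0)"

lemma adj_bound:
  assumes "\<gamma> \<in> vecs (dual H)" "\<phi> \<in> vecs (dual F)"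
  shows "cmod (\<gamma> (\<phi> \<circ> f)) \<le> nrm (dual H) \<gamma> * nrm (Hinf E U F) f * nrm (dual F) \<phi>"
proof -
  have "cmod (\<gamma> (\<phi> \<circ> f)) \<le> nrm (dual H) \<gamma> * nrm H (\<phi> \<circ> f)"
    using H.dual_le[OF assms(1) comp_closed[OF assms(2)]] .
  also have "\<dots> \<le> nrm (dual H) \<gamma> * (nrm (Hinf E U F) f * nrm (dual F) \<phi>)"
    using comp_nrm_le[OF assms(2)] HD.nrm_ge_0[OF assms(1)] by (rule mult_left_mono)
  finally show ?thesis by (simp add: mult.assoc)
qed

lemma adj_closed:
  assumes "\<gamma> \<in> vecs (dual H)"
  shows "adj \<gamma> \<in> vecs (dual (dual F))"
  unfolding adj_def
  using assms adj_bound[OF assms] comp_closed H.dual_add[OF assms] H.dual_scale[OF assms]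
  by (intro FD.restrict_in_dual) (auto simp: comp_add comp_scale)

text \<open>The adjoint of the transpose takes its values in the copy of \<open>F\<close> in the bidual.  All conditions
  of the theorem are compared with this one.\<close>

definition representable :: bool where
  "representable \<longleftrightarrow> (\<forall>\<gamma>\<in>vecs (dual H). is_evaluation F (adj \<gamma>))"

text \<open>Krein's theorem applies because \<open>adj \<gamma> \<phi>\<close> is at most the norm of \<open>\<gamma>\<close> times the supremum of \<open>\<phi>\<close>
  over the range of \<open>f\<close>.\<close>

lemma representable_if_range_compact:
  assumes "relatively_weakly_compact F (f ` U)"
  shows representable
  unfolding representable_def
proof
  fix \<gamma> assume \<gamma>: "\<gamma> \<in> vecs (dual H)"
  show "is_evaluation F (adj \<gamma>)"
  proof (rule F.krein_evaluation[OF assms _ adj_closed[OF \<gamma>]])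
    show "nrm F y \<le> nrm (Hinf E U F) f" if "y \<in> f ` U" for y using Hinf_le[OF f] that by blast
    fix e :: real assume "0 < e"
    show "\<exists>C\<ge>0. \<forall>\<phi>\<in>vecs (dual F). \<forall>b\<ge>0. (\<forall>x\<in>f ` U. cmod (\<phi> x) \<le> b) \<longrightarrow>
        cmod (adj \<gamma> \<phi>) \<le> C * b + e * nrm (dual F) \<phi>"
    proof (intro exI[of _ "nrm (dual H) \<gamma>"] conjI ballI allI impI)
      show "0 \<le> nrm (dual H) \<gamma>" using HD.nrm_ge_0[OF \<gamma>] .
      fix \<phi> and b :: real assume \<phi>: "\<phi> \<in> vecs (dual F)" and b: "0 \<le> b" "\<forall>x\<in>f ` U. cmod (\<phi> x) \<le> b"
      have "cmod (adj \<gamma> \<phi>) \<le> nrm (dual H) \<gamma> * nrm H (\<phi> \<circ> f)"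
        using H.dual_le[OF \<gamma> comp_closed[OF \<phi>]] \<phi> by (simp add: adj_def)
      also have "\<dots> \<le> nrm (dual H) \<gamma> * b"
        using comp_nrm_le_sup[of b \<phi>] b HD.nrm_ge_0[OF \<gamma>] by (intro mult_left_mono) auto
      finally show "cmod (adj \<gamma> \<phi>) \<le> nrm (dual H) \<gamma> * b + e * nrm (dual F) \<phi>"
        using \<open>0 < e\<close> FD.nrm_ge_0[OF \<phi>] by (simp add: add_increasing2)
    qed
  qed
qed

lemma transpose_continuous_if_representable:
  assumes representable
  shows "continuous_map (weak_star_topology F) (weak_topology H) (transpose_map F f)"
proof (rule H.continuous_map_into_weak_topology)
  show "transpose_map F f \<phi> \<in> vecs H" if "\<phi> \<in> topspace (weak_star_topology F)" for \<phi>
    using that comp_closed by (simp add: transpose_map_def)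
  fix \<gamma> assume "\<gamma> \<in> vecs (dual H)"
  then obtain x where x: "x \<in> vecs F" "\<And>\<phi>. \<phi> \<in> vecs (dual F) \<Longrightarrow> adj \<gamma> \<phi> = \<phi> x"
    using assms unfolding representable_def is_evaluation_def by blast
  show "continuous_map (weak_star_topology F) euclidean (\<lambda>\<phi>. \<gamma> (transpose_map F f \<phi>))"
    by (rule continuous_map_eq[OF F.continuous_map_evaluation[OF x(1)]])
      (simp add: transpose_map_def adj_def flip: x(2))
qed

lemma transpose_bounded: "transpose_map F f \<in> bounded_ops (dual F) H"
  unfolding mem_bounded_ops_iff
proof (intro conjI ballI allI impI)
  show "\<exists>K. \<forall>\<phi>\<in>vecs (dual F). nrm H (transpose_map F f \<phi>) \<le> K * nrm (dual F) \<phi>"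
    using comp_nrm_le by (intro exI[of _ "nrm (Hinf E U F) f"]) (simp add: transpose_map_def)
qed (use comp_closed in \<open>auto simp: transpose_map_def comp_add comp_scale\<close>)

text \<open>The image of the dual unit ball is weakly compact by the Banach-Alaoglu theorem.\<close>

lemma transpose_weakly_compact_if_continuous:
  assumes "continuous_map (weak_star_topology F) (weak_topology H) (transpose_map F f)"
  shows "weakly_compact_op (dual F) H (transpose_map F f)"
  unfolding weakly_compact_op_def
  using transpose_bounded
    H.relatively_weakly_compact_if_subset_compact[OF image_compactin[OF F.banach_alaoglu assms] order_refl]
  by blast

lemma eq_zero_if_evaluations_vanish:
  assumes "h \<in> vecs H" "\<And>x. x \<in> U \<Longrightarrow> h x = 0"
  shows "h = 0"
proof
  fix x show "h x = 0 x" using assms by (cases "x \<in> U") (auto simp: mem_Hinf_iff)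
qed

lemma eval_at_in_dual:
  assumes "x \<in> U"
  shows "eval_at H x \<in> vecs (dual H)" "nrm (dual H) (eval_at H x) \<le> 1"
proof -
  have le: "cmod (g x) \<le> 1 * nrm H g" if "g \<in> vecs H" for g
    using Hinf_le[OF that assms] by simp
  show "eval_at H x \<in> vecs (dual H)"
    unfolding eval_at_def using le by (intro H.restrict_in_dual[where K = 1]) (auto simp: scaleC_functional)
  show "nrm (dual H) (eval_at H x) \<le> 1"
    using le by (intro H.dual_nrm_le) (auto simp: eval_at_def)
qed

text \<open>If a functional \<open>adj \<gamma>\<close> were not an evaluation, there would be functionals \<open>\<phi>\<close> in the
  dual ball that vanish at any given finite subset of the range of \<open>f\<close> while
  \<open>\<gamma> (\<phi> \<circ> f) = \<theta>\<close>.  A weak cluster point of such \<open>\<phi> \<circ> f\<close> vanishes on \<open>U\<close>, hence is zero.\<close>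

lemma representable_if_transpose_weakly_compact:
  assumes wc: "weakly_compact_op (dual F) H (transpose_map F f)"
  shows representable
  unfolding representable_def
proof (intro ballI, rule ccontr)
  fix \<gamma> assume \<gamma>: "\<gamma> \<in> vecs (dual H)" and "\<not> is_evaluation F (adj \<gamma>)"
  then obtain \<theta> :: real where \<theta>: "0 < \<theta>" and pickable: "\<forall>D. finite D \<longrightarrow> D \<subseteq> vecs F \<longrightarrow>
      (\<exists>\<phi>\<in>unit_ball (dual F). (\<forall>d\<in>D. \<phi> d = 0) \<and> adj \<gamma> \<phi> = of_real \<theta>)"
    using F.not_evaluation_functionals[OF adj_closed[OF \<gamma>]] by blast
  define S where "S = transpose_map F f ` unit_ball (dual F)"
  define K where "K = weak_topology H closure_of S"
  have K: "compactin (weak_topology H) K" and SH: "S \<subseteq> vecs H"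
    using wc by (simp_all add: weakly_compact_op_def relatively_weakly_compact_def K_def S_def)
  have SK: "S \<subseteq> K" unfolding K_def using closure_of_subset[of S "weak_topology H"] SH by simp
  define C where "C x = {h \<in> vecs H. eval_at H x h \<in> {0}}" for x
  define C\<^sub>\<theta> where "C\<^sub>\<theta> = {h \<in> vecs H. \<gamma> h \<in> {of_real \<theta>}}"
  have clo: "closedin (weak_topology H) {h \<in> vecs H. \<eta> h \<in> {c}}" if "\<eta> \<in> vecs (dual H)" for \<eta> c
    using closedin_continuous_map_preimage[OF H.continuous_map_functional[OF that], of "{c}"] by simp
  have "K \<inter> \<Inter> (insert C\<^sub>\<theta> (C ` U)) \<noteq> {}"
  proof (rule conjunct2[OF K[unfolded compactin_fip], rule_format])
    show "(\<forall>B\<in>insert C\<^sub>\<theta> (C ` U). closedin (weak_topology H) B) \<and>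
      (\<forall>\<F>. finite \<F> \<and> \<F> \<subseteq> insert C\<^sub>\<theta> (C ` U) \<longrightarrow> K \<inter> \<Inter> \<F> \<noteq> {})"
    proof (intro conjI ballI allI impI)
      show "closedin (weak_topology H) B" if "B \<in> insert C\<^sub>\<theta> (C ` U)" for B
        using that clo[OF \<gamma>] clo[OF eval_at_in_dual(1)] by (auto simp only: C_def C\<^sub>\<theta>_def insert_iff image_iff)
      fix \<F> assume \<F>: "finite \<F> \<and> \<F> \<subseteq> insert C\<^sub>\<theta> (C ` U)"
      then have "finite (\<F> - {C\<^sub>\<theta>})" "\<F> - {C\<^sub>\<theta>} \<subseteq> C ` U" by auto
      then obtain D where D: "D \<subseteq> U" "finite D" "\<F> - {C\<^sub>\<theta>} = C ` D" by (metis finite_subset_image)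
      have "finite (f ` D)" "f ` D \<subseteq> vecs F" using D f_closed by auto
      then obtain \<phi> where \<phi>: "\<phi> \<in> unit_ball (dual F)" "\<forall>d\<in>f ` D. \<phi> d = 0" "adj \<gamma> \<phi> = of_real \<theta>"
        using pickable by meson
      define h where "h = transpose_map F f \<phi>"
      have \<phi>D: "\<phi> \<in> vecs (dual F)" using \<phi>(1) by (simp add: unit_ball_def)
      have "h \<in> K" using SK \<phi>(1) by (auto simp: S_def h_def)
      moreover have hH: "h \<in> vecs H" using comp_closed[OF \<phi>D] \<phi>D by (simp add: h_def transpose_map_def)
      moreover have "h \<in> C\<^sub>\<theta>" using hH \<phi>(3) \<phi>D by (simp add: C\<^sub>\<theta>_def h_def transpose_map_def adj_def)
      moreover have "h \<in> C x" if "x \<in> D" for x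
        using hH \<phi>(2) that \<phi>D by (simp add: C_def eval_at_def h_def transpose_map_def)
      moreover have "\<F> \<subseteq> insert C\<^sub>\<theta> (C ` D)" using D(3) by blast
      ultimately show "K \<inter> \<Inter> \<F> \<noteq> {}" by blast
    qed
  qed
  then obtain h where "h \<in> C\<^sub>\<theta>" and hC: "\<And>x. x \<in> U \<Longrightarrow> h \<in> C x" by auto
  then have h: "h \<in> vecs H" "\<gamma> h = of_real \<theta>" by (simp_all add: C\<^sub>\<theta>_def)
  have "h = 0" using hC h(1) by (intro eq_zero_if_evaluations_vanish) (auto simp: C_def eval_at_def)
  then show False using h(2) H.dual_zero[OF \<gamma>] \<theta> by simp
qed


section \<open>The linearization\<close>

lemma mem_Ginf_iff:
  "\<gamma> \<in> vecs (Ginf E U) \<longleftrightarrow> \<gamma> \<in> vecs (dual H) \<and>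
     (\<forall>e>0. \<exists>\<sigma>\<in>complex_span (delta E U ` U). nrm (dual H) (\<gamma> - \<sigma>) < e)"
proof -
  have sub: "complex_span (delta E U ` U) \<subseteq> vecs (dual H)"
    using eval_at_in_dual(1) by (intro complex_vector.span_minimal HD.subspace) (auto simp: delta_def)
  have "\<gamma> \<in> vecs (Ginf E U) \<longleftrightarrow> \<gamma> \<in> vecs (dual H) \<and>
      (\<forall>r>0. \<exists>\<sigma>\<in>complex_span (delta E U ` U). \<sigma> \<in> HD.mball \<gamma> r)"
    by (simp add: Ginf_def norm_topology_def HD.metric_closure_of)
  also have "\<dots> \<longleftrightarrow> \<gamma> \<in> vecs (dual H) \<and>
     (\<forall>e>0. \<exists>\<sigma>\<in>complex_span (delta E U ` U). nrm (dual H) (\<gamma> - \<sigma>) < e)"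
    using sub by (auto simp: HD.mball_def ndist_def subset_iff)
  finally show ?thesis .
qed

lemma Ginf_nrm: "nrm (Ginf E U) = nrm (dual H)"
  by (simp add: Ginf_def)

lemma span_subset_dual: "complex_span (delta E U ` U) \<subseteq> vecs (dual H)"
  using eval_at_in_dual(1) by (intro complex_vector.span_minimal HD.subspace) (auto simp: delta_def)

lemma span_subset_Ginf: "complex_span (delta E U ` U) \<subseteq> vecs (Ginf E U)"
proof
  fix \<sigma> assume \<sigma>: "\<sigma> \<in> complex_span (delta E U ` U)"
  have "\<exists>\<sigma>'\<in>complex_span (delta E U ` U). nrm (dual H) (\<sigma> - \<sigma>') < e" if "0 < e" for e
    using \<sigma> that by (intro bexI[of _ \<sigma>]) auto
  then show "\<sigma> \<in> vecs (Ginf E U)" using \<sigma> span_subset_dual unfolding mem_Ginf_iff by blast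
qed

lemma delta_in_Ginf: "x \<in> U \<Longrightarrow> delta E U x \<in> vecs (Ginf E U)"
  using span_subset_Ginf complex_vector.span_base by blast

lemma Ginf_subspace: "complex_subspace (vecs (Ginf E U))"
  unfolding complex_vector.subspace_def
proof (intro conjI ballI allI)
  show "0 \<in> vecs (Ginf E U)" using span_subset_Ginf complex_vector.span_zero by blast
next
  fix \<gamma> \<gamma>' assume g: "\<gamma> \<in> vecs (Ginf E U)" "\<gamma>' \<in> vecs (Ginf E U)"
  show "\<gamma> + \<gamma>' \<in> vecs (Ginf E U)"
    unfolding mem_Ginf_iff
  proof (intro conjI allI impI)
    show "\<gamma> + \<gamma>' \<in> vecs (dual H)" using g by (simp add: mem_Ginf_iff)
    fix e :: real assume "0 < e"
    then obtain \<sigma> \<sigma>' where s: "\<sigma> \<in> complex_span (delta E U ` U)" "\<sigma>' \<in> complex_span (delta E U ` U)"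
      and n: "nrm (dual H) (\<gamma> - \<sigma>) < e / 2" "nrm (dual H) (\<gamma>' - \<sigma>') < e / 2"
      using g unfolding mem_Ginf_iff by (meson half_gt_zero)
    have "\<gamma> - \<sigma> \<in> vecs (dual H)" "\<gamma>' - \<sigma>' \<in> vecs (dual H)"
      using g s span_subset_dual by (auto simp: mem_Ginf_iff)
    from HD.nrm_triangle[OF this]
    have "nrm (dual H) ((\<gamma> + \<gamma>') - (\<sigma> + \<sigma>')) < e" using n by (simp add: algebra_simps)
    then show "\<exists>\<sigma>\<in>complex_span (delta E U ` U). nrm (dual H) (\<gamma> + \<gamma>' - \<sigma>) < e"
      using complex_vector.span_add[OF s] by blast
  qed
next
  fix a \<gamma> assume g: "\<gamma> \<in> vecs (Ginf E U)"
  show "a *\<^sub>C \<gamma> \<in> vecs (Ginf E U)"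
    unfolding mem_Ginf_iff
  proof (intro conjI allI impI)
    show "a *\<^sub>C \<gamma> \<in> vecs (dual H)" using g by (intro HD.vscale) (simp add: mem_Ginf_iff)
    fix e :: real assume "0 < e"
    then have "0 < e / (cmod a + 1)" by (simp add: add_nonneg_pos)
    then obtain \<sigma> where s: "\<sigma> \<in> complex_span (delta E U ` U)" "nrm (dual H) (\<gamma> - \<sigma>) < e / (cmod a + 1)"
      using g unfolding mem_Ginf_iff by blast
    have d: "\<gamma> - \<sigma> \<in> vecs (dual H)" using g s span_subset_dual by (auto simp: mem_Ginf_iff)
    have "cmod a * nrm (dual H) (\<gamma> - \<sigma>) \<le> (cmod a + 1) * nrm (dual H) (\<gamma> - \<sigma>)"
      using HD.nrm_ge_0[OF d] by (intro mult_right_mono) auto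
    also have "\<dots> < e"
      using s(2) pos_less_divide_eq[of "cmod a + 1" _ e] by (simp add: add_nonneg_pos mult.commute)
    finally have "nrm (dual H) (a *\<^sub>C \<gamma> - a *\<^sub>C \<sigma>) < e"
      using HD.nrm_scaleC[OF d, of a] by (simp add: complex_vector.scale_right_diff_distrib)
    then show "\<exists>\<sigma>\<in>complex_span (delta E U ` U). nrm (dual H) (a *\<^sub>C \<gamma> - \<sigma>) < e"
      using complex_vector.span_scale[OF s(1)] by blast
  qed
qed

text \<open>The functionals \<open>\<gamma>\<close> for which \<open>adj \<gamma>\<close> is an evaluation form a norm-closed subspace, which
  contains the point evaluations.\<close>

lemma Ginf_representable:
  assumes \<gamma>: "\<gamma> \<in> vecs (Ginf E U)"
  shows "is_evaluation F (adj \<gamma>)"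
proof (rule F.evaluation_if_approximable)
  have \<gamma>D: "\<gamma> \<in> vecs (dual H)" using \<gamma> by (simp add: mem_Ginf_iff)
  then show "adj \<gamma> \<in> vecs (dual (dual F))" by (rule adj_closed)
  fix e :: real assume "0 < e"
  define M where "M = nrm (Hinf E U F) f + 1"
  have M: "0 < M" using Hinf_nrm_ge_0[OF f] by (simp add: M_def)
  then obtain \<sigma> where \<sigma>: "\<sigma> \<in> complex_span (delta E U ` U)" and n: "nrm (dual H) (\<gamma> - \<sigma>) < e / M"
    using \<gamma> \<open>0 < e\<close> unfolding mem_Ginf_iff by (meson divide_pos_pos)
  have \<sigma>D: "\<sigma> \<in> vecs (dual H)" using \<sigma> span_subset_dual by blast
  have "\<exists>y\<in>vecs F. \<forall>\<phi>\<in>vecs (dual F). \<sigma> (\<phi> \<circ> f) = \<phi> y"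
    using \<sigma>
  proof (rule complex_vector.span_induct)
    show "\<exists>y\<in>vecs F. \<forall>\<phi>\<in>vecs (dual F). \<gamma> (\<phi> \<circ> f) = \<phi> y" if "\<gamma> \<in> delta E U ` U" for \<gamma>
      using that comp_closed f_closed by (auto simp: delta_def eval_at_def)
    show "complex_subspace {\<sigma>. \<exists>y\<in>vecs F. \<forall>\<phi>\<in>vecs (dual F). \<sigma> (\<phi> \<circ> f) = \<phi> y}"
      unfolding complex_vector.subspace_def
    proof (intro conjI ballI allI)
      show "0 \<in> {\<sigma>. \<exists>y\<in>vecs F. \<forall>\<phi>\<in>vecs (dual F). \<sigma> (\<phi> \<circ> f) = \<phi> y}"
        using F.dual_zero by (auto intro!: bexI[of _ 0])
    next
      fix \<sigma> \<tau> assume "\<sigma> \<in> {\<sigma>. \<exists>y\<in>vecs F. \<forall>\<phi>\<in>vecs (dual F). \<sigma> (\<phi> \<circ> f) = \<phi> y}"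
        "\<tau> \<in> {\<sigma>. \<exists>y\<in>vecs F. \<forall>\<phi>\<in>vecs (dual F). \<sigma> (\<phi> \<circ> f) = \<phi> y}"
      then obtain y z where "y \<in> vecs F" "\<forall>\<phi>\<in>vecs (dual F). \<sigma> (\<phi> \<circ> f) = \<phi> y"
        "z \<in> vecs F" "\<forall>\<phi>\<in>vecs (dual F). \<tau> (\<phi> \<circ> f) = \<phi> z" by blast
      then show "\<sigma> + \<tau> \<in> {\<sigma>. \<exists>y\<in>vecs F. \<forall>\<phi>\<in>vecs (dual F). \<sigma> (\<phi> \<circ> f) = \<phi> y}"
        using F.dual_add by (auto intro!: bexI[of _ "y + z"])
    next
      fix a \<sigma> assume "\<sigma> \<in> {\<sigma>. \<exists>y\<in>vecs F. \<forall>\<phi>\<in>vecs (dual F). \<sigma> (\<phi> \<circ> f) = \<phi> y}"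
      then obtain y where "y \<in> vecs F" "\<forall>\<phi>\<in>vecs (dual F). \<sigma> (\<phi> \<circ> f) = \<phi> y" by blast
      then show "a *\<^sub>C \<sigma> \<in> {\<sigma>. \<exists>y\<in>vecs F. \<forall>\<phi>\<in>vecs (dual F). \<sigma> (\<phi> \<circ> f) = \<phi> y}"
        using F.dual_scale by (auto simp: scaleC_functional intro!: bexI[of _ "a *\<^sub>C y"])
    qed
  qed
  then obtain y where y: "y \<in> vecs F" "\<And>\<phi>. \<phi> \<in> vecs (dual F) \<Longrightarrow> \<sigma> (\<phi> \<circ> f) = \<phi> y" by blast
  have "cmod (adj \<gamma> \<phi> - \<phi> y) \<le> e * nrm (dual F) \<phi>" if \<phi>: "\<phi> \<in> vecs (dual F)" for \<phi>
  proof -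
    have p: "0 \<le> nrm (dual F) \<phi>" using FD.nrm_ge_0[OF \<phi>] .
    have d: "\<gamma> - \<sigma> \<in> vecs (dual H)" using \<gamma>D \<sigma>D by blast
    have "cmod (adj \<gamma> \<phi> - \<phi> y) = cmod ((\<gamma> - \<sigma>) (\<phi> \<circ> f))" using \<phi> y(2)[OF \<phi>] by (simp add: adj_def)
    also have "\<dots> \<le> nrm (dual H) (\<gamma> - \<sigma>) * nrm (Hinf E U F) f * nrm (dual F) \<phi>" using adj_bound[OF d \<phi>] .
    also have "\<dots> \<le> (e / M * M) * nrm (dual F) \<phi>"
      using n HD.nrm_ge_0[OF d] Hinf_nrm_ge_0[OF f] p
      by (intro mult_right_mono mult_mono) (auto simp: M_def)
    finally show ?thesis using M by simp
  qed
  then show "\<exists>x\<in>vecs F. \<forall>\<phi>\<in>vecs (dual F). cmod (adj \<gamma> \<phi> - \<phi> x) \<le> e * nrm (dual F) \<phi>"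
    using y(1) by blast
qed

lemma linearization_exists:
  "\<exists>T\<in>bounded_ops (Ginf E U) F. \<forall>\<gamma>\<in>vecs (Ginf E U). \<forall>\<phi>\<in>vecs (dual F). \<phi> (T \<gamma>) = \<gamma> (\<phi> \<circ> f)"
proof -
  have "\<exists>y. y \<in> vecs F \<and> (\<forall>\<phi>\<in>vecs (dual F). \<phi> y = \<gamma> (\<phi> \<circ> f))" if "\<gamma> \<in> vecs (Ginf E U)" for \<gamma>
    using Ginf_representable[OF that] by (auto simp: is_evaluation_def adj_def)
  then obtain S where S: "\<And>\<gamma>. \<gamma> \<in> vecs (Ginf E U) \<Longrightarrow> S \<gamma> \<in> vecs F"
    "\<And>\<gamma> \<phi>. \<gamma> \<in> vecs (Ginf E U) \<Longrightarrow> \<phi> \<in> vecs (dual F) \<Longrightarrow> \<phi> (S \<gamma>) = \<gamma> (\<phi> \<circ> f)"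
    by metis
  define T where "T \<gamma> = (if \<gamma> \<in> vecs (Ginf E U) then S \<gamma> else 0)" for \<gamma>
  have T: "T \<gamma> \<in> vecs F" "\<phi> (T \<gamma>) = \<gamma> (\<phi> \<circ> f)" if "\<gamma> \<in> vecs (Ginf E U)" "\<phi> \<in> vecs (dual F)" for \<gamma> \<phi>
    using S that by (simp_all add: T_def)
  have add: "\<gamma> + \<gamma>' \<in> vecs (Ginf E U)" if "\<gamma> \<in> vecs (Ginf E U)" "\<gamma>' \<in> vecs (Ginf E U)" for \<gamma> \<gamma>'
    using complex_vector.subspace_add[OF Ginf_subspace that] .
  have scale: "a *\<^sub>C \<gamma> \<in> vecs (Ginf E U)" if "\<gamma> \<in> vecs (Ginf E U)" for a \<gamma>
    using complex_vector.subspace_scale[OF Ginf_subspace that] .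
  have TF: "T \<gamma> \<in> vecs F" if "\<gamma> \<in> vecs (Ginf E U)" for \<gamma> using S(1)[OF that] that by (simp add: T_def)
  have "T \<in> bounded_ops (Ginf E U) F"
    unfolding mem_bounded_ops_iff
  proof (intro conjI ballI allI impI)
    fix \<gamma> assume \<gamma>: "\<gamma> \<in> vecs (Ginf E U)"
    show "T \<gamma> \<in> vecs F" using TF[OF \<gamma>] .
    show "T (\<gamma> + \<gamma>') = T \<gamma> + T \<gamma>'" if "\<gamma>' \<in> vecs (Ginf E U)" for \<gamma>'
    proof (rule F.eq_if_functionals_agree)
      fix \<phi> assume \<phi>: "\<phi> \<in> vecs (dual F)"
      show "\<phi> (T (\<gamma> + \<gamma>')) = \<phi> (T \<gamma> + T \<gamma>')"
        using T(2)[OF add[OF \<gamma> that] \<phi>] T(2)[OF \<gamma> \<phi>] T(2)[OF that \<phi>] F.dual_add[OF \<phi> TF[OF \<gamma>] TF[OF that]] by simp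
    qed (use TF add \<gamma> that in auto)
    show "T (a *\<^sub>C \<gamma>) = a *\<^sub>C T \<gamma>" for a
    proof (rule F.eq_if_functionals_agree)
      fix \<phi> assume \<phi>: "\<phi> \<in> vecs (dual F)"
      show "\<phi> (T (a *\<^sub>C \<gamma>)) = \<phi> (a *\<^sub>C T \<gamma>)"
        using T(2)[OF scale[OF \<gamma>] \<phi>] T(2)[OF \<gamma> \<phi>] F.dual_scale[OF \<phi> TF[OF \<gamma>]] by (simp add: scaleC_functional)
    qed (use TF scale \<gamma> in auto)
  next
    show "\<exists>K. \<forall>\<gamma>\<in>vecs (Ginf E U). nrm F (T \<gamma>) \<le> K * nrm (Ginf E U) \<gamma>"
    proof (intro exI ballI)
      fix \<gamma> assume \<gamma>: "\<gamma> \<in> vecs (Ginf E U)"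
      then have \<gamma>D: "\<gamma> \<in> vecs (dual H)" by (simp add: mem_Ginf_iff)
      have "nrm F (T \<gamma>) \<le> nrm (dual H) \<gamma> * nrm (Hinf E U F) f"
        using adj_bound[OF \<gamma>D] T[OF \<gamma>] TF[OF \<gamma>] HD.nrm_ge_0[OF \<gamma>D] Hinf_nrm_ge_0[OF f]
        by (intro F.nrm_le_if_functionals_le) auto
      then show "nrm F (T \<gamma>) \<le> nrm (Hinf E U F) f * nrm (Ginf E U) \<gamma>"
        by (simp add: Ginf_nrm mult.commute)
    qed
  qed (simp add: T_def)
  then show ?thesis using T(2) by blast
qed

text \<open>Both sides are linear and norm-continuous in \<open>\<gamma>\<close> and agree at the point evaluations.\<close>

lemma linearization_functional:
  assumes T: "T \<in> bounded_ops (Ginf E U) F" and T\<delta>: "\<And>x. x \<in> U \<Longrightarrow> T (delta E U x) = f x"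
    and \<gamma>: "\<gamma> \<in> vecs (Ginf E U)" and \<phi>: "\<phi> \<in> vecs (dual F)"
  shows "\<phi> (T \<gamma>) = \<gamma> (\<phi> \<circ> f)"
proof -
  note T' = bounded_ops_closed[OF T]
  obtain K where K: "\<And>\<gamma>. \<gamma> \<in> vecs (Ginf E U) \<Longrightarrow> nrm F (T \<gamma>) \<le> K * nrm (dual H) \<gamma>"
    using T unfolding mem_bounded_ops_iff Ginf_nrm by blast
  have span: "\<sigma> \<in> vecs (Ginf E U) \<and> \<phi> (T \<sigma>) = \<sigma> (\<phi> \<circ> f)" if "\<sigma> \<in> complex_span (delta E U ` U)" for \<sigma>
    using that
  proof (rule complex_vector.span_induct)
    show "\<gamma> \<in> vecs (Ginf E U) \<and> \<phi> (T \<gamma>) = \<gamma> (\<phi> \<circ> f)" if "\<gamma> \<in> delta E U ` U" for \<gamma>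
      using that delta_in_Ginf T\<delta> comp_closed[OF \<phi>] by (auto simp: delta_def eval_at_def)
    show "complex_subspace {\<gamma>. \<gamma> \<in> vecs (Ginf E U) \<and> \<phi> (T \<gamma>) = \<gamma> (\<phi> \<circ> f)}"
      unfolding complex_vector.subspace_def
    proof (intro conjI ballI allI)
      have "0 \<in> vecs (Ginf E U)" using complex_vector.subspace_0[OF Ginf_subspace] .
      moreover from this have "T 0 = 0" using T'(3)[of 0 0] by simp
      ultimately show "0 \<in> {\<gamma>. \<gamma> \<in> vecs (Ginf E U) \<and> \<phi> (T \<gamma>) = \<gamma> (\<phi> \<circ> f)}"
        using F.dual_zero[OF \<phi>] by simp
    qed (use complex_vector.subspace_add[OF Ginf_subspace] complex_vector.subspace_scale[OF Ginf_subspace]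
        T' F.dual_add[OF \<phi>] F.dual_scale[OF \<phi>] in \<open>auto simp: scaleC_functional\<close>)
  qed
  have \<gamma>D: "\<gamma> \<in> vecs (dual H)" using \<gamma> by (simp add: mem_Ginf_iff)
  define L where "L = nrm (dual F) \<phi> * \<bar>K\<bar> + nrm H (\<phi> \<circ> f) + 1"
  have p: "0 \<le> nrm (dual F) \<phi>" "0 \<le> nrm H (\<phi> \<circ> f)"
    using FD.nrm_ge_0[OF \<phi>] H.nrm_ge_0[OF comp_closed[OF \<phi>]] .
  then have L: "0 < L" by (simp add: L_def add_nonneg_pos)
  have "cmod (\<phi> (T \<gamma>) - \<gamma> (\<phi> \<circ> f)) \<le> 0 + e" if "0 < e" for e
  proof -
    obtain \<sigma> where \<sigma>: "\<sigma> \<in> complex_span (delta E U ` U)" and n: "nrm (dual H) (\<gamma> - \<sigma>) < e / L"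
      using \<gamma> \<open>0 < e\<close> L unfolding mem_Ginf_iff by (meson divide_pos_pos)
    have \<sigma>': "\<sigma> \<in> vecs (Ginf E U)" "\<phi> (T \<sigma>) = \<sigma> (\<phi> \<circ> f)" using span[OF \<sigma>] by auto
    have d: "\<gamma> - \<sigma> \<in> vecs (Ginf E U)" using complex_vector.subspace_diff[OF Ginf_subspace \<gamma> \<sigma>'(1)] .
    then have dD: "\<gamma> - \<sigma> \<in> vecs (dual H)" by (simp add: mem_Ginf_iff)
    have nd: "0 \<le> nrm (dual H) (\<gamma> - \<sigma>)" using HD.nrm_ge_0[OF dD] .
    have "\<phi> (T \<gamma>) = \<phi> (T (\<gamma> - \<sigma>)) + \<phi> (T \<sigma>)"
      using F.dual_add[OF \<phi> T'(1)[OF d] T'(1)[OF \<sigma>'(1)]] T'(2)[OF d \<sigma>'(1)] by simp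
    then have "\<phi> (T \<gamma>) - \<gamma> (\<phi> \<circ> f) = \<phi> (T (\<gamma> - \<sigma>)) - (\<gamma> - \<sigma>) (\<phi> \<circ> f)" using \<sigma>'(2) by simp
    then have "cmod (\<phi> (T \<gamma>) - \<gamma> (\<phi> \<circ> f)) \<le> cmod (\<phi> (T (\<gamma> - \<sigma>))) + cmod ((\<gamma> - \<sigma>) (\<phi> \<circ> f))"
      using norm_triangle_ineq4 by metis
    also have "\<dots> \<le> nrm (dual F) \<phi> * (\<bar>K\<bar> * nrm (dual H) (\<gamma> - \<sigma>)) + nrm (dual H) (\<gamma> - \<sigma>) * nrm H (\<phi> \<circ> f)"
    proof (rule add_mono)
      have "nrm F (T (\<gamma> - \<sigma>)) \<le> \<bar>K\<bar> * nrm (dual H) (\<gamma> - \<sigma>)"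
        using K[OF d] mult_right_mono[OF abs_ge_self nd, of K] by linarith
      then show "cmod (\<phi> (T (\<gamma> - \<sigma>))) \<le> nrm (dual F) \<phi> * (\<bar>K\<bar> * nrm (dual H) (\<gamma> - \<sigma>))"
        using F.dual_le[OF \<phi> T'(1)[OF d]] p(1) by (meson mult_left_mono order_trans)
      show "cmod ((\<gamma> - \<sigma>) (\<phi> \<circ> f)) \<le> nrm (dual H) (\<gamma> - \<sigma>) * nrm H (\<phi> \<circ> f)"
        using H.dual_le[OF dD comp_closed[OF \<phi>]] .
    qed
    also have "\<dots> \<le> L * nrm (dual H) (\<gamma> - \<sigma>)" using nd by (simp add: L_def algebra_simps)
    also have "\<dots> \<le> e" using n L by (simp add: field_simps)
    finally show ?thesis by simp
  qed
  then have "cmod (\<phi> (T \<gamma>) - \<gamma> (\<phi> \<circ> f)) \<le> 0" by (rule field_le_epsilon)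
  then show ?thesis by simp
qed

lemma linearization_spec:
  "linearization E U F f \<in> bounded_ops (Ginf E U) F \<and> (\<forall>x\<in>U. linearization E U F f (delta E U x) = f x)"
proof -
  obtain T where T: "T \<in> bounded_ops (Ginf E U) F"
    and T\<phi>: "\<forall>\<gamma>\<in>vecs (Ginf E U). \<forall>\<phi>\<in>vecs (dual F). \<phi> (T \<gamma>) = \<gamma> (\<phi> \<circ> f)"
    using linearization_exists by blast
  have "T (delta E U x) = f x" if x: "x \<in> U" for x
  proof (rule F.eq_if_functionals_agree)
    show "T (delta E U x) \<in> vecs F" using bounded_ops_closed(1)[OF T delta_in_Ginf[OF x]] .
    show "\<phi> (T (delta E U x)) = \<phi> (f x)" if "\<phi> \<in> vecs (dual F)" for \<phi>
    proof -
      have "\<phi> (T (delta E U x)) = delta E U x (\<phi> \<circ> f)" using T\<phi> delta_in_Ginf[OF x] that by blast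
      also have "\<dots> = \<phi> (f x)" using comp_closed[OF that] by (simp add: delta_def eval_at_def)
      finally show ?thesis .
    qed
  qed (rule f_closed[OF x])
  moreover have "S = T" if S: "S \<in> bounded_ops (Ginf E U) F" "\<forall>x\<in>U. S (delta E U x) = f x" for S
  proof
    fix \<gamma> show "S \<gamma> = T \<gamma>"
    proof (cases "\<gamma> \<in> vecs (Ginf E U)")
      case True
      show ?thesis
      proof (rule F.eq_if_functionals_agree)
        fix \<phi> assume \<phi>: "\<phi> \<in> vecs (dual F)"
        have "\<phi> (S \<gamma>) = \<gamma> (\<phi> \<circ> f)" using linearization_functional[OF S(1) _ True \<phi>] S(2) by blast
        also have "\<dots> = \<phi> (T \<gamma>)" using T\<phi> True \<phi> by metis
        finally show "\<phi> (S \<gamma>) = \<phi> (T \<gamma>)" .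
      qed (use bounded_ops_closed(1)[OF S(1) True] bounded_ops_closed(1)[OF T True] in auto)
    next
      case False
      then show ?thesis using bounded_ops_closed(4)[OF S(1)] bounded_ops_closed(4)[OF T] by simp
    qed
  qed
  ultimately have "\<exists>!T. T \<in> bounded_ops (Ginf E U) F \<and> (\<forall>x\<in>U. T (delta E U x) = f x)"
    using T by blast
  from theI'[OF this] show ?thesis unfolding linearization_def .
qed

lemma range_compact_if_linearization_weakly_compact:
  assumes "weakly_compact_op (Ginf E U) F (linearization E U F f)"
  shows "relatively_weakly_compact F (f ` U)"
proof (rule F.relatively_weakly_compact_subset)
  show "relatively_weakly_compact F (linearization E U F f ` unit_ball (Ginf E U))"
    using assms by (simp add: weakly_compact_op_def)
  show "f ` U \<subseteq> linearization E U F f ` unit_ball (Ginf E U)"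
  proof
    fix y assume "y \<in> f ` U"
    then obtain x where x: "x \<in> U" "y = f x" by blast
    have "delta E U x \<in> unit_ball (Ginf E U)"
      using delta_in_Ginf[OF x(1)] eval_at_in_dual(2)[OF x(1)] by (simp add: unit_ball_def Ginf_nrm delta_def)
    moreover have "y = linearization E U F f (delta E U x)" using linearization_spec x by simp
    ultimately show "y \<in> linearization E U F f ` unit_ball (Ginf E U)" by blast
  qed
qed

text \<open>The linearization extends to the whole dual of \<open>H\<close>, and the extension \<open>R\<close> is continuous from the
  weak* to the weak topology; so it maps the compact dual ball to a weakly compact set.\<close>

lemma linearization_weakly_compact_if_representable:
  assumes representable
  shows "weakly_compact_op (Ginf E U) F (linearization E U F f)"
proof -
  note lin = linearization_spec
  have "\<exists>y. y \<in> vecs F \<and> (\<forall>\<phi>\<in>vecs (dual F). \<phi> y = \<gamma> (\<phi> \<circ> f))" if "\<gamma> \<in> vecs (dual H)" for \<gamma>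
    using assms that unfolding representable_def is_evaluation_def adj_def by fastforce
  then obtain R where R: "\<And>\<gamma>. \<gamma> \<in> vecs (dual H) \<Longrightarrow> R \<gamma> \<in> vecs F"
    "\<And>\<gamma> \<phi>. \<gamma> \<in> vecs (dual H) \<Longrightarrow> \<phi> \<in> vecs (dual F) \<Longrightarrow> \<phi> (R \<gamma>) = \<gamma> (\<phi> \<circ> f)"
    by metis
  have cont: "continuous_map (weak_star_topology H) (weak_topology F) R"
  proof (rule F.continuous_map_into_weak_topology)
    fix \<phi> assume \<phi>: "\<phi> \<in> vecs (dual F)"
    show "continuous_map (weak_star_topology H) euclidean (\<lambda>\<gamma>. \<phi> (R \<gamma>))"
      by (rule continuous_map_eq[OF H.continuous_map_evaluation[OF comp_closed[OF \<phi>]]])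
        (simp add: R(2)[OF _ \<phi>])
  qed (use R(1) in simp)
  have "linearization E U F f ` unit_ball (Ginf E U) \<subseteq> R ` unit_ball (dual H)"
  proof
    fix y assume "y \<in> linearization E U F f ` unit_ball (Ginf E U)"
    then obtain \<gamma> where \<gamma>: "\<gamma> \<in> vecs (Ginf E U)" "nrm (dual H) \<gamma> \<le> 1" and y: "y = linearization E U F f \<gamma>"
      by (auto simp: unit_ball_def Ginf_nrm)
    have \<gamma>D: "\<gamma> \<in> vecs (dual H)" using \<gamma>(1) by (simp add: mem_Ginf_iff)
    have "y = R \<gamma>"
      unfolding y
    proof (rule F.eq_if_functionals_agree)
      show "linearization E U F f \<gamma> \<in> vecs F" using bounded_ops_closed(1) lin \<gamma>(1) by blast
      show "\<phi> (linearization E U F f \<gamma>) = \<phi> (R \<gamma>)" if "\<phi> \<in> vecs (dual F)" for \<phi>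
        using linearization_functional[OF conjunct1[OF lin] _ \<gamma>(1) that] lin R(2)[OF \<gamma>D that] by simp
    qed (rule R(1)[OF \<gamma>D])
    then show "y \<in> R ` unit_ball (dual H)" using \<gamma>D \<gamma>(2) by (auto simp: unit_ball_def)
  qed
  then show ?thesis
    unfolding weakly_compact_op_def
    using lin F.relatively_weakly_compact_if_subset_compact[OF image_compactin[OF H.banach_alaoglu cont]] by blast
qed

text \<open>For \<open>f = T \<circ> g\<close>, the adjoint of the transpose of \<open>g\<close> ends in the bidual of the reflexive space
  \<open>G\<close>, so it takes \<open>\<gamma>\<close> to the evaluation at some \<open>y\<close>; then \<open>adj \<gamma>\<close> is the evaluation at \<open>T y\<close>.\<close>

lemma representable_if_factors:
  fixes G :: "'g::complex_vector cnspace"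
  assumes "complex_banach_space G" and refl: "reflexive G" and "factors_through E U F f G"
  shows representable
  unfolding representable_def
proof
  interpret G: complex_banach_space G by fact
  interpret GD: complex_normed_space "dual G" by (rule G.dual_normed)
  obtain T g where T: "T \<in> bounded_ops G F" and g: "g \<in> vecs (Hinf E U G)" and fT: "f = T \<circ> g"
    using assms(3) by (auto simp: factors_through_def)
  interpret g: bounded_holomorphic E G U g
    by unfold_locales (use U g in auto)
  fix \<gamma> assume \<gamma>: "\<gamma> \<in> vecs (dual H)"
  have "g.adj \<gamma> \<in> eval_at (dual G) ` vecs G" using refl g.adj_closed[OF \<gamma>] by (simp add: reflexive_def)
  then obtain y where y: "y \<in> vecs G" "g.adj \<gamma> = eval_at (dual G) y" by blast
  have "adj \<gamma> \<phi> = \<phi> (T y)" if \<phi>: "\<phi> \<in> vecs (dual F)" for \<phi>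
  proof -
    have "\<phi> \<circ> T \<in> vecs (dual G)"
      using bounded_ops_comp[OF G.complex_normed_space_axioms F.complex_normed_space_axioms T] \<phi>
      unfolding vecs_dual by blast
    then have "\<gamma> ((\<phi> \<circ> T) \<circ> g) = (\<phi> \<circ> T) y"
      using fun_cong[OF y(2), of "\<phi> \<circ> T"] by (simp add: g.adj_def eval_at_def)
    moreover have "(\<phi> \<circ> T) \<circ> g = \<phi> \<circ> f" unfolding fT by (rule comp_assoc)
    ultimately show ?thesis using \<phi> by (simp add: adj_def)
  qed
  then show "is_evaluation F (adj \<gamma>)"
    using bounded_ops_closed(1)[OF T y(1)] unfolding is_evaluation_def by blast
qed

end

section \<open>Cauchy estimates\<close>

lemma deriv_bound_at_centre:
  assumes h: "h holomorphic_on ball 0 R" and B: "\<And>t. t \<in> ball 0 R \<Longrightarrow> cmod (h t) \<le> B" and R: "0 < R"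
  shows "cmod (deriv h 0) \<le> 2 * B / R"
proof -
  have "cmod ((deriv ^^ 1) h 0) \<le> fact 1 * B / (R / 2) ^ 1"
  proof (rule Cauchy_inequality)
    show "h holomorphic_on ball 0 (R / 2)"
      using h by (rule holomorphic_on_subset) (use R in auto)
    show "continuous_on (cball 0 (R / 2)) h"
      using holomorphic_on_imp_continuous_on[OF h] by (rule continuous_on_subset) (use R in auto)
    show "cmod (h x) \<le> B" if "cmod (0 - x) = R / 2" for x using B[of x] that R by simp
  qed (use R in simp)
  then show ?thesis by (simp add: mult.commute)
qed

text \<open>Taylor's formula on the closed unit disc: the second derivative there is bounded by the Cauchy
  estimate on discs of radius \<open>R / 2\<close>, which fit into \<open>ball 0 R\<close> because \<open>1 < R / 2\<close>.\<close>

lemma second_order_remainder_bound: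
  assumes h: "h holomorphic_on ball 0 R" and B: "\<And>t. t \<in> ball 0 R \<Longrightarrow> cmod (h t) \<le> B" and R: "2 < R"
  shows "cmod (h 1 - h 0 - deriv h 0) \<le> 8 * B / R\<^sup>2"
proof -
  have second: "cmod ((deriv ^^ 2) h t) \<le> 8 * B / R\<^sup>2" if t: "t \<in> cball 0 1" for t
  proof -
    have sub: "cball t (R / 2) \<subseteq> ball 0 R"
    proof
      fix u assume "u \<in> cball t (R / 2)"
      then have "cmod (u - t) \<le> R / 2" by (simp add: dist_norm norm_minus_commute)
      then show "u \<in> ball 0 R" using norm_triangle_sub[of u t] t R by simp
    qed
    have "cmod ((deriv ^^ 2) h t) \<le> fact 2 * B / (R / 2) ^ 2"
    proof (rule Cauchy_inequality)
      show "h holomorphic_on ball t (R / 2)"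
        using h by (rule holomorphic_on_subset) (use sub in auto)
      show "continuous_on (cball t (R / 2)) h"
        using holomorphic_on_imp_continuous_on[OF h] sub by (rule continuous_on_subset)
      show "cmod (h x) \<le> B" if "cmod (t - x) = R / 2" for x
        using B[of x] sub that by (auto simp: dist_norm subset_iff)
    qed (use R in simp)
    then show ?thesis by (simp add: power_divide)
  qed
  have "cmod ((deriv ^^ 0) h 1 - (\<Sum>i\<le>1. (deriv ^^ i) h 0 * (1 - 0) ^ i / fact i))
      \<le> 8 * B / R\<^sup>2 * cmod (1 - 0) ^ Suc 1 / fact 1"
  proof (rule complex_Taylor[where S = "cball 0 1"])
    fix i :: nat and x :: complex assume x: "x \<in> cball 0 1"
    have "x \<in> ball 0 R" using x R by simp
    moreover have "(deriv ^^ i) h holomorphic_on ball 0 R" using h by (rule holomorphic_higher_deriv) simp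
    ultimately have "((deriv ^^ i) h has_field_derivative deriv ((deriv ^^ i) h) x) (at x)"
      using holomorphic_derivI open_ball by blast
    then show "((deriv ^^ i) h has_field_derivative (deriv ^^ Suc i) h x) (at x within cball 0 1)"
      using has_field_derivative_at_within by simp
  next
    show "cmod ((deriv ^^ Suc 1) h x) \<le> 8 * B / R\<^sup>2" if "x \<in> cball 0 1" for x
      using second[OF that] by (simp add: numeral_2_eq_2)
  qed auto
  then show ?thesis by (simp add: algebra_simps)
qed

context bounded_holomorphic
begin

lemma line_has_field_derivative:
  assumes x: "x \<in> vecs E" and w: "w \<in> vecs E" and y: "x + t *\<^sub>C w \<in> U"
    and A: "A \<in> bounded_ops E complex_field" and fr: "frechet_at E U complex_field g (x + t *\<^sub>C w) A"
    and nb: "\<exists>d>0. \<forall>s. cmod (s - t) < d \<longrightarrow> x + s *\<^sub>C w \<in> U"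
  shows "((\<lambda>t. g (x + t *\<^sub>C w)) has_field_derivative A w) (at t)"
  unfolding has_field_derivative_def has_derivative_at_alt
proof (intro conjI allI impI)
  show "bounded_linear ((*) (A w))" by (rule bounded_linear_mult_right)
  fix e :: real assume e: "0 < e"
  define n where "n = nrm E w + 1"
  have n: "0 < n" "nrm E w \<le> n" using E.nrm_ge_0[OF w] by (simp_all add: n_def)
  have "0 < e / n" using e n by simp
  then obtain \<delta> where \<delta>: "0 < \<delta>" and le: "\<And>v. v \<in> U \<Longrightarrow> nrm E (v - (x + t *\<^sub>C w)) < \<delta> \<Longrightarrow>
      cmod (g v - g (x + t *\<^sub>C w) - A (v - (x + t *\<^sub>C w))) \<le> e / n * nrm E (v - (x + t *\<^sub>C w))"
    using fr unfolding frechet_at_def complex_field_simps by blast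
  obtain d where d: "0 < d" "\<And>s. cmod (s - t) < d \<Longrightarrow> x + s *\<^sub>C w \<in> U" using nb by blast
  show "\<exists>d>0. \<forall>s. cmod (s - t) < d \<longrightarrow>
      cmod (g (x + s *\<^sub>C w) - g (x + t *\<^sub>C w) - A w * (s - t)) \<le> e * cmod (s - t)"
  proof (intro exI[of _ "min d (\<delta> / n)"] conjI allI impI)
    fix s assume s: "cmod (s - t) < min d (\<delta> / n)"
    have diff: "(x + s *\<^sub>C w) - (x + t *\<^sub>C w) = (s - t) *\<^sub>C w"
      by (simp add: complex_vector.scale_left_diff_distrib)
    have nd: "nrm E ((s - t) *\<^sub>C w) = cmod (s - t) * nrm E w" using E.nrm_scaleC[OF w] .
    have "cmod (s - t) * nrm E w \<le> cmod (s - t) * n" using n by (intro mult_left_mono) auto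
    also have "\<dots> < \<delta>" using s n by (simp add: pos_less_divide_eq)
    finally have "nrm E ((x + s *\<^sub>C w) - (x + t *\<^sub>C w)) < \<delta>" using diff nd by simp
    from le[OF _ this] have "cmod (g (x + s *\<^sub>C w) - g (x + t *\<^sub>C w) - A ((s - t) *\<^sub>C w)) \<le> e / n * (cmod (s - t) * nrm E w)"
      using d(2)[of s] s unfolding diff nd by simp
    also have "\<dots> \<le> e / n * (cmod (s - t) * n)"
      using e n by (intro mult_left_mono) auto
    also have "\<dots> = e * cmod (s - t)" using n by simp
    finally show "cmod (g (x + s *\<^sub>C w) - g (x + t *\<^sub>C w) - A w * (s - t)) \<le> e * cmod (s - t)"
      using bounded_ops_closed(3)[OF A w] by (simp add: scaleC_complex_def mult.commute)
  qed (use d \<delta> n in auto)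
qed

lemma line_holomorphic:
  assumes g: "g \<in> vecs H" and x: "x \<in> U" and r: "0 < r" "\<And>v. v \<in> vecs E \<Longrightarrow> nrm E v < r \<Longrightarrow> x + v \<in> U"
    and w: "w \<in> vecs E" and R: "R * nrm E w \<le> r" "0 < nrm E w"
    and A: "A \<in> bounded_ops E complex_field" and fr: "frechet_at E U complex_field g x A"
  shows "(\<lambda>t. g (x + t *\<^sub>C w)) holomorphic_on ball 0 R"
    and "\<And>t. t \<in> ball 0 R \<Longrightarrow> cmod (g (x + t *\<^sub>C w)) \<le> nrm H g"
    and "0 < R \<Longrightarrow> deriv (\<lambda>t. g (x + t *\<^sub>C w)) 0 = A w"
proof -
  have xE: "x \<in> vecs E" using x U_subset by blast
  have inU: "x + t *\<^sub>C w \<in> U" if "t \<in> ball 0 R" for t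
  proof (rule r(2))
    have "nrm E (t *\<^sub>C w) = cmod t * nrm E w" using E.nrm_scaleC[OF w] .
    also have "\<dots> < R * nrm E w" using that R(2) by (intro mult_strict_right_mono) auto
    finally show "nrm E (t *\<^sub>C w) < r" using R(1) by simp
  qed (use w in blast)
  have nb: "\<exists>d>0. \<forall>s. cmod (s - t) < d \<longrightarrow> x + s *\<^sub>C w \<in> U" if t: "t \<in> ball 0 R" for t
  proof -
    obtain d where "0 < d" "ball t d \<subseteq> ball 0 R" using open_contains_ball t open_ball by blast
    then show ?thesis using inU by (intro exI[of _ d]) (auto simp: subset_iff dist_norm norm_minus_commute)
  qed
  show "(\<lambda>t. g (x + t *\<^sub>C w)) holomorphic_on ball 0 R"
    unfolding holomorphic_on_open[OF open_ball]
  proof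
    fix t :: complex assume t: "t \<in> ball 0 R"
    obtain B where "B \<in> bounded_ops E complex_field" "frechet_at E U complex_field g (x + t *\<^sub>C w) B"
      using g inU[OF t] unfolding mem_Hinf_iff holomorphic_map_iff by blast
    then show "\<exists>f'. ((\<lambda>t. g (x + t *\<^sub>C w)) has_field_derivative f') (at t)"
      using line_has_field_derivative[OF xE w inU[OF t] _ _ nb[OF t]] by blast
  qed
  show "cmod (g (x + t *\<^sub>C w)) \<le> nrm H g" if "t \<in> ball 0 R" for t
    using Hinf_le[OF g inU[OF that]] by simp
  show "deriv (\<lambda>t. g (x + t *\<^sub>C w)) 0 = A w" if "0 < R"
  proof (rule DERIV_imp_deriv, rule line_has_field_derivative[OF xE w _ A])
    show "x + 0 *\<^sub>C w \<in> U" using x by simp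
    show "frechet_at E U complex_field g (x + 0 *\<^sub>C w) A" using fr by simp
    show "\<exists>d>0. \<forall>s. cmod (s - 0) < d \<longrightarrow> x + s *\<^sub>C w \<in> U" using nb[of 0] that by simp
  qed
qed

lemma derivative_bound:
  assumes g: "g \<in> vecs H" and x: "x \<in> U" and r: "0 < r" "\<And>v. v \<in> vecs E \<Longrightarrow> nrm E v < r \<Longrightarrow> x + v \<in> U"
    and A: "A \<in> bounded_ops E complex_field" and fr: "frechet_at E U complex_field g x A" and w: "w \<in> vecs E"
  shows "cmod (A w) \<le> (2 / r * nrm E w) * nrm H g"
proof (cases "w = 0")
  case True
  then show ?thesis using bounded_ops_zero[OF E.complex_normed_space_axioms A] by simp
next
  case False
  then have n: "0 < nrm E w" using E.nrm_ge_0[OF w] E.nrm_eq_0_iff[OF w] by simp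
  define R where "R = r / nrm E w"
  have R: "R * nrm E w \<le> r" "0 < R" using n r by (simp_all add: R_def)
  have "cmod (deriv (\<lambda>t. g (x + t *\<^sub>C w)) 0) \<le> 2 * nrm H g / R"
    using line_holomorphic(1,2)[OF g x r w R(1) n A fr] R(2) by (rule deriv_bound_at_centre)
  then show ?thesis using line_holomorphic(3)[OF g x r w R(1) n A fr R(2)] by (simp add: R_def ac_simps)
qed

lemma remainder_bound:
  assumes g: "g \<in> vecs H" and x: "x \<in> U" and r: "0 < r" "\<And>v. v \<in> vecs E \<Longrightarrow> nrm E v < r \<Longrightarrow> x + v \<in> U"
    and A: "A \<in> bounded_ops E complex_field" and fr: "frechet_at E U complex_field g x A"
    and w: "w \<in> vecs E" "nrm E w < r / 2"
  shows "cmod (g (x + w) - g x - A w) \<le> (8 / r\<^sup>2 * (nrm E w)\<^sup>2) * nrm H g"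
proof (cases "w = 0")
  case True
  then show ?thesis using bounded_ops_zero[OF E.complex_normed_space_axioms A] by simp
next
  case False
  then have n: "0 < nrm E w" using E.nrm_ge_0[OF w(1)] E.nrm_eq_0_iff[OF w(1)] by simp
  define R where "R = r / nrm E w"
  have R: "R * nrm E w \<le> r" "2 < R" using n r w by (simp_all add: R_def field_simps)
  have "cmod (g (x + 1 *\<^sub>C w) - g (x + 0 *\<^sub>C w) - deriv (\<lambda>t. g (x + t *\<^sub>C w)) 0) \<le> 8 * nrm H g / R\<^sup>2"
    using line_holomorphic(1,2)[OF g x r w(1) R(1) n A fr] R(2) by (rule second_order_remainder_bound)
  then show ?thesis
    using line_holomorphic(3)[OF g x r w(1) R(1) n A fr] R(2) by (simp add: R_def power_divide ac_simps)
qed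

lemma ball_subset_U:
  assumes "x \<in> U"
  obtains r where "0 < r" "\<And>v. v \<in> vecs E \<Longrightarrow> nrm E v < r \<Longrightarrow> x + v \<in> U"
proof -
  have xE: "x \<in> vecs E" using assms U_subset by blast
  obtain r where r: "0 < r" "E.mball x r \<subseteq> U"
    using U assms unfolding norm_topology_def E.openin_mtopology by blast
  have "x + v \<in> U" if "v \<in> vecs E" "nrm E v < r" for v
  proof -
    have "ndist E x (x + v) = nrm E v"
      using xE that E.vadd E.nrm_uminus[of v] by (simp add: ndist_def)
    then have "x + v \<in> E.mball x r" using xE that by (simp add: E.mball_def)
    then show ?thesis using r(2) by blast
  qed
  then show ?thesis using r(1) that by blast
qed

end

section \<open>The Davis-Figiel-Johnson-Pelczynski space\<close>

text \<open>Functionals dominated by the sum of two norms are split by Hahn-Banach on a product.\<close>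

instantiation prod :: (complex_vector, complex_vector) complex_vector
begin
definition "scaleC a p = (a *\<^sub>C fst p, a *\<^sub>C snd p)"
instance
  by standard (simp_all add: scaleC_prod_def prod_eq_iff scaleC_add_right scaleC_add_left)
end

context complex_normed_space
begin

lemma eval_at_dual_dual:
  assumes x: "x \<in> vecs X"
  shows "eval_at (dual X) x \<in> vecs (dual (dual X))"
proof -
  interpret D: complex_normed_space "dual X" by (rule dual_normed)
  show ?thesis
    unfolding eval_at_def using dual_le[OF _ x]
    by (intro D.restrict_in_dual[where K = "nrm X x"]) (auto simp: scaleC_functional mult.commute)
qed

end

text \<open>Regard \<open>\<psi>\<close> as a functional on the diagonal of \<open>G \<times> F\<close> and extend it with the sum of the two
  norms as bound.  The component of the extension on \<open>F\<close> is \<open>\<phi>\<close>, the one on \<open>G\<close> is \<open>\<psi> - \<phi>\<close>.\<close>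

lemma split_dominated_functional:
  fixes G F :: "'b::complex_vector cnspace"
  assumes G: "complex_normed_space G" and F: "complex_normed_space F" and GF: "vecs G \<subseteq> vecs F"
    and \<psi>: "\<psi> \<in> vecs (dual G)" and e: "0 \<le> e" and C: "0 \<le> C"
    and dom: "\<And>y. y \<in> vecs G \<Longrightarrow> cmod (\<psi> y) \<le> e * nrm G y + C * nrm F y"
  shows "\<exists>\<phi>\<in>vecs (dual F). \<forall>y\<in>vecs G. cmod (\<psi> y - \<phi> y) \<le> e * nrm G y"
proof -
  interpret G: complex_normed_space G by (rule G)
  interpret F: complex_normed_space F by (rule F)
  define V where "V = vecs G \<times> vecs F"
  define M where "M = (\<lambda>y. (y, y)) ` vecs G"
  define p where "p v = e * nrm G (fst v) + C * nrm F (snd v)" for v :: "'b \<times> 'b"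
  have V: "complex_subspace V"
    unfolding complex_vector.subspace_def V_def by (auto simp: scaleC_prod_def zero_prod_def)
  have M: "complex_subspace M"
    unfolding complex_vector.subspace_def M_def
    by (auto simp: scaleC_prod_def zero_prod_def image_iff)
  obtain \<Psi> where \<Psi>: "\<And>u v. u \<in> V \<Longrightarrow> v \<in> V \<Longrightarrow> \<Psi> (u + v) = \<Psi> u + \<Psi> v"
    "\<And>a v. v \<in> V \<Longrightarrow> \<Psi> (a *\<^sub>C v) = a * \<Psi> v"
    "\<And>v. v \<in> M \<Longrightarrow> \<Psi> v = \<psi> (fst v)" "\<And>v. v \<in> V \<Longrightarrow> cmod (\<Psi> v) \<le> p v"
  proof (rule hahn_banach_complex[OF V M, of p "\<lambda>v. \<psi> (fst v)"])
    show "M \<subseteq> V" using GF by (auto simp: M_def V_def)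
    show "p (u + v) \<le> p u + p v" if "u \<in> V" "v \<in> V" for u v
    proof -
      have "e * nrm G (fst u + fst v) \<le> e * (nrm G (fst u) + nrm G (fst v))"
        using that e by (intro mult_left_mono G.nrm_triangle) (auto simp: V_def)
      moreover have "C * nrm F (snd u + snd v) \<le> C * (nrm F (snd u) + nrm F (snd v))"
        using that C by (intro mult_left_mono F.nrm_triangle) (auto simp: V_def)
      ultimately show ?thesis by (simp add: p_def algebra_simps)
    qed
    show "p (a *\<^sub>C v) = cmod a * p v" if "v \<in> V" for a v
      using that by (auto simp: p_def V_def scaleC_prod_def G.nrm_scaleC F.nrm_scaleC algebra_simps)
    show "\<psi> (fst (u + v)) = \<psi> (fst u) + \<psi> (fst v)" if "u \<in> M" "v \<in> M" for u v
      using that G.dual_add[OF \<psi>] by (auto simp: M_def)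
    show "\<psi> (fst (a *\<^sub>C v)) = a * \<psi> (fst v)" if "v \<in> M" for a v
      using that G.dual_scale[OF \<psi>] by (auto simp: M_def scaleC_prod_def)
    show "cmod (\<psi> (fst v)) \<le> p v" if "v \<in> M" for v
      using that dom by (auto simp: M_def p_def)
  qed auto
  define \<phi> where "\<phi> = (\<lambda>v. if v \<in> vecs F then \<Psi> (0, v) else 0)"
  have "\<phi> \<in> vecs (dual F)"
    unfolding \<phi>_def
  proof (rule F.restrict_in_dual[where K = C])
    show "\<Psi> (0, u + v) = \<Psi> (0, u) + \<Psi> (0, v)" if "u \<in> vecs F" "v \<in> vecs F" for u v
      using \<Psi>(1)[of "(0, u)" "(0, v)"] that by (simp add: V_def)
    show "\<Psi> (0, a *\<^sub>C v) = a * \<Psi> (0, v)" if "v \<in> vecs F" for a v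
      using \<Psi>(2)[of "(0, v)" a] that by (simp add: V_def scaleC_prod_def)
    show "cmod (\<Psi> (0, v)) \<le> C * nrm F v" if "v \<in> vecs F" for v
      using \<Psi>(4)[of "(0, v)"] that by (simp add: V_def p_def)
  qed
  moreover have "cmod (\<psi> y - \<phi> y) \<le> e * nrm G y" if y: "y \<in> vecs G" for y
  proof -
    have "\<psi> y = \<Psi> ((y, 0) + (0, y))" using \<Psi>(3)[of "(y, y)"] y by (simp add: M_def)
    also have "\<dots> = \<Psi> (y, 0) + \<Psi> (0, y)" using y GF by (intro \<Psi>(1)) (auto simp: V_def)
    finally have "\<psi> y - \<phi> y = \<Psi> (y, 0)" using y GF by (auto simp: \<phi>_def)
    then show ?thesis using \<Psi>(4)[of "(y, 0)"] y by (simp add: V_def p_def)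
  qed
  ultimately show ?thesis by blast
qed

context bounded_holomorphic
begin

text \<open>Let \<open>W\<close> be the closed absolutely convex hull of the range of \<open>f\<close> and \<open>B\<close> the closed unit ball
  of \<open>F\<close>.  The value \<open>q n \<phi>\<close> is the supremum of \<open>\<phi>\<close> over \<open>2\<^sup>n W + 2\<^sup>-\<^sup>n B\<close>, so that the dual norm \<open>N n\<close>
  is the gauge of the closure of this set.  The space \<open>DFJP\<close> consists of the vectors for which the
  sequence of these gauges is square summable; \<open>L m\<close> is the norm of its first \<open>m\<close> terms.\<close>

definition q :: "nat \<Rightarrow> ('b \<Rightarrow> complex) \<Rightarrow> real" where
  "q n \<phi> = 2 ^ n * nrm H (\<phi> \<circ> f) + (1/2) ^ n * nrm (dual F) \<phi>"

definition N :: "nat \<Rightarrow> 'b \<Rightarrow> real" where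
  "N n x = (SUP \<phi>\<in>{\<phi>\<in>vecs (dual F). q n \<phi> \<le> 1}. cmod (\<phi> x))"

definition L :: "nat \<Rightarrow> 'b \<Rightarrow> real" where
  "L m x = L2_set (\<lambda>n. N n x) {..<m}"

definition DFJP :: "'b cnspace" where
  "DFJP = \<lparr>vecs = {x\<in>vecs F. bdd_above (range (\<lambda>m. L m x))}, nrm = (\<lambda>x. SUP m. L m x)\<rparr>"

abbreviation "G \<equiv> DFJP"

lemma q_scale:
  assumes "\<phi> \<in> vecs (dual F)" shows "q n (a *\<^sub>C \<phi>) = cmod a * q n \<phi>"
  using H.nrm_scaleC[OF comp_closed[OF assms]] FD.nrm_scaleC[OF assms]
  by (simp add: q_def comp_scale algebra_simps)

lemma q_ge:
  assumes "\<phi> \<in> vecs (dual F)"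
  shows "(1/2) ^ n * nrm (dual F) \<phi> \<le> q n \<phi>" "2 ^ n * nrm H (\<phi> \<circ> f) \<le> q n \<phi>" "0 \<le> q n \<phi>"
  using H.nrm_ge_0[OF comp_closed[OF assms]] FD.nrm_ge_0[OF assms] by (simp_all add: q_def)

lemma N_bdd_above:
  assumes x: "x \<in> vecs F"
  shows "bdd_above ((\<lambda>\<phi>. cmod (\<phi> x)) ` {\<phi>\<in>vecs (dual F). q n \<phi> \<le> 1})"
proof (rule bdd_aboveI2)
  fix \<phi> assume "\<phi> \<in> {\<phi>\<in>vecs (dual F). q n \<phi> \<le> 1}"
  then have \<phi>: "\<phi> \<in> vecs (dual F)" "q n \<phi> \<le> 1" by auto
  have "(1/2) ^ n * nrm (dual F) \<phi> \<le> 1" using q_ge(1)[OF \<phi>(1), of n] \<phi>(2) by linarith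
  then have "nrm (dual F) \<phi> \<le> 2 ^ n" by (simp add: power_one_over field_simps)
  then have "nrm (dual F) \<phi> * nrm F x \<le> 2 ^ n * nrm F x" using F.nrm_ge_0[OF x] by (rule mult_right_mono)
  then show "cmod (\<phi> x) \<le> 2 ^ n * nrm F x" using F.dual_le[OF \<phi>(1) x] by linarith
qed

lemma functional_le_N:
  assumes \<phi>: "\<phi> \<in> vecs (dual F)" and x: "x \<in> vecs F"
  shows "cmod (\<phi> x) \<le> q n \<phi> * N n x"
proof (cases "q n \<phi> = 0")
  case True
  have "0 < (1/2::real) ^ n" by simp
  moreover have "(1/2) ^ n * nrm (dual F) \<phi> \<le> (1/2) ^ n * 0" using q_ge(1)[OF \<phi>, of n] True by simp
  ultimately have "nrm (dual F) \<phi> \<le> 0" by (rule mult_left_le_imp_le[rotated])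
  then have "nrm (dual F) \<phi> = 0" using FD.nrm_ge_0[OF \<phi>] by simp
  then show ?thesis using True F.dual_le[OF \<phi> x] by simp
next
  case False
  then have pos: "0 < q n \<phi>" using q_ge(3)[OF \<phi>, of n] by simp
  define \<psi> where "\<psi> = of_real (inverse (q n \<phi>)) *\<^sub>C \<phi>"
  have "q n \<psi> = cmod (of_real (inverse (q n \<phi>))) * q n \<phi>" unfolding \<psi>_def by (rule q_scale[OF \<phi>])
  also have "\<dots> = 1" unfolding norm_of_real using pos by simp
  finally have "\<psi> \<in> {\<phi>\<in>vecs (dual F). q n \<phi> \<le> 1}"
    unfolding \<psi>_def using FD.vscale[OF \<phi>] by simp
  then have "cmod (\<psi> x) \<le> N n x" unfolding N_def using N_bdd_above[OF x] by (intro cSUP_upper)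
  moreover have "cmod (\<psi> x) = inverse (q n \<phi>) * cmod (\<phi> x)"
    unfolding \<psi>_def scaleC_functional norm_mult norm_of_real using pos by simp
  ultimately show ?thesis using pos by (simp add: field_simps)
qed

lemma N_le:
  assumes "0 \<le> c" "\<And>\<phi>. \<phi> \<in> vecs (dual F) \<Longrightarrow> cmod (\<phi> x) \<le> c * q n \<phi>"
  shows "N n x \<le> c"
  unfolding N_def
proof (rule cSUP_least)
  have "q n 0 \<le> 1" using q_scale[OF FD.vzero, of n 0] by simp
  then show "{\<phi> \<in> vecs (dual F). q n \<phi> \<le> 1} \<noteq> {}" using FD.vzero by blast
  fix \<phi> assume "\<phi> \<in> {\<phi>\<in>vecs (dual F). q n \<phi> \<le> 1}"
  then have \<phi>: "\<phi> \<in> vecs (dual F)" "q n \<phi> \<le> 1" by auto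
  show "cmod (\<phi> x) \<le> c" using assms(2)[OF \<phi>(1)] mult_left_mono[OF \<phi>(2) assms(1)] by simp
qed

lemma N_ge_0: "x \<in> vecs F \<Longrightarrow> 0 \<le> N n x"
proof -
  assume x: "x \<in> vecs F"
  have "q n 0 \<le> 1" using q_scale[OF FD.vzero, of n 0] by simp
  then have "0 \<in> {\<phi>\<in>vecs (dual F). q n \<phi> \<le> 1}" using FD.vzero by blast
  from cSUP_upper[OF this N_bdd_above[OF x]] have "cmod ((0 :: 'b \<Rightarrow> complex) x) \<le> N n x"
    unfolding N_def .
  then show ?thesis by simp
qed

lemma N_triangle:
  assumes "x \<in> vecs F" "y \<in> vecs F" shows "N n (x + y) \<le> N n x + N n y"
proof (rule N_le)
  show "0 \<le> N n x + N n y" using N_ge_0 assms by simp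
  fix \<phi> assume \<phi>: "\<phi> \<in> vecs (dual F)"
  show "cmod (\<phi> (x + y)) \<le> (N n x + N n y) * q n \<phi>"
    using norm_triangle_ineq[of "\<phi> x" "\<phi> y"] functional_le_N[OF \<phi> assms(1), of n] functional_le_N[OF \<phi> assms(2), of n]
      F.dual_add[OF \<phi> assms] by (simp add: algebra_simps)
qed

lemma N_scale_le:
  assumes "x \<in> vecs F" shows "N n (a *\<^sub>C x) \<le> cmod a * N n x"
proof (rule N_le)
  show "0 \<le> cmod a * N n x" using N_ge_0[OF assms] by simp
  fix \<phi> assume \<phi>: "\<phi> \<in> vecs (dual F)"
  show "cmod (\<phi> (a *\<^sub>C x)) \<le> (cmod a * N n x) * q n \<phi>"
    using mult_left_mono[OF functional_le_N[OF \<phi> assms, of n], of "cmod a"] F.dual_scale[OF \<phi> assms]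
    by (simp add: norm_mult ac_simps)
qed

lemma N_le_nrm:
  assumes "x \<in> vecs F" shows "N n x \<le> 2 ^ n * nrm F x"
proof (rule N_le)
  show "0 \<le> 2 ^ n * nrm F x" using F.nrm_ge_0[OF assms] by simp
  fix \<phi> assume \<phi>: "\<phi> \<in> vecs (dual F)"
  have "nrm (dual F) \<phi> \<le> 2 ^ n * q n \<phi>"
    using q_ge(1)[OF \<phi>, of n] by (simp add: power_one_over field_simps)
  from mult_right_mono[OF this F.nrm_ge_0[OF assms]]
  show "cmod (\<phi> x) \<le> (2 ^ n * nrm F x) * q n \<phi>" using F.dual_le[OF \<phi> assms] by (simp add: ac_simps)
qed

lemma q_zero_le:
  assumes "\<phi> \<in> vecs (dual F)" shows "q 0 \<phi> \<le> (nrm (Hinf E U F) f + 1) * nrm (dual F) \<phi>"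
  using comp_nrm_le[OF assms] by (simp add: q_def algebra_simps)

lemma nrm_le_N:
  assumes x: "x \<in> vecs F" shows "nrm F x \<le> (nrm (Hinf E U F) f + 1) * N 0 x"
proof (rule F.nrm_le_if_functionals_le[OF x])
  show "0 \<le> (nrm (Hinf E U F) f + 1) * N 0 x" using Hinf_nrm_ge_0[OF f] N_ge_0[OF x] by simp
  fix \<phi> assume \<phi>: "\<phi> \<in> vecs (dual F)"
  show "cmod (\<phi> x) \<le> (nrm (Hinf E U F) f + 1) * N 0 x * nrm (dual F) \<phi>"
    using functional_le_N[OF \<phi> x, of 0] mult_right_mono[OF q_zero_le[OF \<phi>] N_ge_0[OF x, of 0]]
    by (simp add: ac_simps)
qed

lemma L_triangle:
  assumes "x \<in> vecs F" "y \<in> vecs F" shows "L m (x + y) \<le> L m x + L m y"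
proof -
  have "L m (x + y) \<le> L2_set (\<lambda>n. N n x + N n y) {..<m}"
    unfolding L_def using N_triangle[OF assms] N_ge_0 assms by (intro L2_set_mono) auto
  also have "\<dots> \<le> L m x + L m y" unfolding L_def by (rule L2_set_triangle_ineq)
  finally show ?thesis .
qed

lemma L_scale_le:
  assumes "x \<in> vecs F" shows "L m (a *\<^sub>C x) \<le> cmod a * L m x"
proof -
  have "L m (a *\<^sub>C x) \<le> L2_set (\<lambda>n. cmod a * N n x) {..<m}"
    unfolding L_def using N_scale_le[OF assms] N_ge_0 assms by (intro L2_set_mono) auto
  also have "\<dots> = cmod a * L m x" unfolding L_def by (simp add: L2_set_right_distrib)
  finally show ?thesis .
qed

lemma L_ge_0: "0 \<le> L m x"
  by (simp add: L_def L2_set_nonneg)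

lemma L_mono: "m \<le> k \<Longrightarrow> L m x \<le> L k x"
  unfolding L_def L2_set_def by (intro real_sqrt_le_mono sum_mono2) auto

lemma L_le_nrm:
  assumes "x \<in> vecs F" shows "L m x \<le> (\<Sum>n<m. 2 ^ n) * nrm F x"
proof -
  have "L m x \<le> (\<Sum>n<m. N n x)" unfolding L_def using N_ge_0[OF assms] by (intro L2_set_le_sum) auto
  also have "\<dots> \<le> (\<Sum>n<m. 2 ^ n * nrm F x)" using N_le_nrm[OF assms] by (intro sum_mono) auto
  finally show ?thesis by (simp add: sum_distrib_right)
qed

lemma N_le_L: "N n x \<le> L (Suc n) x"
  unfolding L_def by (rule member_le_L2_set) auto

lemma mem_G_iff: "x \<in> vecs G \<longleftrightarrow> x \<in> vecs F \<and> (\<exists>K. \<forall>m. L m x \<le> K)"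
  by (auto simp: DFJP_def bdd_above_def)

lemma L_le_G_nrm: "x \<in> vecs G \<Longrightarrow> L m x \<le> nrm G x"
  by (auto simp: DFJP_def intro: cSUP_upper)

lemma G_nrm_le: "(\<And>m. L m x \<le> K) \<Longrightarrow> nrm G x \<le> K"
  by (simp add: DFJP_def cSUP_least)

lemma G_subset_F: "vecs G \<subseteq> vecs F"
  by (auto simp: mem_G_iff)

lemma N_le_G_nrm: "x \<in> vecs G \<Longrightarrow> N n x \<le> nrm G x"
  using N_le_L L_le_G_nrm order_trans by blast

lemma F_nrm_le_G_nrm:
  assumes "x \<in> vecs G" shows "nrm F x \<le> (nrm (Hinf E U F) f + 1) * nrm G x"
proof -
  have "nrm F x \<le> (nrm (Hinf E U F) f + 1) * N 0 x" using nrm_le_N assms G_subset_F by blast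
  also have "\<dots> \<le> (nrm (Hinf E U F) f + 1) * nrm G x"
    using N_le_G_nrm[OF assms] Hinf_nrm_ge_0[OF f] by (intro mult_left_mono) auto
  finally show ?thesis .
qed

lemma G_nrm_ge_0: "x \<in> vecs G \<Longrightarrow> 0 \<le> nrm G x"
  using L_le_G_nrm L_ge_0 order_trans by blast

lemma G_normed: "complex_normed_space G"
proof
  have add: "x + y \<in> vecs G" "nrm G (x + y) \<le> nrm G x + nrm G y" if "x \<in> vecs G" "y \<in> vecs G" for x y
  proof -
    have xy: "x \<in> vecs F" "y \<in> vecs F" using that G_subset_F by auto
    have le: "L m (x + y) \<le> nrm G x + nrm G y" for m
      using L_triangle[OF xy, of m] L_le_G_nrm[OF that(1), of m] L_le_G_nrm[OF that(2), of m] by linarith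
    then show "x + y \<in> vecs G" unfolding mem_G_iff using xy by auto
    show "nrm G (x + y) \<le> nrm G x + nrm G y" using G_nrm_le[OF le] .
  qed
  have scale: "a *\<^sub>C x \<in> vecs G" "nrm G (a *\<^sub>C x) \<le> cmod a * nrm G x" if "x \<in> vecs G" for a x
  proof -
    have xF: "x \<in> vecs F" using that G_subset_F by auto
    have le: "L m (a *\<^sub>C x) \<le> cmod a * nrm G x" for m
      using L_scale_le[OF xF, of m a] mult_left_mono[OF L_le_G_nrm[OF that, of m], of "cmod a"] by simp
    then show "a *\<^sub>C x \<in> vecs G" unfolding mem_G_iff using xF by auto
    show "nrm G (a *\<^sub>C x) \<le> cmod a * nrm G x" using G_nrm_le[OF le] .
  qed
  have "L m 0 \<le> 0" for m using L_scale_le[OF F.vzero, of m 0] by simp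
  note L0 = this
  then have zero: "0 \<in> vecs G" unfolding mem_G_iff by auto
  show "complex_subspace (vecs G)"
    unfolding complex_vector.subspace_def using add(1) scale(1) zero by blast
  fix x assume x: "x \<in> vecs G"
  show "0 \<le> nrm G x" using G_nrm_ge_0[OF x] .
  show "nrm G x = 0 \<longleftrightarrow> x = 0"
  proof
    assume "nrm G x = 0"
    then have "nrm F x \<le> 0" using F_nrm_le_G_nrm[OF x] by simp
    then show "x = 0" using F.nrm_ge_0 F.nrm_eq_0_iff x G_subset_F by (metis order_antisym subsetD)
  next
    assume "x = 0"
    then show "nrm G x = 0" using G_nrm_le[of x 0] L0 G_nrm_ge_0[OF x] by force
  qed
  show "nrm G (a *\<^sub>C x) = cmod a * nrm G x" for a
  proof (rule antisym[OF scale(2)[OF x]])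
    show "cmod a * nrm G x \<le> nrm G (a *\<^sub>C x)"
    proof (cases "a = 0")
      case True
      then show ?thesis using G_nrm_ge_0[OF zero] by simp
    next
      case False
      have "nrm G (inverse a *\<^sub>C (a *\<^sub>C x)) \<le> cmod (inverse a) * nrm G (a *\<^sub>C x)"
        using scale(2)[OF scale(1)[OF x, of a], of "inverse a"] .
      moreover have "inverse a *\<^sub>C (a *\<^sub>C x) = x" using False by simp
      ultimately show ?thesis using False by (simp add: norm_divide field_simps)
    qed
  qed
  show "nrm G (x + y) \<le> nrm G x + nrm G y" if "y \<in> vecs G" for y using add(2)[OF x that] .
qed

sublocale G: complex_normed_space G by (rule G_normed)
sublocale GD: complex_normed_space "dual G" by (rule G.dual_normed)

lemma G_banach: "complex_banach_space G"
proof
  show "G.mcomplete"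
    unfolding G.mcomplete_def
  proof (intro allI impI)
    fix s assume s: "G.MCauchy s"
    then have sG: "s n \<in> vecs G" for n unfolding G.MCauchy_def by auto
    then have sF: "s n \<in> vecs F" for n using G_subset_F by blast
    have cau: "\<exists>K. \<forall>m n. K \<le> m \<longrightarrow> K \<le> n \<longrightarrow> nrm G (s m - s n) < e" if "0 < e" for e
      using s that G.MCauchy_iff_nrm[of s] sG by simp
    define M where "M = nrm (Hinf E U F) f + 1"
    have M: "0 < M" using Hinf_nrm_ge_0[OF f] by (simp add: M_def)
    obtain l where l: "l \<in> vecs F" "\<And>e. 0 < e \<Longrightarrow> \<exists>K. \<forall>n\<ge>K. nrm F (s n - l) < e"
    proof (rule F.cauchy_converges[of s, OF sF])
      fix e :: real assume "0 < e"
      then obtain K where K: "\<And>m n. K \<le> m \<Longrightarrow> K \<le> n \<Longrightarrow> nrm G (s m - s n) < e / M"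
        using cau[of "e / M"] M by auto
      have "nrm F (s m - s n) < e" if "K \<le> m" "K \<le> n" for m n
      proof -
        have "nrm F (s m - s n) \<le> M * nrm G (s m - s n)"
          unfolding M_def using sG by (intro F_nrm_le_G_nrm) blast
        also have "\<dots> < e" using K[OF that] M by (simp add: field_simps)
        finally show ?thesis .
      qed
      then show "\<exists>K. \<forall>m n. K \<le> m \<longrightarrow> K \<le> n \<longrightarrow> nrm F (s m - s n) < e" by blast
    qed auto
    \<comment> \<open>\<open>L k\<close> is continuous for the norm of \<open>F\<close>, so bounds on \<open>L k (s m - s n)\<close> pass to the limit\<close>
    have lim: "\<exists>K. \<forall>m\<ge>K. s m - l \<in> vecs G \<and> nrm G (s m - l) \<le> e" if e: "0 < e" for e
    proof -
      obtain K where K: "\<And>m n. K \<le> m \<Longrightarrow> K \<le> n \<Longrightarrow> nrm G (s m - s n) < e" using cau[OF e] by blast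
      have "L k (s m - l) \<le> e" if m: "K \<le> m" for k m
      proof (rule field_le_epsilon)
        fix t :: real assume t: "0 < t"
        define c where "c = (\<Sum>n<k. (2::real) ^ n) + 1"
        have c: "0 < c" unfolding c_def by (intro add_nonneg_pos sum_nonneg) auto
        then obtain K' where K': "\<And>n. K' \<le> n \<Longrightarrow> nrm F (s n - l) < t / c" using l(2)[of "t / c"] t by auto
        define n where "n = max K K'"
        have "L k (s m - l) = L k ((s m - s n) + (s n - l))" by simp
        also have "\<dots> \<le> L k (s m - s n) + L k (s n - l)" using sF l(1) by (intro L_triangle) auto
        also have "\<dots> \<le> e + t"
        proof (rule add_mono)
          show "L k (s m - s n) \<le> e"
            using L_le_G_nrm[of "s m - s n" k] sG K[OF m, of n] by (simp add: n_def)
          have nn: "0 \<le> nrm F (s n - l)" using sF l(1) by (intro F.nrm_ge_0) auto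
          have "L k (s n - l) \<le> (\<Sum>n<k. 2 ^ n) * nrm F (s n - l)" using sF l(1) by (intro L_le_nrm) auto
          also have "\<dots> \<le> c * nrm F (s n - l)" using nn by (intro mult_right_mono) (auto simp: c_def)
          also have "\<dots> \<le> c * (t / c)" using K'[of n] c by (intro mult_left_mono) (auto simp: n_def)
          finally show "L k (s n - l) \<le> t" using c by simp
        qed
        finally show "L k (s m - l) \<le> e + t" .
      qed
      then show ?thesis
        using sF l(1) G_nrm_le unfolding mem_G_iff by (meson F.vdiff)
    qed
    obtain K where "s K - l \<in> vecs G" using lim[of 1] by auto
    then have "s K - (s K - l) \<in> vecs G" using sG by blast
    then have lG: "l \<in> vecs G" by simp
    have "\<exists>K. \<forall>n\<ge>K. nrm G (s n - l) < e" if e: "0 < e" for e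
    proof -
      obtain K where K: "\<forall>m\<ge>K. s m - l \<in> vecs G \<and> nrm G (s m - l) \<le> e / 2"
        using lim[OF half_gt_zero[OF e]] by blast
      have "nrm G (s m - l) < e" if "K \<le> m" for m
        using K[rule_format, OF that] e by linarith
      then show ?thesis by blast
    qed
    then have "limitin G.mtopology s l sequentially" using G.limitin_iff_nrm[of s l] sG lG by simp
    then show "\<exists>x. limitin G.mtopology s x sequentially" by blast
  qed
qed

text \<open>For \<open>v\<close> in \<open>c W\<close> the \<open>n\<close>-th norm is at most \<open>c 2\<^sup>-\<^sup>n\<close>, which is square summable.  The lemma is
  applied to values of \<open>f\<close>, to values of its derivatives and to remainders.\<close>

lemma in_G_if_dominated:
  assumes v: "v \<in> vecs F" and c: "0 \<le> c"
    and dom: "\<And>\<phi>. \<phi> \<in> vecs (dual F) \<Longrightarrow> cmod (\<phi> v) \<le> c * nrm H (\<phi> \<circ> f)"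
  shows "v \<in> vecs G" "nrm G v \<le> 2 * c"
proof -
  have N: "N n v \<le> c * (1/2) ^ n" for n
  proof (rule N_le)
    fix \<phi> assume \<phi>: "\<phi> \<in> vecs (dual F)"
    have "nrm H (\<phi> \<circ> f) \<le> (1/2) ^ n * q n \<phi>"
      using q_ge(2)[OF \<phi>, of n] by (simp add: power_one_over field_simps)
    from mult_left_mono[OF this c] show "cmod (\<phi> v) \<le> c * (1/2) ^ n * q n \<phi>" using dom[OF \<phi>] by (simp add: ac_simps)
  qed (use c in simp)
  have le: "L m v \<le> 2 * c" for m
  proof -
    have "L m v \<le> (\<Sum>n<m. N n v)" unfolding L_def using N_ge_0[OF v] by (intro L2_set_le_sum) auto
    also have "\<dots> \<le> (\<Sum>n<m. c * (1/2) ^ n)" using N by (intro sum_mono) auto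
    also have "\<dots> = c * (\<Sum>n<m. (1/2) ^ n)" by (simp add: sum_distrib_left)
    also have "\<dots> \<le> c * 2" using c by (intro mult_left_mono) (simp_all add: sum_gp_strict)
    finally show ?thesis by simp
  qed
  then show "v \<in> vecs G" using v unfolding mem_G_iff by blast
  show "nrm G v \<le> 2 * c" using G_nrm_le[OF le] .
qed

end

section \<open>Reflexivity and factorization\<close>

context bounded_holomorphic
begin

text \<open>The restriction to \<open>G\<close>, that is, the transpose of the inclusion of \<open>G\<close> in \<open>F\<close>.\<close>

definition restr :: "('b \<Rightarrow> complex) \<Rightarrow> 'b \<Rightarrow> complex" where
  "restr \<phi> = (\<lambda>x. if x \<in> vecs G then \<phi> x else 0)"

lemma restr_in_dual:
  assumes \<phi>: "\<phi> \<in> vecs (dual F)"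
  shows "restr \<phi> \<in> vecs (dual G)"
  unfolding restr_def
proof (rule G.restrict_in_dual[where K = "q 0 \<phi>"])
  fix x assume x: "x \<in> vecs G"
  have "cmod (\<phi> x) \<le> q 0 \<phi> * N 0 x" using functional_le_N[OF \<phi>] x G_subset_F by blast
  also have "\<dots> \<le> q 0 \<phi> * nrm G x" using N_le_G_nrm[OF x] q_ge(3)[OF \<phi>] by (rule mult_left_mono)
  finally show "cmod (\<phi> x) \<le> q 0 \<phi> * nrm G x" .
qed (use F.dual_add[OF \<phi>] F.dual_scale[OF \<phi>] subsetD[OF G_subset_F] in auto)

lemma restr_nrm_le_q:
  assumes \<phi>: "\<phi> \<in> vecs (dual F)"
  shows "nrm (dual G) (restr \<phi>) \<le> q n \<phi>"
proof (rule G.dual_nrm_le[OF q_ge(3)[OF \<phi>]])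
  fix x assume x: "x \<in> vecs G"
  have "cmod (\<phi> x) \<le> q n \<phi> * N n x" using functional_le_N[OF \<phi>] x G_subset_F by blast
  also have "\<dots> \<le> q n \<phi> * nrm G x" using N_le_G_nrm[OF x] q_ge(3)[OF \<phi>] by (rule mult_left_mono)
  finally show "cmod (restr \<phi> x) \<le> q n \<phi> * nrm G x" using x by (simp add: restr_def)
qed

text \<open>The tail of the square sum of a nearly norming vector \<open>x\<^sub>0\<close> is small; perturbing \<open>x\<^sub>0\<close> by
  \<open>t y\<close> therefore increases its norm only by \<open>t\<close> times the head of \<open>y\<close> and terms of second
  order in \<open>t\<close>.\<close>

lemma dual_G_dominated:
  assumes \<psi>: "\<psi> \<in> vecs (dual G)" and e: "0 < e"
  shows "\<exists>C\<ge>0. \<forall>y\<in>vecs G. cmod (\<psi> y) \<le> e * nrm G y + C * nrm F y"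
proof -
  define a where "a = nrm (dual G) \<psi>"
  have a: "0 \<le> a" using GD.nrm_ge_0[OF \<psi>] by (simp add: a_def)
  \<comment> \<open>the estimate below leaves an error of \<open>t (1 + 3 a)\<close>, which has to be at most \<open>e\<close>\<close>
  define t where "t = min 1 (e / (1 + 3 * a))"
  have t: "0 < t" "t \<le> 1" "t * (1 + 3 * a) \<le> e"
  proof -
    show "0 < t" "t \<le> 1" using e a by (simp_all add: t_def)
    have "t \<le> e / (1 + 3 * a)" by (simp add: t_def)
    then show "t * (1 + 3 * a) \<le> e" using a by (simp add: pos_le_divide_eq)
  qed
  have t2: "0 < t\<^sup>2" using t by simp
  obtain x1 where x1: "x1 \<in> unit_ball G" "a - t\<^sup>2 < cmod (\<psi> x1)"
  proof -
    have "a - t\<^sup>2 < (SUP x\<in>unit_ball G. cmod (\<psi> x))"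
      using t2 by (simp add: a_def G.dual_nrm_eq)
    then show ?thesis
      using less_cSUP_iff[OF _ G.dual_bdd_above[OF \<psi>]] G.zero_in_unit_ball that by blast
  qed
  obtain x0 where x0: "x0 \<in> vecs G" "nrm G x0 \<le> 1" "\<psi> x0 = of_real (cmod (\<psi> x1))"
  proof (cases "\<psi> x1 = 0")
    case True
    then show ?thesis using that[of x1] x1(1) by (simp add: unit_ball_def)
  next
    case False
    define c where "c = of_real (cmod (\<psi> x1)) / \<psi> x1"
    have "cmod c = 1" "c * \<psi> x1 = of_real (cmod (\<psi> x1))" using False by (simp_all add: c_def norm_divide)
    then show ?thesis
      using that[of "c *\<^sub>C x1"] x1(1) G.dual_scale[OF \<psi>, of x1 c] G.nrm_scaleC[of x1 c] by (simp add: unit_ball_def)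
  qed
  have x0F: "x0 \<in> vecs F" using x0 G_subset_F by blast
  \<comment> \<open>choose \<open>m\<close> so that the tail of the square sum of \<open>x0\<close> is small\<close>
  define Q where "Q k = (\<Sum>n<k. (N n x0)\<^sup>2)" for k
  have QL: "Q k = (L k x0)\<^sup>2" for k
    by (simp add: Q_def L_def L2_set_def sum_nonneg)
  have Q1: "Q k \<le> 1" for k
    unfolding QL using L_le_G_nrm[OF x0(1), of k] x0(2) L_ge_0[of k x0] by (intro power_le_one) auto
  have "bdd_above (range Q)" using Q1 by (intro bdd_aboveI2)
  then obtain m where m: "\<And>k. Q k < Q m + t ^ 4"
  proof -
    assume bdd: "bdd_above (range Q)" and that: "\<And>m. (\<And>k. Q k < Q m + t ^ 4) \<Longrightarrow> thesis"
    have "(SUP k. Q k) - t ^ 4 < (SUP k. Q k)" using t by simp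
    then obtain m where m: "(SUP k. Q k) - t ^ 4 < Q m" using less_cSUP_iff[OF _ bdd] by blast
    have "Q k \<le> (SUP k. Q k)" for k using bdd by (intro cSUP_upper) auto
    then show thesis using m by (intro that[of m]) (smt (verit))
  qed
  define c where "c = a * (\<Sum>n<m. (2::real) ^ n)"
  have c: "0 \<le> c" using a by (simp add: c_def sum_nonneg)
  have unit: "cmod (\<psi> y) \<le> e + a * L m y" if y: "y \<in> vecs G" "nrm G y \<le> 1" for y
  proof -
    have yF: "y \<in> vecs F" using y G_subset_F by blast
    obtain u where u: "cmod u = 1" "u * \<psi> y = of_real (cmod (\<psi> y))"
    proof (cases "\<psi> y = 0")
      case False
      then show ?thesis using that[of "of_real (cmod (\<psi> y)) / \<psi> y"] by (simp add: norm_divide)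
    qed (use that[of 1] in simp)
    define y' where "y' = (of_real t * u) *\<^sub>C y"
    have y'G: "y' \<in> vecs G" and y'F: "y' \<in> vecs F" using y yF by (auto simp: y'_def)
    define h where "h = L m y"
    have h: "0 \<le> h" "h \<le> 1" using L_ge_0 L_le_G_nrm[OF y(1), of m] y(2) by (auto simp: h_def)
    have cu: "cmod (of_real t * u) = t" using u t by (simp add: norm_mult)
    have L'y: "L k y' \<le> t * L k y" for k using L_scale_le[OF yF, of k "of_real t * u"] cu by (simp add: y'_def)
    have "nrm G (x0 + y') \<le> 1 + t * h + 3 * t\<^sup>2"
    proof (rule G_nrm_le)
      fix k0
      define k where "k = max m k0"
      have k: "m \<le> k" "k0 \<le> k" by (simp_all add: k_def)
      define T where "T z = L2_set (\<lambda>n. N n z) {m..<k}" for z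
      have split: "(L k z)\<^sup>2 = (L m z)\<^sup>2 + (T z)\<^sup>2" for z
      proof -
        have "(\<Sum>n<k. (N n z)\<^sup>2) = (\<Sum>n<m. (N n z)\<^sup>2) + (\<Sum>n\<in>{m..<k}. (N n z)\<^sup>2)"
          using k(1) by (simp add: lessThan_atLeast0 sum.atLeastLessThan_concat)
        then show ?thesis by (simp add: L_def T_def L2_set_def sum_nonneg)
      qed
      have T0: "0 \<le> T z" for z by (simp add: T_def L2_set_nonneg)
      have "(T x0)\<^sup>2 \<le> (t\<^sup>2)\<^sup>2" using split[of x0] m[of k] by (simp add: QL)
      then have Tx0: "T x0 \<le> t\<^sup>2" by (rule power2_le_imp_le) simp
      have "(T y')\<^sup>2 \<le> (L k y')\<^sup>2" using split[of y'] by simp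
      then have "T y' \<le> L k y'" by (rule power2_le_imp_le[OF _ L_ge_0])
      also have "\<dots> \<le> t * L k y" by (rule L'y)
      also have "\<dots> \<le> t * 1" using L_le_G_nrm[OF y(1), of k] y(2) t by (intro mult_left_mono) auto
      finally have Ty: "T y' \<le> t" by simp
      have "T (x0 + y') \<le> L2_set (\<lambda>n. N n x0 + N n y') {m..<k}"
        unfolding T_def using N_triangle[OF x0F y'F] N_ge_0 x0F y'F by (intro L2_set_mono) auto
      also have "\<dots> \<le> T x0 + T y'" unfolding T_def by (rule L2_set_triangle_ineq)
      also have "\<dots> \<le> t\<^sup>2 + t" using Tx0 Ty by simp
      also have "\<dots> \<le> 2 * t" using t by (simp add: power2_eq_square mult_left_le)
      finally have tail: "T (x0 + y') \<le> 2 * t" .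
      have "L m (x0 + y') \<le> L m x0 + L m y'" by (rule L_triangle[OF x0F y'F])
      also have "\<dots> \<le> 1 + t * h" using L_le_G_nrm[OF x0(1), of m] x0(2) L'y[of m] by (simp add: h_def)
      finally have head: "L m (x0 + y') \<le> 1 + t * h" .
      have th: "0 \<le> t * h" using t h by simp
      have "(L k (x0 + y'))\<^sup>2 \<le> (1 + t * h)\<^sup>2 + (2 * t)\<^sup>2"
        unfolding split using head tail L_ge_0 T0 by (intro add_mono power_mono) auto
      also have "\<dots> \<le> (1 + t * h + 2 * t\<^sup>2)\<^sup>2"
      proof -
        have "(1 + t * h + 2 * t\<^sup>2)\<^sup>2 = (1 + t * h)\<^sup>2 + 4 * t\<^sup>2 * (1 + t * h) + (2 * t\<^sup>2)\<^sup>2"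
          by (simp add: power2_eq_square algebra_simps)
        moreover have "4 * t\<^sup>2 * 1 \<le> 4 * t\<^sup>2 * (1 + t * h)" using th by (intro mult_left_mono) auto
        moreover have "(2 * t)\<^sup>2 = 4 * t\<^sup>2 * 1" by (simp add: power_mult_distrib)
        moreover have "0 \<le> (2 * t\<^sup>2)\<^sup>2" by simp
        ultimately show ?thesis by linarith
      qed
      finally have "L k (x0 + y') \<le> 1 + t * h + 2 * t\<^sup>2"
        by (rule power2_le_imp_le) (use th t2 in simp)
      then show "L k0 (x0 + y') \<le> 1 + t * h + 3 * t\<^sup>2"
        using L_mono[OF k(2), of "x0 + y'"] t2 by linarith
    qed
    moreover have "\<psi> (x0 + y') = of_real (cmod (\<psi> x1) + t * cmod (\<psi> y))"
      using G.dual_add[OF \<psi> x0(1) y'G] G.dual_scale[OF \<psi> y(1)] x0(3) u(2) by (simp add: y'_def mult.assoc)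
    then have "cmod (\<psi> x1) + t * cmod (\<psi> y) = cmod (\<psi> (x0 + y'))"
      using t by (simp add: norm_of_real del: of_real_add of_real_mult)
    then have "cmod (\<psi> x1) + t * cmod (\<psi> y) \<le> a * nrm G (x0 + y')"
      using G.dual_le[OF \<psi>, of "x0 + y'"] x0(1) y'G by (simp add: a_def)
    ultimately have "cmod (\<psi> x1) + t * cmod (\<psi> y) \<le> a * (1 + t * h + 3 * t\<^sup>2)"
      using mult_left_mono[OF _ a] order_trans by blast
    then have "t * cmod (\<psi> y) \<le> t\<^sup>2 + a * (t * h + 3 * t\<^sup>2)"
      using x1(2) by (simp add: algebra_simps)
    also have "\<dots> = t * (t * (1 + 3 * a) + a * h)" by (simp add: power2_eq_square algebra_simps)
    finally have "cmod (\<psi> y) \<le> t * (1 + 3 * a) + a * h" using t(1) by simp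
    then show ?thesis using t(3) by (simp add: h_def)
  qed
  have "cmod (\<psi> y) \<le> e * nrm G y + c * nrm F y" if y: "y \<in> vecs G" for y
  proof (cases "y = 0")
    case True
    then show ?thesis using G.dual_zero[OF \<psi>] by simp
  next
    case False
    define r where "r = nrm G y"
    have r: "0 < r" using False G.nrm_ge_0[OF y] G.nrm_eq_0_iff[OF y] by (simp add: r_def)
    define v where "v = of_real (inverse r) *\<^sub>C y"
    have v: "v \<in> vecs G" "nrm G v \<le> 1"
      using G.normalized_in_unit_ball[OF y False] by (auto simp: v_def r_def unit_ball_def)
    have vF: "v \<in> vecs F" using v G_subset_F by blast
    have yv: "y = of_real r *\<^sub>C v" using r by (simp add: v_def)
    have "cmod (\<psi> v) \<le> e + a * ((\<Sum>n<m. 2 ^ n) * nrm F v)"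
      using unit[OF v] mult_left_mono[OF L_le_nrm[OF vF, of m] a] by linarith
    then have "cmod (\<psi> v) \<le> e + c * nrm F v" by (simp add: c_def mult.assoc)
    then have "r * cmod (\<psi> v) \<le> r * (e + c * nrm F v)" using r by (intro mult_left_mono) auto
    moreover have "cmod (\<psi> y) = r * cmod (\<psi> v)"
      unfolding yv G.dual_scale[OF \<psi> v(1)] norm_mult norm_of_real using r by simp
    moreover have "nrm F y = r * nrm F v"
      using F.nrm_scaleC[OF vF, of "of_real r"] r unfolding yv by simp
    ultimately show ?thesis by (simp add: r_def algebra_simps)
  qed
  then show ?thesis using c by blast
qed

lemma restr_dense:
  assumes "\<psi> \<in> vecs (dual G)" "0 < e"
  shows "\<exists>\<phi>\<in>vecs (dual F). nrm (dual G) (\<psi> - restr \<phi>) \<le> e"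
proof -
  obtain C where "0 \<le> C" "\<And>y. y \<in> vecs G \<Longrightarrow> cmod (\<psi> y) \<le> e * nrm G y + C * nrm F y"
    using dual_G_dominated[OF assms] by blast
  then obtain \<phi> where \<phi>: "\<phi> \<in> vecs (dual F)" "\<And>y. y \<in> vecs G \<Longrightarrow> cmod (\<psi> y - \<phi> y) \<le> e * nrm G y"
    using split_dominated_functional[OF G.complex_normed_space_axioms F.complex_normed_space_axioms G_subset_F assms(1), of e C] assms(2)
    by (metis less_imp_le)
  have "nrm (dual G) (\<psi> - restr \<phi>) \<le> e"
    using assms(2) \<phi>(2) by (intro G.dual_nrm_le) (auto simp: restr_def)
  then show ?thesis using \<phi>(1) by blast
qed

text \<open>If \<open>\<phi> \<mapsto> \<zeta> (\<phi>|\<^sub>G)\<close> is evaluation at \<open>x\<close>, then testing \<open>\<zeta>\<close> on \<open>\<Sum> N n x \<phi>\<^sub>n\<close> with \<open>\<phi>\<^sub>n\<close> nearly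
  norming for \<open>N n\<close> shows that \<open>x\<close> belongs to \<open>G\<close>.\<close>

lemma representing_vector_in_G:
  assumes \<zeta>: "\<zeta> \<in> vecs (dual (dual G))" and x: "x \<in> vecs F"
    and \<zeta>x: "\<And>\<phi>. \<phi> \<in> vecs (dual F) \<Longrightarrow> \<zeta> (restr \<phi>) = \<phi> x"
  shows "x \<in> vecs G"
proof -
  have "\<exists>\<phi>. \<phi> \<in> vecs (dual F) \<and> q n \<phi> \<le> 1 \<and> (\<exists>r\<ge>N n x / 2. \<phi> x = of_real r)" for n
  proof (cases "N n x = 0")
    case True
    have "q n 0 \<le> 1" using q_scale[OF FD.vzero, of n 0] by simp
    then show ?thesis using True FD.vzero by (intro exI[of _ 0]) (auto intro: exI[of _ 0])
  next
    case False
    then have "N n x / 2 < N n x" using N_ge_0[OF x, of n] by simp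
    then have half: "N n x / 2 < (SUP \<phi>\<in>{\<phi>\<in>vecs (dual F). q n \<phi> \<le> 1}. cmod (\<phi> x))"
      unfolding N_def[symmetric] .
    have "q n 0 \<le> 1" using q_scale[OF FD.vzero, of n 0] by simp
    then have ne: "{\<phi>\<in>vecs (dual F). q n \<phi> \<le> 1} \<noteq> {}" using FD.vzero by blast
    obtain \<phi> where \<phi>: "\<phi> \<in> vecs (dual F)" "q n \<phi> \<le> 1" "N n x / 2 < cmod (\<phi> x)"
      using half unfolding less_cSUP_iff[OF ne N_bdd_above[OF x]] by blast
    have nz: "\<phi> x \<noteq> 0" using \<phi>(3) N_ge_0[OF x, of n] by auto
    define c where "c = of_real (cmod (\<phi> x)) / \<phi> x"
    have c: "cmod c = 1" "c * \<phi> x = of_real (cmod (\<phi> x))" using nz by (simp_all add: c_def norm_divide)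
    show ?thesis
    proof (intro exI conjI)
      show "c *\<^sub>C \<phi> \<in> vecs (dual F)" using \<phi>(1) by blast
      show "q n (c *\<^sub>C \<phi>) \<le> 1" using q_scale[OF \<phi>(1)] c \<phi>(2) by simp
      show "N n x / 2 \<le> cmod (\<phi> x)" using \<phi>(3) by simp
      show "(c *\<^sub>C \<phi>) x = of_real (cmod (\<phi> x))" using c by (simp add: scaleC_functional)
    qed
  qed
  then obtain \<phi> r where \<phi>: "\<And>n. \<phi> n \<in> vecs (dual F)" "\<And>n. q n (\<phi> n) \<le> 1"
    and r: "\<And>n. N n x / 2 \<le> r n" "\<And>n. \<phi> n x = complex_of_real (r n)" by metis
  have "L m x \<le> 2 * nrm (dual (dual G)) \<zeta>" for m
  proof -
    define \<psi> where "\<psi> = (\<Sum>n<m. of_real (N n x) *\<^sub>C \<phi> n)"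
    have \<psi>D: "\<psi> \<in> vecs (dual F)" unfolding \<psi>_def using \<phi>(1) by (intro complex_vector.subspace_sum[OF FD.subspace]) blast
    have app: "\<psi> y = (\<Sum>n<m. of_real (N n x) * \<phi> n y)" for y
    proof -
      have "\<psi> y = (\<Sum>n<m. (of_real (N n x) *\<^sub>C \<phi> n) y)" unfolding \<psi>_def by (induction m) auto
      then show ?thesis by (simp add: scaleC_functional)
    qed
    have "nrm (dual G) (restr \<psi>) \<le> L m x"
    proof (rule G.dual_nrm_le[OF L_ge_0])
      fix y assume y: "y \<in> vecs G"
      then have yF: "y \<in> vecs F" using G_subset_F by blast
      have "cmod (\<psi> y) \<le> (\<Sum>n<m. cmod (of_real (N n x) * \<phi> n y))" unfolding app by (rule norm_sum)
      also have "\<dots> \<le> (\<Sum>n<m. \<bar>N n x\<bar> * \<bar>N n y\<bar>)"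
      proof (rule sum_mono)
        fix n
        have "cmod (\<phi> n y) \<le> q n (\<phi> n) * N n y" using functional_le_N[OF \<phi>(1) yF] .
        also have "\<dots> \<le> 1 * N n y" using \<phi>(2) N_ge_0[OF yF] by (intro mult_right_mono)
        finally show "cmod (of_real (N n x) * \<phi> n y) \<le> \<bar>N n x\<bar> * \<bar>N n y\<bar>"
          using N_ge_0[OF yF, of n] by (simp add: norm_mult mult_left_mono)
      qed
      also have "\<dots> \<le> L m x * L m y" unfolding L_def by (rule L2_set_mult_ineq)
      also have "\<dots> \<le> L m x * nrm G y" using L_le_G_nrm[OF y] L_ge_0 by (intro mult_left_mono)
      finally show "cmod (restr \<psi> y) \<le> L m x * nrm G y" using y by (simp add: restr_def)
    qed
    then have "nrm (dual (dual G)) \<zeta> * nrm (dual G) (restr \<psi>) \<le> nrm (dual (dual G)) \<zeta> * L m x"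
      using complex_normed_space.dual_nrm_ge_0[OF G.dual_normed \<zeta>] by (intro mult_left_mono)
    then have up: "cmod (\<psi> x) \<le> nrm (dual (dual G)) \<zeta> * L m x"
      using GD.dual_le[OF \<zeta> restr_in_dual[OF \<psi>D]] \<zeta>x[OF \<psi>D] by simp
    have "(L m x)\<^sup>2 / 2 = (\<Sum>n<m. N n x * (N n x / 2))"
      by (simp add: L_def L2_set_def sum_nonneg power2_eq_square sum_divide_distrib)
    also have "\<dots> \<le> (\<Sum>n<m. N n x * r n)" using r(1) N_ge_0[OF x] by (intro sum_mono mult_left_mono)
    also have "\<dots> \<le> cmod (of_real (\<Sum>n<m. N n x * r n))" unfolding norm_of_real by (rule abs_ge_self)
    also have "of_real (\<Sum>n<m. N n x * r n) = \<psi> x" unfolding app r(2) by simp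
    finally have "L m x * L m x \<le> (2 * nrm (dual (dual G)) \<zeta>) * L m x" using up by (simp add: power2_eq_square)
    then show ?thesis
      using L_ge_0[of m x] complex_normed_space.dual_nrm_ge_0[OF G.dual_normed \<zeta>]
      by (cases "L m x = 0") (auto simp: mult_le_cancel_right)
  qed
  then show ?thesis unfolding mem_G_iff using x by blast
qed

text \<open>A functional \<open>\<zeta>\<close> on the dual of \<open>G\<close> induces \<open>\<phi> \<mapsto> \<zeta> (restr \<phi>)\<close> on the dual of \<open>F\<close>, which for every \<open>n\<close> is
  bounded by a multiple \<open>k\<close> of \<open>q n\<close>.  Since the norm has the factor \<open>2\<^sup>-\<^sup>n\<close> in \<open>q n\<close>, Krein's theorem
  shows that it is evaluation at some \<open>x\<close>.  This \<open>x\<close> lies in \<open>G\<close>, and \<open>\<zeta>\<close> is evaluation at \<open>x\<close>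
  because the restricted functionals are dense in the dual of \<open>G\<close>.\<close>

lemma G_reflexive:
  assumes wc: "relatively_weakly_compact F (f ` U)"
  shows "reflexive G"
proof -
  have "\<exists>x\<in>vecs G. \<zeta> = eval_at (dual G) x" if \<zeta>: "\<zeta> \<in> vecs (dual (dual G))" for \<zeta>
  proof -
    define k where "k = nrm (dual (dual G)) \<zeta>"
    have k: "0 \<le> k" unfolding k_def using complex_normed_space.dual_nrm_ge_0[OF G.dual_normed \<zeta>] .
    define z where "z = (\<lambda>\<phi>. if \<phi> \<in> vecs (dual F) then \<zeta> (restr \<phi>) else 0)"
    have \<zeta>q: "cmod (\<zeta> (restr \<phi>)) \<le> k * q n \<phi>" if "\<phi> \<in> vecs (dual F)" for \<phi> n
      using GD.dual_le[OF \<zeta> restr_in_dual[OF that]] mult_left_mono[OF restr_nrm_le_q[OF that, of n] k]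
      by (simp add: k_def)
    have z: "z \<in> vecs (dual (dual F))"
      unfolding z_def
    proof (rule FD.restrict_in_dual[where K = "k * (nrm (Hinf E U F) f + 1)"])
      show "\<zeta> (restr (\<phi> + \<psi>)) = \<zeta> (restr \<phi>) + \<zeta> (restr \<psi>)" if "\<phi> \<in> vecs (dual F)" "\<psi> \<in> vecs (dual F)" for \<phi> \<psi>
      proof -
        have "restr (\<phi> + \<psi>) = restr \<phi> + restr \<psi>" by (auto simp: restr_def fun_eq_iff)
        then show ?thesis using GD.dual_add[OF \<zeta>] restr_in_dual that by simp
      qed
      show "\<zeta> (restr (a *\<^sub>C \<phi>)) = a * \<zeta> (restr \<phi>)" if "\<phi> \<in> vecs (dual F)" for a \<phi>
      proof -
        have "restr (a *\<^sub>C \<phi>) = a *\<^sub>C restr \<phi>" by (auto simp: restr_def fun_eq_iff scaleC_functional)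
        then show ?thesis using GD.dual_scale[OF \<zeta>] restr_in_dual that by simp
      qed
      show "cmod (\<zeta> (restr \<phi>)) \<le> k * (nrm (Hinf E U F) f + 1) * nrm (dual F) \<phi>" if "\<phi> \<in> vecs (dual F)" for \<phi>
        using \<zeta>q[OF that, of 0] mult_left_mono[OF q_zero_le[OF that] k] by (simp add: mult.assoc)
    qed
    have "is_evaluation F z"
    proof (rule F.krein_evaluation[OF wc _ z])
      show "nrm F y \<le> nrm (Hinf E U F) f" if "y \<in> f ` U" for y using Hinf_le[OF f] that by blast
      fix e :: real assume e: "0 < e"
      obtain n where "(1/2::real) ^ n < e / (k + 1)"
        using real_arch_pow_inv[of "e / (k + 1)" "1/2"] e k by auto
      then have "(k + 1) * (1/2) ^ n < e" using k by (simp add: field_simps)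
      moreover have "k * (1/2) ^ n \<le> (k + 1) * (1/2::real) ^ n" by (intro mult_right_mono) auto
      ultimately have n: "k * (1/2) ^ n \<le> e" by linarith
      show "\<exists>C\<ge>0. \<forall>\<phi>\<in>vecs (dual F). \<forall>b\<ge>0. (\<forall>x\<in>f ` U. cmod (\<phi> x) \<le> b) \<longrightarrow>
          cmod (z \<phi>) \<le> C * b + e * nrm (dual F) \<phi>"
      proof (intro exI[of _ "k * 2 ^ n"] conjI ballI allI impI)
        fix \<phi> and b :: real assume \<phi>: "\<phi> \<in> vecs (dual F)" and b: "0 \<le> b" "\<forall>x\<in>f ` U. cmod (\<phi> x) \<le> b"
        have "nrm H (\<phi> \<circ> f) \<le> b" using comp_nrm_le_sup[OF b(1)] b(2) by blast
        then have "(k * 2 ^ n) * nrm H (\<phi> \<circ> f) \<le> (k * 2 ^ n) * b" using k by (intro mult_left_mono) auto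
        moreover have "(k * (1/2) ^ n) * nrm (dual F) \<phi> \<le> e * nrm (dual F) \<phi>"
          using n FD.nrm_ge_0[OF \<phi>] by (rule mult_right_mono)
        moreover have "k * q n \<phi> = (k * 2 ^ n) * nrm H (\<phi> \<circ> f) + (k * (1/2) ^ n) * nrm (dual F) \<phi>"
          by (simp add: q_def algebra_simps)
        ultimately show "cmod (z \<phi>) \<le> k * 2 ^ n * b + e * nrm (dual F) \<phi>"
          using \<zeta>q[OF \<phi>, of n] \<phi> by (simp add: z_def)
      qed (use k in simp)
    qed
    then obtain x where xF: "x \<in> vecs F" and zx: "\<And>\<phi>. \<phi> \<in> vecs (dual F) \<Longrightarrow> \<zeta> (restr \<phi>) = \<phi> x"
      unfolding is_evaluation_def z_def by auto
    have xG: "x \<in> vecs G" using representing_vector_in_G[OF \<zeta> xF zx] .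
    have "\<zeta> \<psi> = eval_at (dual G) x \<psi>" for \<psi>
    proof (cases "\<psi> \<in> vecs (dual G)")
      case True
      define c where "c = k + nrm G x + 1"
      have c: "0 < c" using k G.nrm_ge_0[OF xG] by (simp add: c_def)
      have "cmod (\<zeta> \<psi> - \<psi> x) \<le> 0 + e" if e: "0 < e" for e
      proof -
        obtain \<phi> where \<phi>: "\<phi> \<in> vecs (dual F)" "nrm (dual G) (\<psi> - restr \<phi>) \<le> e / c"
          using restr_dense[OF True, of "e / c"] e c by auto
        have d: "\<psi> - restr \<phi> \<in> vecs (dual G)" using True restr_in_dual[OF \<phi>(1)] by blast
        have "\<zeta> \<psi> - \<psi> x = \<zeta> (\<psi> - restr \<phi>) - (\<psi> - restr \<phi>) x"
          using GD.dual_diff[OF \<zeta> True restr_in_dual[OF \<phi>(1)]] zx[OF \<phi>(1)] xG by (simp add: restr_def)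
        then have "cmod (\<zeta> \<psi> - \<psi> x) \<le> cmod (\<zeta> (\<psi> - restr \<phi>)) + cmod ((\<psi> - restr \<phi>) x)"
          using norm_triangle_ineq4 by metis
        also have "\<dots> \<le> k * nrm (dual G) (\<psi> - restr \<phi>) + nrm (dual G) (\<psi> - restr \<phi>) * nrm G x"
          unfolding k_def using GD.dual_le[OF \<zeta> d] G.dual_le[OF d xG] by (rule add_mono)
        also have "\<dots> \<le> c * nrm (dual G) (\<psi> - restr \<phi>)"
          using GD.nrm_ge_0[OF d] by (simp add: c_def algebra_simps)
        also have "\<dots> \<le> c * (e / c)" using \<phi>(2) c by (intro mult_left_mono) auto
        finally show ?thesis using c by simp
      qed
      then have "cmod (\<zeta> \<psi> - \<psi> x) \<le> 0" by (rule field_le_epsilon)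
      then show ?thesis using True by (simp add: eval_at_def)
    next
      case False
      then show ?thesis using GD.dual_off[OF \<zeta>] by (simp add: eval_at_def)
    qed
    then show ?thesis using xG by blast
  qed
  then show ?thesis
    unfolding reflexive_def using G.eval_at_dual_dual by blast
qed

text \<open>Applied to a functional \<open>\<phi>\<close>, the remainder in the derivative of \<open>f\<close> is bounded by a Cauchy
  estimate in terms of the supremum of \<open>\<phi> \<circ> f\<close>, and such bounds control the norm of \<open>G\<close>.\<close>

lemma f_in_Hinf_G: "f \<in> vecs (Hinf E U G)"
proof -
  have fG: "f x \<in> vecs G" "nrm G (f x) \<le> 2 * 1" if x: "x \<in> U" for x
  proof -
    have "cmod (\<phi> (f x)) \<le> 1 * nrm H (\<phi> \<circ> f)" if "\<phi> \<in> vecs (dual F)" for \<phi>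
      using Hinf_le[OF comp_closed[OF that] x] by simp
    from in_G_if_dominated[OF f_closed[OF x] _ this]
    show "f x \<in> vecs G" "nrm G (f x) \<le> 2 * 1" by simp_all
  qed
  have "\<exists>A\<in>bounded_ops E G. frechet_at E U G f x A" if x: "x \<in> U" for x
  proof -
    have xE: "x \<in> vecs E" using x U_subset by blast
    obtain A where A: "A \<in> bounded_ops E F" and fr: "frechet_at E U F f x A"
      using f x unfolding mem_Hinf_iff holomorphic_map_iff by blast
    note A' = bounded_ops_closed[OF A]
    obtain r where r: "0 < r" "\<And>v. v \<in> vecs E \<Longrightarrow> nrm E v < r \<Longrightarrow> x + v \<in> U" using ball_subset_U[OF x] by blast
    have \<phi>A: "\<phi> \<circ> A \<in> bounded_ops E complex_field" "frechet_at E U complex_field (\<phi> \<circ> f) x (\<phi> \<circ> A)"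
      if "\<phi> \<in> vecs (dual F)" for \<phi>
    proof -
      have \<phi>: "\<phi> \<in> bounded_ops F complex_field" using that by (simp add: vecs_dual)
      show "\<phi> \<circ> A \<in> bounded_ops E complex_field"
        using bounded_ops_comp[OF E.complex_normed_space_axioms F.complex_normed_space_axioms A \<phi>] .
      show "frechet_at E U complex_field (\<phi> \<circ> f) x (\<phi> \<circ> A)"
        by (rule frechet_at_comp[OF E.complex_normed_space_axioms F.complex_normed_space_axioms U_subset \<phi> f_closed x A fr])
    qed
    have AG: "A w \<in> vecs G" "nrm G (A w) \<le> 2 * (2 / r * nrm E w)" if w: "w \<in> vecs E" for w
    proof -
      have "cmod (\<phi> (A w)) \<le> (2 / r * nrm E w) * nrm H (\<phi> \<circ> f)" if "\<phi> \<in> vecs (dual F)" for \<phi>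
        using derivative_bound[OF comp_closed[OF that] x r \<phi>A[OF that] w] by simp
      moreover have "0 \<le> 2 / r * nrm E w" using r(1) E.nrm_ge_0[OF w] by simp
      ultimately show "A w \<in> vecs G" "nrm G (A w) \<le> 2 * (2 / r * nrm E w)"
        using in_G_if_dominated[OF A'(1)[OF w]] by blast+
    qed
    have "A \<in> bounded_ops E G"
      unfolding mem_bounded_ops_iff
    proof (intro conjI ballI allI impI)
      show "\<exists>K. \<forall>w\<in>vecs E. nrm G (A w) \<le> K * nrm E w"
        using AG(2) by (intro exI[of _ "2 * (2 / r)"]) (simp add: mult.assoc)
    qed (use AG A' in auto)
    moreover have "frechet_at E U G f x A"
      unfolding frechet_at_def
    proof (intro allI impI)
      fix \<epsilon> :: real assume \<epsilon>: "0 < \<epsilon>"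
      define \<delta> where "\<delta> = min (r / 2) (\<epsilon> * r\<^sup>2 / 16)"
      have \<delta>: "0 < \<delta>" using r(1) \<epsilon> by (simp add: \<delta>_def)
      show "\<exists>\<delta>>0. \<forall>y\<in>U. nrm E (y - x) < \<delta> \<longrightarrow> nrm G (f y - f x - A (y - x)) \<le> \<epsilon> * nrm E (y - x)"
      proof (intro exI[of _ \<delta>] conjI ballI impI \<delta>)
        fix y assume y: "y \<in> U" "nrm E (y - x) < \<delta>"
        define w where "w = y - x"
        have w: "w \<in> vecs E" "nrm E w < r / 2" "nrm E w \<le> \<epsilon> * r\<^sup>2 / 16"
          using y U_subset xE by (auto simp: w_def \<delta>_def)
        have yxw: "y = x + w" by (simp add: w_def)
        have w0: "0 \<le> nrm E w" using E.nrm_ge_0[OF w(1)] .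
        have vF: "f y - f x - A w \<in> vecs F" using f_closed x y A'(1)[OF w(1)] by blast
        have "cmod (\<phi> (f y - f x - A w)) \<le> (8 / r\<^sup>2 * (nrm E w)\<^sup>2) * nrm H (\<phi> \<circ> f)" if \<phi>: "\<phi> \<in> vecs (dual F)" for \<phi>
        proof -
          have "\<phi> (f y - f x - A w) = (\<phi> \<circ> f) (x + w) - (\<phi> \<circ> f) x - (\<phi> \<circ> A) w"
            using F.dual_diff[OF \<phi>] f_closed x y A'(1)[OF w(1)] yxw by simp
          then show ?thesis using remainder_bound[OF comp_closed[OF \<phi>] x r \<phi>A[OF \<phi>] w(1,2)] by simp
        qed
        then have "nrm G (f y - f x - A w) \<le> 2 * (8 / r\<^sup>2 * (nrm E w)\<^sup>2)"
          by (intro in_G_if_dominated(2)[OF vF]) auto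
        also have "\<dots> = (16 / r\<^sup>2 * nrm E w) * nrm E w" by (simp add: power2_eq_square)
        also have "\<dots> \<le> \<epsilon> * nrm E w"
        proof (rule mult_right_mono[OF _ w0])
          have "16 / r\<^sup>2 * nrm E w \<le> 16 / r\<^sup>2 * (\<epsilon> * r\<^sup>2 / 16)" using w(3) by (intro mult_left_mono) auto
          also have "\<dots> = \<epsilon>" using r(1) by simp
          finally show "16 / r\<^sup>2 * nrm E w \<le> \<epsilon>" .
        qed
        finally show "nrm G (f y - f x - A (y - x)) \<le> \<epsilon> * nrm E (y - x)" by (simp add: w_def)
      qed
    qed
    ultimately show ?thesis by blast
  qed
  then have "holomorphic_map E U G f" unfolding holomorphic_map_iff using fG(1) by blast
  then show ?thesis unfolding mem_Hinf_iff using fG(2) f_off by blast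
qed

lemma factors_through_reflexive:
  assumes "relatively_weakly_compact F (f ` U)"
  shows "complex_banach_space G \<and> reflexive G \<and> factors_through E U F f G"
proof (intro conjI G_banach G_reflexive[OF assms])
  define T where "T x = (if x \<in> vecs G then x else 0)" for x
  have "\<exists>K. \<forall>x\<in>vecs G. nrm F x \<le> K * nrm G x" using F_nrm_le_G_nrm by blast
  then have "T \<in> bounded_ops G F"
    unfolding mem_bounded_ops_iff T_def using G_subset_F by auto
  moreover have "f = T \<circ> f"
  proof
    fix x show "f x = (T \<circ> f) x"
      using f_in_Hinf_G f_off by (cases "x \<in> U") (auto simp: T_def mem_Hinf_iff holomorphic_map_iff)
  qed
  ultimately show "factors_through E U F f G"
    unfolding factors_through_def using f_in_Hinf_G by blast
qed

end

section \<open>The equivalences\<close>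

theorem theorem2p7:
  fixes E :: "'a::complex_vector cnspace"
    and F :: "'b::complex_vector cnspace"
    and U :: "'a set" and f :: "'a \<Rightarrow> 'b"
  assumes E: "complex_banach_space E" and F: "complex_banach_space F"
    and U: "openin (norm_topology E) U"
    and f: "f \<in> vecs (Hinf E U F)"
  shows
    "(relatively_weakly_compact F (f ` U) \<longleftrightarrow>
        weakly_compact_op (Ginf E U) F (linearization E U F f)) \<and>
     (relatively_weakly_compact F (f ` U) \<longleftrightarrow>
        (\<exists>G :: 'b cnspace. complex_banach_space G \<and> reflexive G \<and> factors_through E U F f G)) \<and>
     (relatively_weakly_compact F (f ` U) \<longleftrightarrow>
        weakly_compact_op (dual F) (Hinf_scalar E U) (transpose_map F f)) \<and>
     (relatively_weakly_compact F (f ` U) \<longleftrightarrow>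
        continuous_map (weak_star_topology F) (weak_topology (Hinf_scalar E U))
          (transpose_map F f)) \<and>
     (\<forall>G :: 'g::complex_vector cnspace.
        complex_banach_space G \<and> reflexive G \<and> factors_through E U F f G \<longrightarrow>
          relatively_weakly_compact F (f ` U))"
proof -
  interpret bounded_holomorphic E F U f
    using E F U f by (simp add: bounded_holomorphic_def bounded_holomorphic_axioms_def)
  let ?c1 = "relatively_weakly_compact F (f ` U)"
  have c1: "?c1 \<longleftrightarrow> representable"
    using representable_if_range_compact linearization_weakly_compact_if_representable
      range_compact_if_linearization_weakly_compact by blast
  moreover have "representable \<longleftrightarrow> weakly_compact_op (Ginf E U) F (linearization E U F f)"
    using c1 linearization_weakly_compact_if_representable
      range_compact_if_linearization_weakly_compact by blast
  moreover have "representable \<longleftrightarrow>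
      (\<exists>G :: 'b cnspace. complex_banach_space G \<and> reflexive G \<and> factors_through E U F f G)"
    using c1 factors_through_reflexive representable_if_factors by blast
  moreover have "representable \<longleftrightarrow> weakly_compact_op (dual F) H (transpose_map F f)"
    using transpose_continuous_if_representable transpose_weakly_compact_if_continuous
      representable_if_transpose_weakly_compact by blast
  moreover have "representable \<longleftrightarrow>
      continuous_map (weak_star_topology F) (weak_topology H) (transpose_map F f)"
    using transpose_continuous_if_representable transpose_weakly_compact_if_continuous
      representable_if_transpose_weakly_compact by blast
  moreover have "?c1" if "complex_banach_space G" "reflexive G" "factors_through E U F f G"
    for G :: "'g::complex_vector cnspace"
    using c1 representable_if_factors[OF that] by blast
  ultimately show ?thesis by blast
qed

end
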